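(* There is an absolute constant $c>0$ such that the following holds for every integer $N\ge 2$. If $A\subset[N]=\{1,\ldots,N\}$ contains no non-trivial solution to the equation $x+y+z=3w$, then \[ |A| \le \frac{N}{\exp\left(c(\log N)^{1/7}\right)}. \]
   Context: A solution $(x,y,z,w)\in A^4$ to $x+y+z=3w$ is called trivial if $x=y=z=w$, and non-trivial otherwise (i.e. the variables are not all equal).
   Formalization: The inclusion A ⊂ [N] is taken to be proper; this excludes only N = 2, A = {1,2}, for which the stated bound fails, since for N ≥ 3 a set without non-trivial solutions is automatically a proper subset of [N]. *)

theory Defs
  imports Complex_Main
begin

definition is_solution :: "nat set \<Rightarrow> nat \<times> nat \<times> nat \<times> nat \<Rightarrow> bool" where
  "is_solution A = (\<lambda>(x, y, z, w). x \<in> A \<and> y \<in> A \<and> z \<in> A \<and> w \<in> A \<and> x + y + z = 3 * w)"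

definition trivial :: "nat \<times> nat \<times> nat \<times> nat \<Rightarrow> bool" where
  "trivial = (\<lambda>(x, y, z, w). x = y \<and> y = z \<and> z = w)"

text \<open>
  The inclusion of \<open>A\<close> in \<open>[N]\<close> has to be read as proper: \<open>{1, 2}\<close> has no non-trivial solution,
  so with a non-proper inclusion the bound at \<open>N = 2\<close> would say \<open>2 \<le> 2 / exp (c * (ln 2) powr (1 / 7))\<close>,
  which fails for every \<open>c > 0\<close>. For \<open>N \<ge> 3\<close> the two readings agree, as \<open>[N]\<close> contains \<open>1 + 2 + 3 = 3 * 2\<close>.
\<close>

lemma no_nontrivial_solution_1_2: "\<not> (\<exists>s. is_solution {1, 2} s \<and> \<not> trivial s)"
  by (auto simp: is_solution_def trivial_def)

lemma proper_subset_if_no_nontrivial_solution: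
  assumes "N \<ge> 3" "A \<subseteq> {1..N}" "\<not> (\<exists>s. is_solution A s \<and> \<not> trivial s)"
  shows "A \<subset> {1..N}"
proof -
  have "\<not> trivial (1, 2, 3, 2)"
    by (simp add: trivial_def)
  moreover have "is_solution {1..N} (1, 2, 3, 2)"
    using assms(1) by (simp add: is_solution_def)
  ultimately show ?thesis
    using assms(2,3) by blast
qed

end

theory Submission
  imports Defs "HOL-Analysis.Analysis"
begin

text \<open>
  Density increment on Bohr sets. Let \<open>A\<close> have density \<open>\<alpha>\<close> on a Bohr set \<open>B\<close>, and suppose that no translate of
  a slightly smaller Bohr set carries density more than \<open>1.01 \<alpha>\<close>. Centring \<open>A\<close> at a typical point, one finds
  a set \<open>Y\<close> of density about \<open>\<alpha>\<^sup>2\<close> in a small Bohr set and a shift \<open>c\<close> with \<open>3 Y \<subseteq> A\<close> and \<open>Y + c \<subseteq> A\<close>. Put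
  \<open>P = A \<inter> B\<close> and let \<open>F u\<close> be the proportion of \<open>y \<in> Y\<close> with \<open>u + 3 y \<in> P + 3 Y\<close>. Then \<open>F = 1\<close> on \<open>P\<close>, while
  \<open>F (3 c - a) < 1 / 2\<close> for \<open>a \<in> A\<close>, since otherwise \<open>a + p + 3 y' = 3 (c + y)\<close> would be a non-trivial solution
  in \<open>A\<close>. By Croot--Sisask sampling, \<open>F\<close> is almost invariant, outside a set of exponentially small measure,
  under differences of a dense set \<open>T\<close>; averaging \<open>F\<close> repeatedly over such differences kills all Fourier
  coefficients outside the large spectrum of \<open>T\<close>, and by Chang's theorem relative to Bohr sets that spectrum
  is annihilated by a Bohr set \<open>V\<close> of slightly larger rank. So \<open>P\<close> and the reflection \<open>3 c - A\<close> live on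
  almost disjoint translates of \<open>3 V\<close>; as they live in almost the same Bohr set, one of them must be
  concentrated, which contradicts the assumption. Each step costs rank \<open>O (log\<^sup>4 (1 / \<alpha>))\<close> and a radius
  factor \<open>\<alpha>\<close> to a constant power, and there are \<open>O (log (1 / \<alpha>))\<close> steps, whence \<open>log N = O (log\<^sup>7 (1 / \<alpha>))\<close>.
\<close>

section \<open>Bohr sets of integers\<close>

text \<open>The fourth power in the rank cost comes from the sampling. With m about log (1 /
  \<alpha>), pushing the coefficients outside the large spectrum below a power of \<alpha> takes m
  averagings. Each of them may then move F by only O (1 / m), outside a set of measure exp (- O
  (m)), and this accuracy takes about m^3 samples. One sample costs a factor exp (O (m)) in the
  density of T, and Chang's bound is the logarithm of that density: O (m^4) new frequencies. After O
  (m) increments the rank is O (m^5), while the logarithm of the inverse radius is O (m^2); the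
  product of the two is what log N has to exceed. The two conditions on Y are dictated by the
  equation: 3 Y supplies a variable on the left and 3 (c + Y) the right-hand side, so the same
  dilate 3 Y builds the sumset and tests membership in it.\<close>

text \<open>
  The condition \<open>\<bar>x\<bar> \<le> r * R\<close> plays the role of one more frequency, so the rank of \<open>bohr G R r\<close> is
  \<open>card G + 1\<close>. Working in the integers instead of a cyclic group makes the dilation by 3 harmless.
\<close>


definition bohr :: "real set \<Rightarrow> real \<Rightarrow> real \<Rightarrow> int set" where
  "bohr G R r = {x. \<bar>real_of_int x\<bar> \<le> r * R \<and> (\<forall>t\<in>G. cmod (1 - cis (t * real_of_int x)) \<le> r)}"

lemma finite_bohr [simp]: "finite (bohr G R r)"
proof (rule finite_subset)
  show "bohr G R r \<subseteq> {-\<lceil>r * R\<rceil>..\<lceil>r * R\<rceil>}"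
    by (auto simp: bohr_def abs_le_iff) linarith+
qed simp

lemma zero_in_bohr [simp]: "0 \<le> r \<Longrightarrow> 0 \<le> R \<Longrightarrow> 0 \<in> bohr G R r"
  by (simp add: bohr_def)

lemma card_bohr_pos: "0 \<le> r \<Longrightarrow> 0 \<le> R \<Longrightarrow> 0 < card (bohr G R r)"
  using zero_in_bohr[of r R G] by (auto simp: card_gt_0_iff simp del: zero_in_bohr)

lemma bohr_mono: "r \<le> s \<Longrightarrow> 0 \<le> R \<Longrightarrow> H \<subseteq> G \<Longrightarrow> bohr G R r \<subseteq> bohr H R s"
  unfolding bohr_def by safe (meson order_trans mult_right_mono, meson order_trans subsetD)

lemma cmod_cis_diff: "cmod (cis a - cis b) = cmod (1 - cis (a - b))"
proof -
  have "cis a - cis b = - (cis b * (1 - cis (a - b)))"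
    by (simp add: algebra_simps cis_mult)
  then show ?thesis
    by (simp add: norm_mult)
qed

lemma cmod_one_minus_cis_minus: "cmod (1 - cis (- a)) = cmod (1 - cis a)"
  using cmod_cis_diff[of 0 a] by (simp add: norm_minus_commute)

lemma cmod_one_minus_cis_add: "cmod (1 - cis (a + b)) \<le> cmod (1 - cis a) + cmod (1 - cis b)"
proof -
  have "1 - cis (a + b) = (1 - cis a) + cis a * (1 - cis b)"
    by (simp add: algebra_simps cis_mult)
  then have "cmod (1 - cis (a + b)) \<le> cmod (1 - cis a) + cmod (cis a * (1 - cis b))"
    by (metis norm_triangle_ineq)
  then show ?thesis
    by (simp add: norm_mult)
qed

lemma bohr_uminus: "x \<in> bohr G R r \<Longrightarrow> - x \<in> bohr G R r"
  by (simp add: bohr_def cmod_one_minus_cis_minus)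

lemma bohr_add: "x \<in> bohr G R r \<Longrightarrow> y \<in> bohr G R s \<Longrightarrow> x + y \<in> bohr G R (r + s)"
  unfolding bohr_def
  by (auto simp: distrib_left distrib_right intro: order_trans[OF cmod_one_minus_cis_add] add_mono)

lemma bohr_diff: "x \<in> bohr G R r \<Longrightarrow> y \<in> bohr G R s \<Longrightarrow> x - y \<in> bohr G R (r + s)"
  using bohr_add[of x G R r "- y" s] bohr_uminus[of y] by simp

lemma bohr_triple: "x \<in> bohr G R r \<Longrightarrow> 3 * x \<in> bohr G R (3 * r)"
  using bohr_add[OF bohr_add[of x G R r x r], of x r] by (simp add: algebra_simps)

section \<open>Covering and doubling of Bohr sets\<close>

lemma pigeonhole_fibre:
  assumes "finite C" "finite B" "B \<noteq> {}" "\<And>x. x \<in> C \<Longrightarrow> f x \<in> B"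
  shows "\<exists>C'\<subseteq>C. card C \<le> card B * card C' \<and> (\<forall>x\<in>C'. \<forall>y\<in>C'. f x = f y)"
proof -
  obtain y where "y \<in> B" "card C \<le> card (f -` {y} \<inter> C) * card B"
    using pigeonhole_card[of f C B] assms by auto
  then show ?thesis
    by (intro exI[of _ "f -` {y} \<inter> C"]) (auto simp: mult.commute)
qed

lemma floor_eq_imp_diff_less:
  assumes "\<lfloor>(a::real) / s\<rfloor> = \<lfloor>b / s\<rfloor>" "s > 0"
  shows "\<bar>a - b\<bar> < s"
proof -
  have "\<bar>a / s - b / s\<bar> < 1"
    using assms(1) by linarith
  then have "\<bar>(a - b) / s\<bar> < 1"
    by (simp add: diff_divide_distrib)
  then show ?thesis
    using assms(2) by (simp add: abs_divide)
qed

text \<open>Each condition costs one pigeonhole: 5 cells of length \<open>r * R\<close> for the size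
  of \<open>x\<close>, then 9 * 9 squares of side \<open>r / 2\<close> for each frequency, both
  counts below 100. An arbitrary \<open>C\<close> is allowed so that the induction on
  \<open>G\<close> can continue inside a fibre.\<close>

lemma bohr_pigeonhole:
  assumes "finite G" "finite C" "R > 0" "r > 0" "C \<subseteq> bohr G R (2 * r)"
  shows "\<exists>C'\<subseteq>C. card C \<le> 100 ^ (card G + 1) * card C' \<and> (\<forall>x\<in>C'. \<forall>y\<in>C'. x - y \<in> bohr G R r)"
  using assms(1,2,5)
proof (induction G arbitrary: C rule: finite_induct)
  case empty
  let ?f = "\<lambda>x::int. \<lfloor>real_of_int x / (r * R)\<rfloor>"
  have rR: "r * R > 0"
    using assms by simp
  have im: "?f x \<in> {-2..2}" if "x \<in> C" for x
  proof -
    have "\<bar>real_of_int x\<bar> \<le> 2 * (r * R)"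
      using that empty.prems(2) by (auto simp: bohr_def)
    then have "\<bar>real_of_int x / (r * R)\<bar> \<le> 2"
      using rR by (simp add: abs_divide pos_divide_le_eq del: abs_of_pos)
    then have "-2 \<le> real_of_int x / (r * R)" "real_of_int x / (r * R) \<le> 2"
      by linarith+
    then show ?thesis
      unfolding atLeastAtMost_iff by linarith
  qed
  have "\<exists>C'\<subseteq>C. card C \<le> card {-2..2::int} * card C' \<and> (\<forall>x\<in>C'. \<forall>y\<in>C'. ?f x = ?f y)"
    by (rule pigeonhole_fibre) (fact empty.prems(1), simp, simp, fact im)
  then obtain C' where C': "C' \<subseteq> C" "card C \<le> card {-2..2::int} * card C'"
    "\<forall>x\<in>C'. \<forall>y\<in>C'. ?f x = ?f y"
    by blast
  have "x - y \<in> bohr {} R r" if "x \<in> C'" "y \<in> C'" for x y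
  proof -
    have "?f x = ?f y"
      using C'(3) that by blast
    then have "\<bar>real_of_int x - real_of_int y\<bar> < r * R"
      using rR by (rule floor_eq_imp_diff_less)
    then show ?thesis
      by (simp add: bohr_def)
  qed
  moreover have "card C \<le> 100 * card C'"
    using C'(2) by simp
  ultimately show ?case
    using C'(1) by (intro exI[of _ C']) auto
next
  case (insert t G)
  have "bohr (insert t G) R (2 * r) \<subseteq> bohr G R (2 * r)"
    by (auto simp: bohr_def)
  then obtain C1 where C1: "C1 \<subseteq> C" "card C \<le> 100 ^ (card G + 1) * card C1"
    "\<forall>x\<in>C1. \<forall>y\<in>C1. x - y \<in> bohr G R r"
    using insert.IH[of C] insert.prems by auto
  let ?z = "\<lambda>x::int. cis (t * real_of_int x)"
  let ?f = "\<lambda>x::int. (\<lfloor>Re (?z x) / (r / 2)\<rfloor>, \<lfloor>Im (?z x) / (r / 2)\<rfloor>)"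
  \<comment> \<open>\<open>?z x\<close> is within \<open>2 * r\<close> of 1, so its real part in
    units of \<open>r / 2\<close> is within 4 of \<open>2 / r\<close>; hence the shifted
    window.\<close>
  let ?B = "{\<lfloor>2 / r\<rfloor> - 4..\<lfloor>2 / r\<rfloor> + 4} \<times> {-4..4::int}"
  have im: "?f x \<in> ?B" if "x \<in> C1" for x
  proof -
    have "cmod (1 - ?z x) \<le> 2 * r"
      using that C1(1) insert.prems(2) by (auto simp: bohr_def)
    then have "\<bar>Re (?z x) - 1\<bar> \<le> 2 * r" "\<bar>Im (?z x)\<bar> \<le> 2 * r"
      using abs_Re_le_cmod[of "1 - ?z x"] abs_Im_le_cmod[of "1 - ?z x"] by auto
    then have "\<bar>(Re (?z x) - 1) / (r / 2)\<bar> \<le> 4" "\<bar>Im (?z x) / (r / 2)\<bar> \<le> 4"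
      using assms(4) by (simp_all add: abs_divide pos_divide_le_eq)
    moreover have "(Re (?z x) - 1) / (r / 2) = Re (?z x) / (r / 2) - 2 / r"
      by (simp add: diff_divide_distrib)
    ultimately have "2 / r - 4 \<le> Re (?z x) / (r / 2)" "Re (?z x) / (r / 2) \<le> 2 / r + 4"
      "-4 \<le> Im (?z x) / (r / 2)" "Im (?z x) / (r / 2) \<le> 4"
      by linarith+
    then show ?thesis
      unfolding mem_Times_iff fst_conv snd_conv atLeastAtMost_iff by linarith
  qed
  have "finite C1"
    using C1(1) insert.prems(1) finite_subset by blast
  then have "\<exists>C'\<subseteq>C1. card C1 \<le> card ?B * card C' \<and> (\<forall>x\<in>C'. \<forall>y\<in>C'. ?f x = ?f y)"
    by (rule pigeonhole_fibre) (simp, simp, fact im)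
  then obtain C' where C': "C' \<subseteq> C1" "card C1 \<le> card ?B * card C'"
    "\<forall>x\<in>C'. \<forall>y\<in>C'. ?f x = ?f y"
    by blast
  have "x - y \<in> bohr (insert t G) R r" if "x \<in> C'" "y \<in> C'" for x y
  proof -
    have "?f x = ?f y"
      using C'(3) that by blast
    then have "\<bar>Re (?z x) - Re (?z y)\<bar> < r / 2" "\<bar>Im (?z x) - Im (?z y)\<bar> < r / 2"
      using assms(4) unfolding prod.inject by (elim conjE; intro floor_eq_imp_diff_less; simp)+
    then have "cmod (?z x - ?z y) \<le> r"
      using cmod_le[of "?z x - ?z y"] by simp
    then have "cmod (1 - cis (t * real_of_int (x - y))) \<le> r"
      by (simp add: cmod_cis_diff right_diff_distrib)
    moreover have "x - y \<in> bohr G R r"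
      using C1(3) C'(1) that by blast
    ultimately show ?thesis
      by (simp add: bohr_def)
  qed
  moreover have "card C \<le> 100 ^ (card (insert t G) + 1) * card C'"
  proof -
    have "card C1 \<le> 100 * card C'"
      using C'(2) by (simp add: card_cartesian_product)
    then have "100 ^ (card G + 1) * card C1 \<le> 100 ^ (card G + 1) * (100 * card C')"
      by (rule mult_left_mono) simp
    also have "\<dots> = 100 ^ (card (insert t G) + 1) * card C'"
      using insert.hyps by simp
    finally show ?thesis
      using C1(2) by linarith
  qed
  ultimately show ?case
    using C'(1) C1(1) by (intro exI[of _ C']) auto
qed

lemma card_translate_le:
  assumes "finite B" "\<And>x. x \<in> C \<Longrightarrow> x - (a::int) \<in> B"
  shows "card C \<le> card B"
  using assms by (intro card_inj_on_le[of "\<lambda>x. x - a"]) (auto simp: inj_on_def)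

text \<open>Subtracting one point of a pigeonhole class from the whole class moves it injectively
  into the smaller Bohr set.\<close>

lemma card_bohr_double:
  assumes "finite G" "R > 0" "r > 0" "card G + 1 \<le> D"
  shows "card (bohr G R (2 * r)) \<le> 100 ^ D * card (bohr G R r)"
proof -
  obtain C where C: "C \<subseteq> bohr G R (2 * r)"
    "card (bohr G R (2 * r)) \<le> 100 ^ (card G + 1) * card C"
    "\<forall>x\<in>C. \<forall>y\<in>C. x - y \<in> bohr G R r"
    using bohr_pigeonhole[of G "bohr G R (2 * r)" R r] assms by auto
  have "card C \<le> card (bohr G R r)"
  proof (cases "C = {}")
    case False
    then obtain a where "a \<in> C" by auto
    then show ?thesis
      using C(3) by (intro card_translate_le[of _ _ a]) auto
  qed simp
  moreover have "(100::nat) ^ (card G + 1) \<le> 100 ^ D"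
    using assms(4) by (rule power_increasing) simp
  ultimately have "100 ^ (card G + 1) * card C \<le> 100 ^ D * card (bohr G R r)"
    by (intro mult_mono) auto
  then show ?thesis
    using C(2) by linarith
qed

text \<open>At radius 2 the frequencies impose nothing, since chords of the unit circle have length
  at most 2, so the set contains the integers of \<open>[0, R]\<close>; \<open>j + 1\<close>
  halvings then reach the radius in question.\<close>

lemma card_bohr_lower:
  assumes "finite G" "R \<ge> 1" "card G + 1 \<le> D"
  shows "R \<le> 100 ^ (D * (j + 1)) * real (card (bohr G R ((1 / 2) ^ j)))"
proof -
  have one: "R \<le> card (bohr G R 2)"
  proof -
    have "{0..\<lfloor>R\<rfloor>} \<subseteq> bohr G R 2"
    proof
      fix x assume x: "x \<in> {0..\<lfloor>R\<rfloor>}"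
      have "cmod (1 - cis a) \<le> 2" for a
        using norm_triangle_ineq4[of 1 "cis a"] by simp
      moreover have "real_of_int x \<le> R" "0 \<le> real_of_int x"
        using x by (auto simp: le_floor_iff)
      ultimately show "x \<in> bohr G R 2"
        using assms(2) by (auto simp: bohr_def)
    qed
    then have "card {0..\<lfloor>R\<rfloor>} \<le> card (bohr G R 2)"
      by (intro card_mono) auto
    then show ?thesis
      using assms(2) by (simp, linarith)
  qed
  have "card (bohr G R 2) \<le> 100 ^ (D * (j + 1)) * card (bohr G R ((1 / 2) ^ j))"
  proof (induction j)
    case 0
    then show ?case
      using card_bohr_double[of G R 1 D] assms by simp
  next
    case (Suc j)
    have "card (bohr G R ((1 / 2) ^ j)) \<le> 100 ^ D * card (bohr G R ((1 / 2) ^ Suc j))"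
      using card_bohr_double[of G R "(1 / 2) ^ Suc j" D] assms by simp
    then have "100 ^ (D * (j + 1)) * card (bohr G R ((1 / 2) ^ j))
        \<le> 100 ^ (D * (j + 1)) * (100 ^ D * card (bohr G R ((1 / 2) ^ Suc j)))"
      by (rule mult_left_mono) simp
    also have "\<dots> = 100 ^ (D * (Suc j + 1)) * card (bohr G R ((1 / 2) ^ Suc j))"
      by (simp add: power_add)
    finally show ?case
      using Suc by linarith
  qed
  then have "real (card (bohr G R 2)) \<le> real (100 ^ (D * (j + 1)) * card (bohr G R ((1 / 2) ^ j)))"
    by (rule of_nat_mono)
  then show ?thesis
    using one by simp
qed

text \<open>If every radius failed, the size would grow by \<open>1 + \<eta>\<close> at each of
  \<open>n = 7 * D * q\<close> equal steps from \<open>r\<close> to \<open>2 * r\<close>. As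
  \<open>q\<close> such steps double it, the total growth would be
  \<open>2 ^ (7 * D) = 128 ^ D\<close>, more than the doubling constant
  \<open>100 ^ D\<close>.\<close>

lemma bohr_regular_radius:
  fixes \<eta> :: real
  assumes "finite G" "R > 0" "r > 0" "card G + 1 \<le> D" "0 < \<eta>" "\<eta> \<le> 1"
  shows "\<exists>s. r \<le> s \<and> s \<le> 2 * r \<and>
    real (card (bohr G R (s + s * \<eta> / (28 * real D)))) \<le> (1 + \<eta>) * card (bohr G R s)"
proof (rule ccontr)
  assume contra: "\<not> ?thesis"
  define q where "q = nat \<lceil>1 / \<eta>\<rceil>"
  define n where "n = 7 * D * q"
  have D: "real D \<ge> 1"
    using assms(4) by simp
  have q1: "real q * \<eta> \<ge> 1"
  proof -
    have "real q \<ge> 1 / \<eta>"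
      unfolding q_def by linarith
    then show ?thesis
      using assms(5) by (simp add: pos_divide_le_eq mult.commute)
  qed
  have q2: "real q * \<eta> \<le> 2"
  proof -
    have "1 / \<eta> \<ge> 1"
      using assms(5,6) by simp
    then have "real q \<le> 2 / \<eta>"
      unfolding q_def by linarith
    then show ?thesis
      using assms(5) by (simp add: pos_le_divide_eq)
  qed
  have qpos: "q > 0"
    using q1 by (auto intro: Nat.gr0I)
  have npos: "real n > 0"
    using qpos D by (simp add: n_def)
  define f where "f i = real (card (bohr G R (r + i * r / n)))" for i :: nat
  have step: "f (Suc i) \<ge> (1 + \<eta>) * f i" if "i < n" for i
  proof -
    let ?s = "r + i * r / n"
    have s: "r \<le> ?s" "?s \<le> 2 * r"
      using assms(3) npos that by (auto simp: divide_le_eq)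
    then have "real (card (bohr G R (?s + ?s * \<eta> / (28 * real D)))) > (1 + \<eta>) * f i"
      using contra unfolding f_def by (meson not_le)
    \<comment> \<open>A step has length \<open>r / n\<close> with
      \<open>n \<le> 14 * D / \<eta>\<close>, and \<open>?s\<close> is at most \<open>2 * r\<close>;
      this is the origin of the constant 28.\<close>
    moreover have "?s + ?s * \<eta> / (28 * real D) \<le> r + Suc i * r / n"
    proof -
      have "?s * \<eta> / (28 * real D) \<le> 2 * r * \<eta> / (28 * real D)"
        using s(2) assms(5) D by (intro divide_right_mono mult_right_mono) auto
      also have "\<dots> = r * \<eta> / (14 * D)"
        by simp
      also have "\<dots> \<le> r / n"
      proof -
        have "\<eta> * real n \<le> 14 * real D"
          using mult_left_mono[OF q2, of "7 * real D"] D by (simp add: n_def algebra_simps)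
        then have "r * (\<eta> * real n) \<le> r * (14 * real D)"
          using assms(3) by (intro mult_left_mono) auto
        then show ?thesis
          using npos D by (simp add: field_simps)
      qed
      finally show ?thesis
        by (simp add: add_divide_distrib distrib_right)
    qed
    then have "bohr G R (?s + ?s * \<eta> / (28 * real D)) \<subseteq> bohr G R (r + Suc i * r / n)"
      using assms(2) by (intro bohr_mono) auto
    then have "real (card (bohr G R (?s + ?s * \<eta> / (28 * real D)))) \<le> f (Suc i)"
      unfolding f_def by (intro of_nat_mono card_mono) auto
    ultimately show ?thesis
      by linarith
  qed
  have "f i \<ge> (1 + \<eta>) ^ i * f 0" if "i \<le> n" for i
    using that
  proof (induction i)
    case (Suc i)
    have "(1 + \<eta>) * ((1 + \<eta>) ^ i * f 0) \<le> (1 + \<eta>) * f i"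
      using Suc assms(5) by (intro mult_left_mono) auto
    then show ?case
      using step[of i] Suc.prems by (simp add: algebra_simps)
  qed simp
  then have "f n \<ge> (1 + \<eta>) ^ n * f 0"
    by simp
  moreover have "(1 + \<eta>) ^ n \<ge> 128 ^ D"
  proof -
    have "(1 + \<eta>) ^ q \<ge> 1 + real q * \<eta>"
      using assms(5) by (intro Bernoulli_inequality) auto
    then have "(1 + \<eta>) ^ q \<ge> 2"
      using q1 by linarith
    then have "((1 + \<eta>) ^ q) ^ (7 * D) \<ge> 2 ^ (7 * D)"
      by (intro power_mono) auto
    moreover have "((1 + \<eta>) ^ q) ^ (7 * D) = (1 + \<eta>) ^ n"
      unfolding n_def power_mult[symmetric] by (simp add: mult.commute)
    moreover have "(2::real) ^ (7 * D) = 128 ^ D"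
      unfolding power_mult by simp
    ultimately show ?thesis
      by simp
  qed
  moreover have "f 0 > 0"
    using card_bohr_pos[of r R G] assms by (simp add: f_def)
  moreover have "f n \<le> 100 ^ D * f 0"
  proof -
    have "f n = real (card (bohr G R (2 * r)))"
      using npos by (simp add: f_def)
    also have "\<dots> \<le> real (100 ^ D * card (bohr G R r))"
      using card_bohr_double[of G R r D] assms by (intro of_nat_mono) auto
    finally show ?thesis
      by (simp add: f_def)
  qed
  ultimately have "128 ^ D * f 0 \<le> 100 ^ D * f 0"
    by (meson mult_right_mono order_trans less_imp_le)
  then have "(128::real) ^ D \<le> 100 ^ D"
    using \<open>f 0 > 0\<close> by simp
  moreover have "(100::real) ^ D < 128 ^ D"
    using assms(4) by (intro power_strict_mono) auto
  ultimately show False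
    by linarith
qed


section \<open>Almost periodicity by random sampling\<close>

text \<open>The exponential lies below its chord on \<open>[- s, s]\<close>. The affine bound is
  used twice: for a centred variable its mean is \<open>cosh s\<close>, and up to a constant it is a
  factor of a Riesz product.\<close>

lemma exp_le_cosh_sinh:
  assumes "\<bar>x\<bar> \<le> (1::real)"
  shows "exp (s * x) \<le> cosh s + x * sinh s"
proof -
  have "exp ((1 - (1 + x) / 2) *\<^sub>R (- s) + ((1 + x) / 2) *\<^sub>R s)
      \<le> (1 - (1 + x) / 2) * exp (- s) + ((1 + x) / 2) * exp s"
    using assms by (intro convex_onD[OF exp_convex]) auto
  moreover have "(1 - (1 + x) / 2) *\<^sub>R (- s) + ((1 + x) / 2) *\<^sub>R s = s * x"
    by (simp add: field_simps)
  ultimately show ?thesis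
    by (simp add: cosh_def sinh_def field_simps)
qed

lemma cosh_le_exp_square:
  assumes "\<bar>s\<bar> \<le> (1::real)"
  shows "cosh s \<le> exp (s\<^sup>2)"
proof -
  have *: "cosh s \<le> 1 + s\<^sup>2" if "0 \<le> s" "s \<le> 1" for s :: real
  proof -
    have "exp s \<le> 1 + s + s\<^sup>2"
      using exp_bound[of s] that by simp
    moreover have "exp (- s) \<le> 1 - s + s\<^sup>2"
    proof -
      have "(1 - s + s\<^sup>2) * exp s \<ge> (1 - s + s\<^sup>2) * (1 + s + s\<^sup>2 / 2)"
      proof (rule mult_left_mono)
        show "1 + s + s\<^sup>2 / 2 \<le> exp s"
          using exp_lower_Taylor_quadratic[of s] that by simp
        show "0 \<le> 1 - s + s\<^sup>2"
          using that by simp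
      qed
      moreover have "(1 - s + s\<^sup>2) * (1 + s + s\<^sup>2 / 2) = 1 + s\<^sup>2 / 2 + s ^ 3 / 2 + s ^ 4 / 2"
        by (simp add: field_simps power2_eq_square power3_eq_cube power4_eq_xxxx)
      ultimately have "(1 - s + s\<^sup>2) * exp s \<ge> 1"
        using that by (smt (verit) zero_le_power divide_nonneg_nonneg)
      then show ?thesis
        by (simp add: exp_minus field_simps)
    qed
    ultimately show ?thesis
      by (simp add: cosh_def)
  qed
  have "cosh \<bar>s\<bar> \<le> 1 + \<bar>s\<bar>\<^sup>2"
    using *[of "\<bar>s\<bar>"] assms by simp
  then have "cosh s \<le> 1 + s\<^sup>2"
    by (cases "s \<ge> 0") (simp_all add: abs_if)
  also have "\<dots> \<le> exp (s\<^sup>2)"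
    by (rule exp_ge_add_one_self)
  finally show ?thesis .
qed

text \<open>Exponential moments with the parameter \<open>s = \<epsilon> / 2\<close>, which
  minimises \<open>s ^ 2 - s * \<epsilon>\<close> with value \<open>- \<epsilon> ^ 2 / 4\<close>.
  Probabilities are counts of tuples, so independence becomes the factorisation of a sum over
  \<open>PiE\<close>.\<close>

lemma hoeffding_tuples_upper:
  fixes \<phi> :: "'a \<Rightarrow> real"
  assumes "finite Y" "\<And>y. y \<in> Y \<Longrightarrow> \<bar>\<phi> y\<bar> \<le> 1" "sum \<phi> Y = 0" "0 < \<epsilon>" "\<epsilon> \<le> 1"
  shows "real (card {f \<in> PiE {..<k} (\<lambda>_. Y). (\<Sum>i<k. \<phi> (f i)) > \<epsilon> * k})
    \<le> exp (- (\<epsilon>\<^sup>2 * k / 4)) * real (card Y) ^ k"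
proof -
  let ?P = "PiE {..<k} (\<lambda>_. Y)" and ?s = "\<epsilon> / 2"
  let ?B = "{f \<in> ?P. (\<Sum>i<k. \<phi> (f i)) > \<epsilon> * k}"
  have fin: "finite ?P"
    using assms(1) by (intro finite_PiE) auto
  have "real (card ?B) * exp (?s * (\<epsilon> * k)) = (\<Sum>f\<in>?B. exp (?s * (\<epsilon> * k)))"
    by simp
  also have "\<dots> \<le> (\<Sum>f\<in>?B. exp (?s * (\<Sum>i<k. \<phi> (f i))))"
    using assms(4) by (intro sum_mono) auto
  also have "\<dots> \<le> (\<Sum>f\<in>?P. exp (?s * (\<Sum>i<k. \<phi> (f i))))"
    using fin by (intro sum_mono2) auto
  also have "\<dots> = (\<Sum>f\<in>?P. \<Prod>i<k. exp (?s * \<phi> (f i)))"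
    by (simp add: exp_sum sum_distrib_left)
  also have "\<dots> = (\<Prod>i<k. \<Sum>y\<in>Y. exp (?s * \<phi> y))"
    using assms(1) by (subst prod_sum_PiE) auto
  also have "\<dots> = (\<Sum>y\<in>Y. exp (?s * \<phi> y)) ^ k"
    by simp
  also have "\<dots> \<le> (exp (?s\<^sup>2) * card Y) ^ k"
  proof (rule power_mono)
    have "(\<Sum>y\<in>Y. exp (?s * \<phi> y)) \<le> (\<Sum>y\<in>Y. cosh ?s + \<phi> y * sinh ?s)"
      using assms(2) by (intro sum_mono exp_le_cosh_sinh) auto
    also have "\<dots> = cosh ?s * card Y + sum \<phi> Y * sinh ?s"
      by (simp add: sum.distrib sum_distrib_right)
    also have "\<dots> \<le> exp (?s\<^sup>2) * card Y"
      using assms(3-5) cosh_le_exp_square[of ?s] by (simp add: mult_right_mono)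
    finally show "(\<Sum>y\<in>Y. exp (?s * \<phi> y)) \<le> exp (?s\<^sup>2) * card Y" .
  qed (simp add: sum_nonneg)
  also have "\<dots> = exp (k * ?s\<^sup>2) * real (card Y) ^ k"
    by (simp add: power_mult_distrib exp_of_nat_mult)
  finally have "real (card ?B) \<le> exp (k * ?s\<^sup>2) * real (card Y) ^ k / exp (?s * (\<epsilon> * k))"
    by (simp add: pos_le_divide_eq)
  also have "\<dots> = exp (k * ?s\<^sup>2 - ?s * (\<epsilon> * k)) * real (card Y) ^ k"
    by (simp add: exp_diff)
  also have "k * ?s\<^sup>2 - ?s * (\<epsilon> * k) = - (\<epsilon>\<^sup>2 * k / 4)"
    by (simp add: power2_eq_square field_simps)
  finally show ?thesis .
qed

lemma hoeffding_tuples: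
  fixes \<phi> :: "'a \<Rightarrow> real"
  assumes "finite Y" "\<And>y. y \<in> Y \<Longrightarrow> \<bar>\<phi> y\<bar> \<le> 1" "sum \<phi> Y = 0" "0 < \<epsilon>" "\<epsilon> \<le> 1"
  shows "real (card {f \<in> PiE {..<k} (\<lambda>_. Y). \<bar>\<Sum>i<k. \<phi> (f i)\<bar> > \<epsilon> * k})
    \<le> 2 * exp (- (\<epsilon>\<^sup>2 * k / 4)) * real (card Y) ^ k"
proof -
  let ?P = "PiE {..<k} (\<lambda>_. Y)"
  have "{f \<in> ?P. \<bar>\<Sum>i<k. \<phi> (f i)\<bar> > \<epsilon> * k} \<subseteq> {f \<in> ?P. (\<Sum>i<k. \<phi> (f i)) > \<epsilon> * k}
      \<union> {f \<in> ?P. (\<Sum>i<k. - \<phi> (f i)) > \<epsilon> * k}"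
  proof
    fix f assume "f \<in> {f \<in> ?P. \<bar>\<Sum>i<k. \<phi> (f i)\<bar> > \<epsilon> * k}"
    then have f: "f \<in> ?P" and "\<epsilon> * k < \<bar>\<Sum>i<k. \<phi> (f i)\<bar>"
      by blast+
    then have "\<epsilon> * k < (\<Sum>i<k. \<phi> (f i)) \<or> \<epsilon> * k < - (\<Sum>i<k. \<phi> (f i))"
      by linarith
    with f show "f \<in> {f \<in> ?P. (\<Sum>i<k. \<phi> (f i)) > \<epsilon> * k} \<union> {f \<in> ?P. (\<Sum>i<k. - \<phi> (f i)) > \<epsilon> * k}"
      unfolding sum_negf by blast
  qed
  moreover have "finite ?P"
    using assms(1) by (intro finite_PiE) auto
  ultimately have "card {f \<in> ?P. \<bar>\<Sum>i<k. \<phi> (f i)\<bar> > \<epsilon> * k}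
      \<le> card {f \<in> ?P. (\<Sum>i<k. \<phi> (f i)) > \<epsilon> * k} + card {f \<in> ?P. (\<Sum>i<k. - \<phi> (f i)) > \<epsilon> * k}"
    by (intro order_trans[OF card_mono card_Un_le]) auto
  then have "real (card {f \<in> ?P. \<bar>\<Sum>i<k. \<phi> (f i)\<bar> > \<epsilon> * k})
      \<le> real (card {f \<in> ?P. (\<Sum>i<k. \<phi> (f i)) > \<epsilon> * k})
        + real (card {f \<in> ?P. (\<Sum>i<k. - \<phi> (f i)) > \<epsilon> * k})"
    by linarith
  then show ?thesis
    using hoeffding_tuples_upper[of Y \<phi> \<epsilon> k] hoeffding_tuples_upper[of Y "\<lambda>y. - \<phi> y" \<epsilon> k] assms
    by (simp add: sum_negf)
qed

section \<open>Sampling the proportion of hits\<close>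

definition hit_ratio :: "int set \<Rightarrow> int set \<Rightarrow> int \<Rightarrow> real" where
  "hit_ratio S Y u = real (card {y \<in> Y. u + y \<in> S}) / real (card Y)"

lemma hit_ratio_bounds: "0 \<le> hit_ratio S Y u" "finite Y \<Longrightarrow> hit_ratio S Y u \<le> 1"
proof -
  show "0 \<le> hit_ratio S Y u"
    by (simp add: hit_ratio_def)
  assume "finite Y"
  then have "card {y \<in> Y. u + y \<in> S} \<le> card Y"
    by (intro card_mono) auto
  then show "hit_ratio S Y u \<le> 1"
    by (cases "card Y = 0") (auto simp: hit_ratio_def divide_le_eq)
qed

lemma hit_ratio_eq_0: "\<not> (\<exists>y\<in>Y. u + y \<in> S) \<Longrightarrow> hit_ratio S Y u = 0"
proof -
  assume "\<not> (\<exists>y\<in>Y. u + y \<in> S)"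
  then have "{y \<in> Y. u + y \<in> S} = {}"
    by auto
  then show ?thesis
    unfolding hit_ratio_def by (simp only: card.empty of_nat_0 div_0)
qed

definition sample_bad :: "int set \<Rightarrow> int set \<Rightarrow> real \<Rightarrow> nat \<Rightarrow> (nat \<Rightarrow> int) \<Rightarrow> int set" where
  "sample_bad S Y \<epsilon> k f =
    {u. \<bar>(\<Sum>i<k. of_bool (u + f i \<in> S)) - k * hit_ratio S Y u\<bar> > \<epsilon> * k}"

text \<open>Hoeffding's inequality counts the bad tuples for a fixed \<open>u\<close>; exchanging
  the sums bounds the mean number of bad points of a tuple. Outside \<open>U\<close> the sample sum
  and the ratio both vanish, so only \<open>card U\<close> points count.\<close>

lemma sum_sample_bad:
  assumes "finite S" "finite Y" "Y \<noteq> {}" "0 < \<epsilon>" "\<epsilon> \<le> 1"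
    "finite U" "\<And>u. (\<exists>y\<in>Y. u + y \<in> S) \<Longrightarrow> u \<in> U"
  shows "(\<Sum>f\<in>PiE {..<k} (\<lambda>_. Y). real (card (sample_bad S Y \<epsilon> k f)))
    \<le> 2 * exp (- (\<epsilon>\<^sup>2 * k / 4)) * card U * real (card Y) ^ k"
    and "f \<in> PiE {..<k} (\<lambda>_. Y) \<Longrightarrow> sample_bad S Y \<epsilon> k f \<subseteq> U"
proof -
  let ?P = "PiE {..<k} (\<lambda>_. Y)"
  have fin: "finite ?P"
    using assms(2) by (intro finite_PiE) auto
  show sub: "sample_bad S Y \<epsilon> k f \<subseteq> U" if f: "f \<in> ?P" for f
  proof
    fix u assume u: "u \<in> sample_bad S Y \<epsilon> k f"
    show "u \<in> U"
    proof (rule ccontr)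
      assume "u \<notin> U"
      then have no: "\<not> (\<exists>y\<in>Y. u + y \<in> S)"
        using assms(7) by auto
      have "(\<Sum>i<k. of_bool (u + f i \<in> S) :: real) = 0"
        using no f by (intro sum.neutral) (auto simp: PiE_def Pi_def)
      then show False
        using u hit_ratio_eq_0[OF no] assms(4) by (auto simp: sample_bad_def mult_less_0_iff)
    qed
  qed
  have "(\<Sum>f\<in>?P. real (card (sample_bad S Y \<epsilon> k f)))
      = (\<Sum>f\<in>?P. \<Sum>u\<in>U. of_bool (u \<in> sample_bad S Y \<epsilon> k f))"
  proof (rule sum.cong[OF refl])
    fix f assume "f \<in> ?P"
    then have "{u \<in> U. u \<in> sample_bad S Y \<epsilon> k f} = sample_bad S Y \<epsilon> k f"
      using sub by auto
    then show "real (card (sample_bad S Y \<epsilon> k f)) = (\<Sum>u\<in>U. of_bool (u \<in> sample_bad S Y \<epsilon> k f))"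
      using assms(6) by (simp add: Int_def)
  qed
  also have "\<dots> = (\<Sum>u\<in>U. \<Sum>f\<in>?P. of_bool (u \<in> sample_bad S Y \<epsilon> k f))"
    by (rule sum.swap)
  also have "\<dots> \<le> (\<Sum>u\<in>U. 2 * exp (- (\<epsilon>\<^sup>2 * k / 4)) * real (card Y) ^ k)"
  proof (rule sum_mono)
    fix u
    define \<phi> where "\<phi> y = of_bool (u + y \<in> S) - hit_ratio S Y u" for y
    have "sum \<phi> Y = real (card {y \<in> Y. u + y \<in> S}) - card Y * hit_ratio S Y u"
      using assms(2) by (simp add: \<phi>_def sum_subtractf Int_def)
    then have sum0: "sum \<phi> Y = 0"
      using assms(2,3) by (simp add: hit_ratio_def)
    have "\<bar>\<phi> y\<bar> \<le> 1" for y
      using hit_ratio_bounds(1)[of S Y u] hit_ratio_bounds(2)[of Y S u] assms(2)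
      by (auto simp: \<phi>_def of_bool_def abs_le_iff)
    then have "real (card {f \<in> ?P. \<bar>\<Sum>i<k. \<phi> (f i)\<bar> > \<epsilon> * k})
        \<le> 2 * exp (- (\<epsilon>\<^sup>2 * k / 4)) * real (card Y) ^ k"
      using hoeffding_tuples[of Y \<phi> \<epsilon> k] assms sum0 by auto
    moreover have "{f \<in> ?P. \<bar>\<Sum>i<k. \<phi> (f i)\<bar> > \<epsilon> * k} = ?P \<inter> {f. u \<in> sample_bad S Y \<epsilon> k f}"
      by (auto simp: sample_bad_def \<phi>_def sum_subtractf)
    ultimately show "(\<Sum>f\<in>?P. of_bool (u \<in> sample_bad S Y \<epsilon> k f))
        \<le> 2 * exp (- (\<epsilon>\<^sup>2 * k / 4)) * real (card Y) ^ k"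
      using fin by simp
  qed
  finally show "(\<Sum>f\<in>?P. real (card (sample_bad S Y \<epsilon> k f)))
    \<le> 2 * exp (- (\<epsilon>\<^sup>2 * k / 4)) * card U * real (card Y) ^ k"
    by (simp add: mult_ac)
qed

text \<open>The exceptional part of an error is kept as a nonnegative function of small total mass
  and not as a small set: averaging over translates preserves a bound on the mass, while a union of
  translated exceptional sets would grow.\<close>

definition l1_bounded :: "real \<Rightarrow> (int \<Rightarrow> real) \<Rightarrow> bool" where
  "l1_bounded c h \<longleftrightarrow> (\<forall>u. 0 \<le> h u) \<and> (\<forall>X. finite X \<longrightarrow> sum h X \<le> c)"

lemma l1_bounded_shift: "l1_bounded c h \<Longrightarrow> l1_bounded c (\<lambda>u. h (u + a))"
proof -
  assume h: "l1_bounded c h"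
  have "sum (\<lambda>u. h (u + a)) X = sum h ((\<lambda>u. u + a) ` X)" for X
    by (subst sum.reindex) (auto simp: inj_on_def)
  then show ?thesis
    using h by (auto simp: l1_bounded_def)
qed

lemma l1_bounded_add: "l1_bounded c h \<Longrightarrow> l1_bounded d g \<Longrightarrow> l1_bounded (c + d) (\<lambda>u. h u + g u)"
  by (auto simp: l1_bounded_def sum.distrib add_mono)

lemma l1_bounded_indicator:
  assumes "finite B" "real (card B) \<le> c"
  shows "l1_bounded c (\<lambda>u. of_bool (u \<in> B))"
proof -
  have "real (card (X \<inter> B)) \<le> c" if "finite X" for X
    using assms card_mono[of B "X \<inter> B"] by (auto intro: order_trans[OF of_nat_mono])
  then show ?thesis
    by (auto simp: l1_bounded_def)
qed

lemma l1_bounded_card: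
  assumes "l1_bounded c h" "a > 0" "\<And>u. u \<in> X \<Longrightarrow> h u \<ge> a" "finite X"
  shows "real (card X) \<le> c / a"
proof -
  have "card X * a = (\<Sum>u\<in>X. a)"
    by simp
  also have "\<dots> \<le> sum h X"
    using assms(3) by (rule sum_mono)
  also have "\<dots> \<le> c"
    using assms(1,4) by (auto simp: l1_bounded_def)
  finally show ?thesis
    using assms(2) by (simp add: pos_le_divide_eq)
qed

text \<open>By Markov's inequality at least half of the \<open>k\<close>-tuples from
  \<open>Y\<close> approximate the ratio outside a set of size \<open>c\<close>, twice the bound for
  the mean. A good tuple shifted by \<open>t\<close> in \<open>E\<close> is a tuple from
  \<open>W\<close>, so some \<open>g\<close> arises from many \<open>t\<close>, and these form
  \<open>T\<close>. For \<open>t\<close> and \<open>t'\<close> in \<open>T\<close>, both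
  \<open>a (u - t)\<close> and \<open>a (u - t')\<close> are close to the ratio at \<open>u\<close>,
  with one and the same function \<open>a\<close> sampled along \<open>g\<close>; comparing them
  shows that \<open>t - t'\<close> is an almost period. The factor 8 adds two errors of mass
  \<open>c\<close>.\<close>

lemma croot_sisask:
  assumes "finite S" "finite Y" "Y \<noteq> {}" "0 < \<epsilon>" "\<epsilon> \<le> 1" "finite E" "k > 0"
    "finite U" "\<And>u. (\<exists>y\<in>Y. u + y \<in> S) \<Longrightarrow> u \<in> U"
    "finite W" "\<And>y t. y \<in> Y \<Longrightarrow> t \<in> E \<Longrightarrow> y + t \<in> W"
  obtains T where "T \<subseteq> E" "real (card Y) ^ k * real (card E) \<le> 2 * real (card W) ^ k * real (card T)"
    "\<And>t t'. t \<in> T \<Longrightarrow> t' \<in> T \<Longrightarrow> \<exists>h. l1_bounded (8 * exp (- (\<epsilon>\<^sup>2 * k / 4)) * card U) h \<and>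
       (\<forall>u. \<bar>hit_ratio S Y (u + (t - t')) - hit_ratio S Y u\<bar> \<le> 2 * \<epsilon> + h u)"
proof -
  let ?P = "PiE {..<k} (\<lambda>_. Y)" and ?Q = "PiE {..<k} (\<lambda>_. W)"
  define c where "c = 4 * exp (- (\<epsilon>\<^sup>2 * k / 4)) * card U"
  define good where "good = {f \<in> ?P. real (card (sample_bad S Y \<epsilon> k f)) \<le> c}"
  have finP: "finite ?P" and finQ: "finite ?Q"
    using assms(2,10) by (auto intro!: finite_PiE)
  have cardP: "card ?P = card Y ^ k" and cardQ: "card ?Q = card W ^ k"
    by (simp_all add: card_PiE)
  have c0: "c \<ge> 0"
    by (simp add: c_def)
  have good_half: "real (card Y) ^ k \<le> 2 * real (card good)"
  \<comment> \<open>Markov's inequality divides by \<open>c\<close>. When \<open>c = 0\<close> the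
    set \<open>U\<close> is empty and every tuple is good.\<close>
  proof (cases "c = 0")
    case True
    then have "card U = 0"
      by (simp add: c_def)
    then have "U = {}"
      using assms(8) by simp
    have "good = ?P"
      unfolding good_def using sum_sample_bad(2)[OF assms(1-5,8,9), of _ k] c0 \<open>U = {}\<close> by auto
    then show ?thesis
      using cardP by simp
  next
    case False
    then have cpos: "c > 0"
      using c0 by simp
    have "c * card (?P - good) = (\<Sum>f\<in>?P - good. c)"
      by simp
    also have "\<dots> \<le> (\<Sum>f\<in>?P - good. real (card (sample_bad S Y \<epsilon> k f)))"
    proof (rule sum_mono)
      fix f assume "f \<in> ?P - good"
      then show "c \<le> real (card (sample_bad S Y \<epsilon> k f))"
        unfolding good_def by (simp only: Diff_iff mem_Collect_eq) linarith
    qed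
    also have "\<dots> \<le> (\<Sum>f\<in>?P. real (card (sample_bad S Y \<epsilon> k f)))"
      using finP by (intro sum_mono2) auto
    also have "\<dots> \<le> c / 2 * real (card Y) ^ k"
      using sum_sample_bad(1)[OF assms(1-5,8,9), of k] by (simp add: c_def mult_ac)
    finally have "card (?P - good) \<le> real (card Y) ^ k / 2"
      using cpos by (simp add: field_simps)
    moreover have "card (?P - good) = card ?P - card good"
      using finP by (intro card_Diff_subset) (auto simp: good_def intro: finite_subset)
    moreover have "card good \<le> card ?P"
      using finP by (intro card_mono) (auto simp: good_def)
    ultimately show ?thesis
      using cardP by (simp add: of_nat_diff)
  qed
  define sh where "sh f t = (\<lambda>i\<in>{..<k}. f i + t)" for f :: "nat \<Rightarrow> int" and t
  define R where "R g = {t \<in> E. \<exists>f\<in>good. sh f t = g}" for g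
  have inj: "inj_on (\<lambda>f. sh f t) good" for t
  proof (rule inj_onI)
    fix f f' assume f: "f \<in> good" "f' \<in> good" "sh f t = sh f' t"
    show "f = f'"
    proof (rule PiE_ext)
      show "f \<in> ?P" "f' \<in> ?P"
        using f by (auto simp: good_def)
      show "f i = f' i" if "i \<in> {..<k}" for i
        using fun_cong[OF f(3), of i] that by (simp add: sh_def)
    qed
  qed
  have shQ: "sh f t \<in> ?Q" if "f \<in> good" "t \<in> E" for f t
    using that assms(11) by (auto simp: sh_def good_def PiE_def Pi_def)
  have "card good * card E = (\<Sum>t\<in>E. card ((\<lambda>f. sh f t) ` good))"
    using inj by (simp add: card_image)
  also have "\<dots> = (\<Sum>t\<in>E. \<Sum>g\<in>?Q. of_bool (\<exists>f\<in>good. sh f t = g))"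
  proof (rule sum.cong[OF refl])
    fix t assume "t \<in> E"
    then have "(\<lambda>f. sh f t) ` good = ?Q \<inter> {g. \<exists>f\<in>good. sh f t = g}"
      using shQ by auto
    then show "card ((\<lambda>f. sh f t) ` good) = (\<Sum>g\<in>?Q. of_bool (\<exists>f\<in>good. sh f t = g))"
      using finQ by simp
  qed
  also have "\<dots> = (\<Sum>g\<in>?Q. \<Sum>t\<in>E. of_bool (\<exists>f\<in>good. sh f t = g))"
    by (rule sum.swap)
  also have "\<dots> = (\<Sum>g\<in>?Q. card (R g))"
    using assms(6) by (simp add: R_def Int_def)
  finally have total: "card good * card E = (\<Sum>g\<in>?Q. card (R g))" .
  obtain g where g: "real (card good) * card E \<le> real (card W) ^ k * card (R g)"
  proof (cases "?Q = {}")
    case True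
    then have "real (card good) * card E \<le> 0"
      using total by (simp add: True flip: of_nat_mult)
    then have "real (card good) * card E \<le> real (card W) ^ k * card (R undefined)"
      by (rule order_trans) simp
    then show ?thesis
      by (rule that)
  next
    case False
    have "\<exists>g\<in>?Q. card good * card E \<le> card ?Q * card (R g)"
    proof (rule ccontr)
      assume "\<not> ?thesis"
      then have "card ?Q * card (R g) < card good * card E" if "g \<in> ?Q" for g
        using that by (meson not_le)
      then have "(\<Sum>g\<in>?Q. card ?Q * card (R g)) < (\<Sum>g\<in>?Q. card good * card E)"
        using False finQ by (intro sum_strict_mono) auto
      then show False
        using total by (simp flip: sum_distrib_left)
    qed
    then obtain g where "card good * card E \<le> card W ^ k * card (R g)"
      unfolding cardQ by auto
    then have "real (card good * card E) \<le> real (card W ^ k * card (R g))"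
      by (rule of_nat_mono)
    then show ?thesis
      using that[of g] by simp
  qed
  define a where "a u = (\<Sum>i<k. of_bool (u + g i \<in> S)) / k" for u
  have close: "\<exists>h. l1_bounded c h \<and> (\<forall>u. \<bar>a (u - t) - hit_ratio S Y u\<bar> \<le> \<epsilon> + h u)"
    if t: "t \<in> R g" for t
  proof -
    obtain f where f: "f \<in> good" "sh f t = g"
      using t by (auto simp: R_def)
    have gi: "g i = f i + t" if "i < k" for i
      using f(2) that by (auto simp: sh_def)
    let ?B = "sample_bad S Y \<epsilon> k f"
    have B: "?B \<subseteq> U" "real (card ?B) \<le> c"
      using sum_sample_bad(2)[OF assms(1-5,8,9), of f k] f(1) by (auto simp: good_def)
    have "\<bar>a (u - t) - hit_ratio S Y u\<bar> \<le> \<epsilon> + of_bool (u \<in> ?B)" for u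
    proof -
      have "a (u - t) = (\<Sum>i<k. of_bool (u + f i \<in> S)) / k"
        by (simp add: a_def gi algebra_simps)
      moreover have "0 \<le> (\<Sum>i<k. of_bool (u + f i \<in> S) :: real)"
        by (intro sum_nonneg) auto
      moreover have "(\<Sum>i<k. of_bool (u + f i \<in> S) :: real) \<le> real k"
        using sum_mono[of "{..<k}" "\<lambda>i. of_bool (u + f i \<in> S) :: real" "\<lambda>_. 1"] by (simp del: sum_of_bool_eq)
      ultimately have a: "a (u - t) = (\<Sum>i<k. of_bool (u + f i \<in> S)) / k" "0 \<le> a (u - t)" "a (u - t) \<le> 1"
        using assms(7) by (auto simp: divide_le_eq)
      show ?thesis
      proof (cases "u \<in> ?B")
        case True
        then show ?thesis
          using a(2,3) hit_ratio_bounds(1)[of S Y u] hit_ratio_bounds(2)[of Y S u] assms(2,4)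
          by (simp add: abs_le_iff)
      next
        case False
        have "k * a (u - t) = (\<Sum>i<k. of_bool (u + f i \<in> S))"
          using a(1) assms(7) by (simp del: sum_of_bool_eq)
        then have "\<bar>k * a (u - t) - k * hit_ratio S Y u\<bar> \<le> \<epsilon> * k"
          using False by (simp add: sample_bad_def del: sum_of_bool_eq)
        then have "k * \<bar>a (u - t) - hit_ratio S Y u\<bar> \<le> k * \<epsilon>"
          by (simp add: abs_mult mult.commute flip: right_diff_distrib)
        then show ?thesis
          using assms(7) False by simp
      qed
    qed
    moreover have "l1_bounded c (\<lambda>u. of_bool (u \<in> ?B))"
      using B assms(8) finite_subset by (intro l1_bounded_indicator) auto
    ultimately show ?thesis
      by blast
  qed
  show ?thesis
  proof (rule that[of "R g"])
    show "R g \<subseteq> E"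
      by (auto simp: R_def)
    have "real (card Y) ^ k * real (card E) \<le> 2 * real (card good) * card E"
      using good_half by (intro mult_right_mono) auto
    then show "real (card Y) ^ k * real (card E) \<le> 2 * real (card W) ^ k * real (card (R g))"
      using g by simp
    fix t t' assume "t \<in> R g" "t' \<in> R g"
    then obtain h h' where h: "l1_bounded c h" "\<And>u. \<bar>a (u - t) - hit_ratio S Y u\<bar> \<le> \<epsilon> + h u"
      and h': "l1_bounded c h'" "\<And>u. \<bar>a (u - t') - hit_ratio S Y u\<bar> \<le> \<epsilon> + h' u"
      using close by meson
    have "\<bar>hit_ratio S Y (u + (t - t')) - hit_ratio S Y u\<bar> \<le> 2 * \<epsilon> + (h (u + (t - t')) + h' u)" for u
      using h(2)[of "u + (t - t')"] h'(2)[of u] by simp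
    moreover have "l1_bounded (c + c) (\<lambda>u. h (u + (t - t')) + h' u)"
      using h h' by (intro l1_bounded_add l1_bounded_shift)
    ultimately show "\<exists>h. l1_bounded (8 * exp (- (\<epsilon>\<^sup>2 * k / 4)) * card U) h \<and>
       (\<forall>u. \<bar>hit_ratio S Y (u + (t - t')) - hit_ratio S Y u\<bar> \<le> 2 * \<epsilon> + h u)"
      by (intro exI[of _ "\<lambda>u. h (u + (t - t')) + h' u"]) (simp add: c_def mult_ac)
  qed
qed

section \<open>Repeated averaging over differences\<close>

definition autoavg :: "int set \<Rightarrow> (int \<Rightarrow> real) \<Rightarrow> int \<Rightarrow> real" where
  "autoavg T g u = (\<Sum>p\<in>T \<times> T. g (u + (fst p - snd p))) / card (T \<times> T)"

lemma autoavg_mono: "(\<And>u. g u \<le> h u) \<Longrightarrow> autoavg T g u \<le> autoavg T h u"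
  unfolding autoavg_def by (intro divide_right_mono sum_mono) auto

lemma autoavg_diff: "autoavg T (\<lambda>u. g u - h u) u = autoavg T g u - autoavg T h u"
  by (simp add: autoavg_def sum_subtractf diff_divide_distrib)

lemma autoavg_add: "autoavg T (\<lambda>u. g u + h u) u = autoavg T g u + autoavg T h u"
  by (simp add: autoavg_def sum.distrib add_divide_distrib)

lemma autoavg_const: "finite T \<Longrightarrow> T \<noteq> {} \<Longrightarrow> autoavg T (\<lambda>_. c) u = c"
  by (simp add: autoavg_def)

lemma autoavg_abs: "\<bar>autoavg T g u\<bar> \<le> autoavg T (\<lambda>u. \<bar>g u\<bar>) u"
  unfolding autoavg_def by (simp add: abs_divide divide_right_mono)

lemma l1_bounded_average:
  assumes "finite I" "I \<noteq> {}" "\<And>i. i \<in> I \<Longrightarrow> l1_bounded c (g i)"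
  shows "l1_bounded c (\<lambda>u. (\<Sum>i\<in>I. g i u) / card I)"
  unfolding l1_bounded_def
proof (intro conjI allI impI)
  fix u show "0 \<le> (\<Sum>i\<in>I. g i u) / card I"
    using assms(3) by (intro divide_nonneg_nonneg sum_nonneg) (auto simp: l1_bounded_def)
next
  fix X :: "int set" assume "finite X"
  have "(\<Sum>u\<in>X. (\<Sum>i\<in>I. g i u) / card I) = (\<Sum>i\<in>I. \<Sum>u\<in>X. g i u) / card I"
    by (simp add: sum.swap[of _ I X] flip: sum_divide_distrib)
  also have "\<dots> \<le> (\<Sum>i\<in>I. c) / card I"
    using assms(3) \<open>finite X\<close> by (intro divide_right_mono sum_mono) (auto simp: l1_bounded_def)
  also have "\<dots> = c"
    using assms(1,2) by simp
  finally show "(\<Sum>u\<in>X. (\<Sum>i\<in>I. g i u) / card I) \<le> c" .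
qed

lemma l1_bounded_autoavg:
  assumes "finite T" "T \<noteq> {}" "l1_bounded c h"
  shows "l1_bounded c (autoavg T h)"
  unfolding autoavg_def using assms by (intro l1_bounded_average l1_bounded_shift) auto

text \<open>Averaging increases neither the supremum norm nor the mass, so each further application
  only adds the error of averaging \<open>F\<close> once: one \<open>\<epsilon>\<close> and one
  \<open>c\<close>.\<close>

lemma autoavg_iterate_close:
  assumes "finite T" "T \<noteq> {}"
    "\<And>t t'. t \<in> T \<Longrightarrow> t' \<in> T \<Longrightarrow> \<exists>h. l1_bounded c h \<and> (\<forall>u. \<bar>F (u + (t - t')) - F u\<bar> \<le> \<epsilon> + h u)"
  shows "\<exists>h. l1_bounded (m * c) h \<and> (\<forall>u. \<bar>((autoavg T ^^ m) F) u - F u\<bar> \<le> m * \<epsilon> + h u)"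
proof (induction m)
  case 0
  then show ?case
    by (intro exI[of _ "\<lambda>_. 0"]) (simp add: l1_bounded_def)
next
  case (Suc m)
  let ?I = "T \<times> T"
  have "\<forall>p\<in>?I. \<exists>h. l1_bounded c h \<and> (\<forall>u. \<bar>F (u + (fst p - snd p)) - F u\<bar> \<le> \<epsilon> + h u)"
    using assms(3) by auto
  from bchoice[OF this] obtain H where "\<forall>p\<in>?I. l1_bounded c (H p) \<and>
      (\<forall>u. \<bar>F (u + (fst p - snd p)) - F u\<bar> \<le> \<epsilon> + H p u)" ..
  then have H: "\<And>p. p \<in> ?I \<Longrightarrow> l1_bounded c (H p)"
    "\<And>p u. p \<in> ?I \<Longrightarrow> \<bar>F (u + (fst p - snd p)) - F u\<bar> \<le> \<epsilon> + H p u"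
    by blast+
  define h0 where "h0 u = (\<Sum>p\<in>?I. H p u) / card ?I" for u
  have I: "finite ?I" "?I \<noteq> {}"
    using assms by auto
  have h0: "l1_bounded c h0"
    unfolding h0_def using I H(1) by (intro l1_bounded_average) auto
  have one: "\<bar>autoavg T F u - F u\<bar> \<le> \<epsilon> + h0 u" for u
  proof -
    have "autoavg T F u - F u = (\<Sum>p\<in>?I. F (u + (fst p - snd p)) - F u) / card ?I"
      using I assms by (simp add: autoavg_def sum_subtractf diff_divide_distrib)
    also have "\<bar>\<dots>\<bar> \<le> (\<Sum>p\<in>?I. \<bar>F (u + (fst p - snd p)) - F u\<bar>) / card ?I"
      by (simp add: abs_divide divide_right_mono)
    also have "\<dots> \<le> (\<Sum>p\<in>?I. \<epsilon> + H p u) / card ?I"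
      using H(2) by (intro divide_right_mono sum_mono) auto
    also have "\<dots> = \<epsilon> + h0 u"
      using I assms by (simp add: h0_def sum.distrib add_divide_distrib)
    finally show ?thesis .
  qed
  obtain h where h: "l1_bounded (m * c) h" "\<And>u. \<bar>((autoavg T ^^ m) F) u - F u\<bar> \<le> m * \<epsilon> + h u"
    using Suc by auto
  have "\<bar>((autoavg T ^^ Suc m) F) u - F u\<bar> \<le> Suc m * \<epsilon> + (autoavg T h u + h0 u)" for u
  proof -
    have "\<bar>autoavg T ((autoavg T ^^ m) F) u - autoavg T F u\<bar>
        \<le> autoavg T (\<lambda>u. \<bar>((autoavg T ^^ m) F) u - F u\<bar>) u"
      using autoavg_abs[of T "\<lambda>u. ((autoavg T ^^ m) F) u - F u" u] by (simp add: autoavg_diff)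
    also have "\<dots> \<le> autoavg T (\<lambda>u. m * \<epsilon> + h u) u"
      using h(2) by (intro autoavg_mono) auto
    also have "\<dots> = m * \<epsilon> + autoavg T h u"
      using assms by (simp add: autoavg_add autoavg_const)
    finally show ?thesis
      using one[of u] by (simp add: algebra_simps)
  qed
  moreover have "l1_bounded (Suc m * c) (\<lambda>u. autoavg T h u + h0 u)"
    using l1_bounded_add[OF l1_bounded_autoavg[OF assms(1,2) h(1)] h0] by (simp add: algebra_simps)
  ultimately show ?case
    by blast
qed


section \<open>Fourier transform of finitely supported functions\<close>

abbreviation fin_supp :: "(int \<Rightarrow> real) \<Rightarrow> bool" where
  "fin_supp F \<equiv> finite {u. F u \<noteq> 0}"

definition ft :: "(int \<Rightarrow> real) \<Rightarrow> real \<Rightarrow> complex" where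
  "ft F \<theta> = (\<Sum>u | F u \<noteq> 0. of_real (F u) * cis (\<theta> * of_int u))"

lemma ft_eq:
  assumes "finite C" "\<And>u. F u \<noteq> 0 \<Longrightarrow> u \<in> C"
  shows "ft F \<theta> = (\<Sum>u\<in>C. of_real (F u) * cis (\<theta> * of_int u))"
  unfolding ft_def using assms by (intro sum.mono_neutral_left) auto

lemma supp_shift: "{u. F (u + a) \<noteq> 0} = (\<lambda>u. u - a) ` {u. F (u::int) \<noteq> (0::real)}"
  by (auto simp: image_iff intro!: exI[of _ "_ + a"])

lemma ft_shift: "ft (\<lambda>u. F (u + a)) \<theta> = cis (- \<theta> * of_int a) * ft F \<theta>"
proof -
  have "ft (\<lambda>u. F (u + a)) \<theta>
      = (\<Sum>u | F u \<noteq> 0. of_real (F (u - a + a)) * cis (\<theta> * of_int (u - a)))"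
    unfolding ft_def supp_shift by (subst sum.reindex) (auto simp: inj_on_def)
  also have "\<dots> = (\<Sum>u | F u \<noteq> 0. cis (- \<theta> * of_int a) * (of_real (F u) * cis (\<theta> * of_int u)))"
    by (intro sum.cong refl) (simp add: cis_mult algebra_simps)
  finally show ?thesis
    by (simp add: ft_def sum_distrib_left)
qed

lemma fin_supp_shift: "fin_supp F \<Longrightarrow> fin_supp (\<lambda>u. F (u + a))"
  by (simp add: supp_shift)

lemma fin_supp_diff: "fin_supp F \<Longrightarrow> fin_supp H \<Longrightarrow> fin_supp (\<lambda>u. F u - H u)"
  by (rule finite_subset[of _ "{u. F u \<noteq> 0} \<union> {u. H u \<noteq> 0}"]) auto

lemma ft_diff:
  assumes "fin_supp F" "fin_supp H"
  shows "ft (\<lambda>u. F u - H u) \<theta> = ft F \<theta> - ft H \<theta>"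
proof -
  let ?C = "{u. F u \<noteq> 0} \<union> {u. H u \<noteq> 0}"
  have C: "finite ?C"
    using assms by simp
  have "ft (\<lambda>u. F u - H u) \<theta> = (\<Sum>u\<in>?C. of_real (F u - H u) * cis (\<theta> * of_int u))"
    using C by (intro ft_eq) auto
  moreover have "ft F \<theta> = (\<Sum>u\<in>?C. of_real (F u) * cis (\<theta> * of_int u))"
    using C by (intro ft_eq) auto
  moreover have "ft H \<theta> = (\<Sum>u\<in>?C. of_real (H u) * cis (\<theta> * of_int u))"
    using C by (intro ft_eq) auto
  ultimately show ?thesis
    by (simp add: left_diff_distrib flip: sum_subtractf)
qed

lemma supp_average:
  assumes "finite I"
  shows "{u. (\<Sum>i\<in>I. f i u) / c \<noteq> (0::real)} \<subseteq> (\<Union>i\<in>I. {u. f i u \<noteq> 0})"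
proof
  fix u assume "u \<in> {u. (\<Sum>i\<in>I. f i u) / c \<noteq> (0::real)}"
  then have "(\<Sum>i\<in>I. f i u) \<noteq> 0"
    by auto
  then obtain i where "i \<in> I" "f i u \<noteq> 0"
    by (rule sum.not_neutral_contains_not_neutral)
  then show "u \<in> (\<Union>i\<in>I. {u. f i u \<noteq> 0})"
    by blast
qed

lemma ft_average:
  assumes "finite I" "\<And>i. i \<in> I \<Longrightarrow> fin_supp (f i)"
  shows "ft (\<lambda>u. (\<Sum>i\<in>I. f i u) / c) \<theta> = (\<Sum>i\<in>I. ft (f i) \<theta>) / of_real c"
proof -
  let ?C = "\<Union>i\<in>I. {u. f i u \<noteq> 0}"
  have C: "finite ?C"
    using assms by auto
  have "ft (\<lambda>u. (\<Sum>i\<in>I. f i u) / c) \<theta>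
      = (\<Sum>u\<in>?C. of_real ((\<Sum>i\<in>I. f i u) / c) * cis (\<theta> * of_int u))"
  proof (rule ft_eq[OF C])
    fix u assume "(\<Sum>i\<in>I. f i u) / c \<noteq> 0"
    then show "u \<in> ?C"
      by (intro subsetD[OF supp_average[OF assms(1), of f c]]) simp
  qed
  also have "\<dots> = (\<Sum>u\<in>?C. \<Sum>i\<in>I. of_real (f i u) * cis (\<theta> * of_int u)) / of_real c"
    by (simp add: sum_divide_distrib sum_distrib_right)
  also have "\<dots> = (\<Sum>i\<in>I. \<Sum>u\<in>?C. of_real (f i u) * cis (\<theta> * of_int u)) / of_real c"
    by (subst sum.swap) simp
  also have "(\<Sum>i\<in>I. \<Sum>u\<in>?C. of_real (f i u) * cis (\<theta> * of_int u)) = (\<Sum>i\<in>I. ft (f i) \<theta>)"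
    using C by (intro sum.cong refl ft_eq[symmetric]) auto
  finally show ?thesis .
qed

lemma fin_supp_autoavg:
  assumes "finite T" "fin_supp F"
  shows "fin_supp (autoavg T F)"
proof (rule finite_subset)
  show "{u. autoavg T F u \<noteq> 0} \<subseteq> (\<Union>p\<in>T \<times> T. {u. F (u + (fst p - snd p)) \<noteq> 0})"
    unfolding autoavg_def using assms by (intro supp_average) auto
  show "finite (\<Union>p\<in>T \<times> T. {u. F (u + (fst p - snd p)) \<noteq> 0})"
    using assms by (intro finite_UN_I fin_supp_shift) auto
qed

lemma ft_autoavg:
  assumes "finite T" "fin_supp F"
  shows "ft (autoavg T F) \<theta> = of_real ((cmod (\<Sum>t\<in>T. cis (\<theta> * of_int t)) / card T)\<^sup>2) * ft F \<theta>"
proof -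
  let ?S = "\<Sum>t\<in>T. cis (\<theta> * of_int t)"
  have "(\<Sum>p\<in>T \<times> T. cis (- \<theta> * of_int (fst p - snd p)))
      = (\<Sum>t\<in>T. \<Sum>t'\<in>T. cnj (cis (\<theta> * of_int t)) * cis (\<theta> * of_int t'))"
    unfolding sum.cartesian_product
    by (intro sum.cong refl) (auto simp: cis_cnj cis_mult algebra_simps split: prod.splits)
  also have "\<dots> = cnj ?S * ?S"
    by (simp add: sum_product)
  also have "\<dots> = of_real ((cmod ?S)\<^sup>2)"
    by (metis complex_norm_square mult.commute)
  finally have *: "(\<Sum>p\<in>T \<times> T. cis (- \<theta> * of_int (fst p - snd p))) = of_real ((cmod ?S)\<^sup>2)" .
  have "ft (autoavg T F) \<theta> = (\<Sum>p\<in>T \<times> T. ft (\<lambda>u. F (u + (fst p - snd p))) \<theta>) / of_real (card (T \<times> T))"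
    unfolding autoavg_def using assms by (intro ft_average fin_supp_shift) auto
  also have "\<dots> = (\<Sum>p\<in>T \<times> T. cis (- \<theta> * of_int (fst p - snd p))) * ft F \<theta> / of_real (card (T \<times> T))"
    by (simp only: ft_shift sum_distrib_right)
  also have "\<dots> = of_real ((cmod ?S)\<^sup>2) * ft F \<theta> / of_real (card (T \<times> T))"
    by (simp only: *)
  finally show ?thesis
    by (simp add: card_cartesian_product power2_eq_square)
qed

lemma autoavg_iterate_ft:
  assumes "finite T" "fin_supp F"
  shows "fin_supp ((autoavg T ^^ m) F)"
    "ft ((autoavg T ^^ m) F) \<theta>
      = of_real ((cmod (\<Sum>t\<in>T. cis (\<theta> * of_int t)) / card T) ^ (2 * m)) * ft F \<theta>"
proof -
  show *: "fin_supp ((autoavg T ^^ m) F)" for m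
    by (induction m) (simp_all add: assms fin_supp_autoavg)
  show "ft ((autoavg T ^^ m) F) \<theta>
      = of_real ((cmod (\<Sum>t\<in>T. cis (\<theta> * of_int t)) / card T) ^ (2 * m)) * ft F \<theta>"
  proof (induction m)
    case (Suc m)
    then show ?case
      using ft_autoavg[OF assms(1) *[of m], of \<theta>] by (simp add: power_add power2_eq_square mult_ac)
  qed simp
qed

section \<open>Parseval's identity and Fourier multipliers\<close>

lemma sum_cis_orthogonal:
  fixes M :: nat and n :: int
  assumes "\<bar>n\<bar> < int M"
  shows "(\<Sum>j<M. cis (2 * pi * real j / real M * of_int n)) = (if n = 0 then of_nat M else 0)"
proof (cases "n = 0")
  case False
  let ?z = "cis (2 * pi / real M * of_int n)"
  have M: "M > 0"
    using assms by linarith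
  have "?z \<noteq> 1"
  proof
    assume "?z = 1"
    then have "cos (2 * pi / real M * of_int n) = 1"
      by (simp add: complex_eq_iff)
    then obtain k :: int where "2 * pi / real M * of_int n = of_int k * (2 * pi)"
      by (auto simp: cos_one_2pi_int mult.assoc)
    then have "real_of_int n = real_of_int k * real M"
      using M by (simp add: field_simps)
    then have "n = k * int M"
      by (metis of_int_eq_iff of_int_mult of_int_of_nat_eq)
    then have "int M dvd n" by simp
    then have "int M \<le> \<bar>n\<bar>"
      using False by (intro zdvd_imp_le) auto
    with assms show False by simp
  qed
  moreover have "?z ^ M = 1"
  proof -
    have "real M * (2 * pi / real M * of_int n) = 2 * pi * of_int n"
      using M by simp
    then have "?z ^ M = cis (2 * pi * of_int n)"
      by (simp only: Complex.DeMoivre)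
    then show ?thesis
      by (simp only: cis_multiple_2pi Ints_of_int)
  qed
  moreover have "(\<Sum>j<M. cis (2 * pi * real j / real M * of_int n)) = (\<Sum>j<M. ?z ^ j)"
    unfolding Complex.DeMoivre by (intro sum.cong refl arg_cong[of _ _ cis]) simp
  ultimately show ?thesis
    using False by (simp add: geometric_sum)
qed simp

text \<open>Sampling the circle at \<open>M\<close> points replaces the integral. As
  \<open>M = 2 * Q + 1\<close> exceeds every difference of two points of \<open>[- Q, Q]\<close>, no
  two of them are identified modulo \<open>M\<close>.\<close>

lemma parseval:
  assumes "\<And>u. F u \<noteq> 0 \<Longrightarrow> \<bar>u\<bar> \<le> int Q" "M = 2 * Q + 1"
  shows "(\<Sum>j<M. (cmod (ft F (2 * pi * real j / real M)))\<^sup>2) = real M * (\<Sum>u\<in>{- int Q..int Q}. (F u)\<^sup>2)"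
proof -
  let ?C = "{- int Q..int Q}" and ?th = "\<lambda>j. 2 * pi * real j / real M"
  have ft: "ft F \<theta> = (\<Sum>u\<in>?C. of_real (F u) * cis (\<theta> * of_int u))" for \<theta>
  proof (rule ft_eq)
    fix u assume "F u \<noteq> 0"
    then show "u \<in> ?C"
      using assms(1)[of u] by auto
  qed simp
  have cc: "cnj (cis a) = cis (- a)" for a
    by (rule cis_cnj)
  have sq: "of_real ((cmod (ft F \<theta>))\<^sup>2)
      = (\<Sum>u\<in>?C. \<Sum>w\<in>?C. of_real (F u * F w) * cis (\<theta> * of_int (u - w)))" for \<theta>
    unfolding complex_norm_square ft cnj_sum sum_product
  proof (intro sum.cong refl)
    fix u w
    have "cis (\<theta> * of_int u) * cis (- (\<theta> * of_int w)) = cis (\<theta> * of_int (u - w))"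
      by (simp add: cis_mult right_diff_distrib)
    then show "of_real (F u) * cis (\<theta> * of_int u) * cnj (of_real (F w) * cis (\<theta> * of_int w))
        = of_real (F u * F w) * cis (\<theta> * of_int (u - w))"
      by (simp add: cc)
  qed
  have "of_real (\<Sum>j<M. (cmod (ft F (?th j)))\<^sup>2)
      = (\<Sum>j<M. \<Sum>u\<in>?C. \<Sum>w\<in>?C. of_real (F u * F w) * cis (?th j * of_int (u - w)))"
    by (simp only: of_real_sum sq)
  also have "\<dots> = (\<Sum>u\<in>?C. \<Sum>w\<in>?C. of_real (F u * F w) * (\<Sum>j<M. cis (?th j * of_int (u - w))))"
    unfolding sum_distrib_left by (subst sum.swap) (intro sum.cong refl sum.swap)
  also have "\<dots> = (\<Sum>u\<in>?C. \<Sum>w\<in>?C. if u = w then of_real (F u * F w) * of_nat M else 0)"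
  proof (intro sum.cong refl)
    fix u w assume "u \<in> ?C" "w \<in> ?C"
    then have "\<bar>u - w\<bar> < int M"
      using assms(2) by auto
    then show "of_real (F u * F w) * (\<Sum>j<M. cis (?th j * of_int (u - w)))
        = (if u = w then of_real (F u * F w) * of_nat M else 0 :: complex)"
      by (simp only: sum_cis_orthogonal) auto
  qed
  also have "\<dots> = (\<Sum>u\<in>?C. of_real (F u * F u) * of_nat M)"
    by (intro sum.cong refl) (simp add: sum.delta)
  also have "\<dots> = of_real (real M * (\<Sum>u\<in>?C. (F u)\<^sup>2))"
    by (simp add: sum_distrib_left power2_eq_square mult_ac)
  finally show ?thesis
    by (simp only: of_real_eq_iff)
qed

text \<open>One \<open>Q\<close> is taken for both supports and \<open>X\<close>, so that Parseval's
  identity applies to \<open>F\<close> and \<open>H\<close> at the same sampling points.\<close>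

lemma multiplier_l2_bound:
  assumes "fin_supp F" "fin_supp H" "\<kappa> \<ge> 0"
    "\<And>\<theta>. cmod (ft H \<theta>) \<le> \<kappa> * cmod (ft F \<theta>)" "finite X" "finite C" "\<And>u. F u \<noteq> 0 \<Longrightarrow> u \<in> C"
  shows "(\<Sum>u\<in>X. (H u)\<^sup>2) \<le> \<kappa>\<^sup>2 * (\<Sum>u\<in>C. (F u)\<^sup>2)"
proof -
  have "finite ((\<lambda>u. nat \<bar>u\<bar>) ` ({u. F u \<noteq> 0} \<union> {u. H u \<noteq> 0} \<union> X))"
    using assms by simp
  then obtain Q where Q: "\<And>u. u \<in> {u. F u \<noteq> 0} \<union> {u. H u \<noteq> 0} \<union> X \<Longrightarrow> nat \<bar>u\<bar> \<le> Q"
    unfolding finite_nat_set_iff_bounded_le by blast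
  have Q': "\<bar>u\<bar> \<le> int Q" if "F u \<noteq> 0 \<or> H u \<noteq> 0 \<or> u \<in> X" for u
    using Q[of u] that by auto
  define M where "M = 2 * Q + 1"
  let ?B = "{- int Q..int Q}" and ?th = "\<lambda>j. 2 * pi * real j / real M"
  have "real M * (\<Sum>u\<in>?B. (H u)\<^sup>2) = (\<Sum>j<M. (cmod (ft H (?th j)))\<^sup>2)"
    using Q' by (intro parseval[symmetric]) (auto simp: M_def)
  also have "\<dots> \<le> (\<Sum>j<M. (\<kappa> * cmod (ft F (?th j)))\<^sup>2)"
    using assms(4) by (intro sum_mono power_mono) auto
  also have "\<dots> = \<kappa>\<^sup>2 * (\<Sum>j<M. (cmod (ft F (?th j)))\<^sup>2)"
    by (simp add: power_mult_distrib sum_distrib_left)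
  also have "(\<Sum>j<M. (cmod (ft F (?th j)))\<^sup>2) = real M * (\<Sum>u\<in>?B. (F u)\<^sup>2)"
    using Q' by (intro parseval) (auto simp: M_def)
  finally have "real M * (\<Sum>u\<in>?B. (H u)\<^sup>2) \<le> real M * (\<kappa>\<^sup>2 * (\<Sum>u\<in>?B. (F u)\<^sup>2))"
    by (simp add: mult_ac)
  then have "(\<Sum>u\<in>?B. (H u)\<^sup>2) \<le> \<kappa>\<^sup>2 * (\<Sum>u\<in>?B. (F u)\<^sup>2)"
    by (rule mult_left_le_imp_le) (simp add: M_def)
  moreover have "(\<Sum>u\<in>X. (H u)\<^sup>2) \<le> (\<Sum>u\<in>?B. (H u)\<^sup>2)"
  proof (rule sum_mono2)
    show "X \<subseteq> ?B"
      using Q' by (auto simp: abs_le_iff) (smt (verit))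
  qed auto
  moreover have "(\<Sum>u\<in>?B. (F u)\<^sup>2) \<le> (\<Sum>u\<in>C. (F u)\<^sup>2)"
  proof -
    have "(\<Sum>u\<in>?B. (F u)\<^sup>2) = (\<Sum>u\<in>?B \<inter> C. (F u)\<^sup>2)"
      using assms(7) by (intro sum.mono_neutral_right) auto
    also have "\<dots> \<le> (\<Sum>u\<in>C. (F u)\<^sup>2)"
      using assms(6) by (intro sum_mono2) auto
    finally show ?thesis .
  qed
  ultimately show ?thesis
    by (meson mult_left_mono order_trans zero_le_power2)
qed

text \<open>After \<open>m\<close> averagings, the difference under translation by \<open>v\<close>
  has a Fourier multiplier whose modulus is the quantity in the last hypothesis. It is small at
  every \<open>\<theta>\<close> if \<open>v\<close> nearly annihilates the frequencies at which the
  mean over \<open>T\<close> is large; the others are damped by the power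
  \<open>2 * m\<close>.\<close>

lemma autoavg_iterate_almost_period:
  assumes "finite T" "\<kappa> \<ge> 0" "finite X" "finite C" "\<And>u. F u \<noteq> 0 \<Longrightarrow> u \<in> C"
    "\<And>\<theta>. (cmod (\<Sum>t\<in>T. cis (\<theta> * of_int t)) / card T) ^ (2 * m) * cmod (1 - cis (\<theta> * of_int v)) \<le> \<kappa>"
  shows "(\<Sum>u\<in>X. ((autoavg T ^^ m) F (u + v) - (autoavg T ^^ m) F u)\<^sup>2) \<le> \<kappa>\<^sup>2 * (\<Sum>u\<in>C. (F u)\<^sup>2)"
proof -
  let ?G = "(autoavg T ^^ m) F"
  have F: "fin_supp F"
    using assms(4,5) by (auto intro: finite_subset)
  have G: "fin_supp ?G"
    using F assms(1) by (rule autoavg_iterate_ft(1)[rotated])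
  show ?thesis
  proof (rule multiplier_l2_bound)
    fix \<theta>
    let ?r = "(cmod (\<Sum>t\<in>T. cis (\<theta> * of_int t)) / card T) ^ (2 * m)"
    have "ft (\<lambda>u. ?G (u + v) - ?G u) \<theta> = (cis (- \<theta> * of_int v) - 1) * ft ?G \<theta>"
      using G by (subst ft_diff) (auto simp: ft_shift algebra_simps intro: fin_supp_shift)
    also have "\<dots> = (cis (- \<theta> * of_int v) - 1) * (of_real ?r * ft F \<theta>)"
      using autoavg_iterate_ft(2)[OF assms(1) F] by simp
    finally have "ft (\<lambda>u. ?G (u + v) - ?G u) \<theta> = (cis (- \<theta> * of_int v) - 1) * (of_real ?r * ft F \<theta>)" .
    then have "cmod (ft (\<lambda>u. ?G (u + v) - ?G u) \<theta>)
        = cmod (cis (- \<theta> * of_int v) - 1) * (?r * cmod (ft F \<theta>))"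
      by (simp only: norm_mult norm_of_real) (simp add: abs_of_nonneg)
    also have "cmod (cis (- \<theta> * of_int v) - 1) = cmod (1 - cis (\<theta> * of_int v))"
    proof -
      have "1 - cis (\<theta> * of_int v) = cis (\<theta> * of_int v) * (cis (- \<theta> * of_int v) - 1)"
        by (simp add: algebra_simps cis_mult)
      then show ?thesis
        by (simp add: norm_mult)
    qed
    finally show "cmod (ft (\<lambda>u. ?G (u + v) - ?G u) \<theta>) \<le> \<kappa> * cmod (ft F \<theta>)"
      using mult_right_mono[OF assms(6)[of \<theta>], of "cmod (ft F \<theta>)"] by (simp add: mult_ac)
    show "fin_supp (\<lambda>u. ?G (u + v) - ?G u)"
      using G by (intro fin_supp_diff fin_supp_shift)
  qed (use assms F in auto)
qed


section \<open>Chang's theorem relative to a Bohr set\<close>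

definition riesz :: "(real \<Rightarrow> complex) \<Rightarrow> real set \<Rightarrow> int \<Rightarrow> real" where
  "riesz w L x = (\<Prod>t\<in>L. 1 + Re (w t * cis (t * of_int x)))"

text \<open>
  The threshold grows with \<open>card L\<close>: when a maximal dissociated set fails to extend, the new factor of the
  Riesz product must then contribute a definite amount, \<open>1 / 32\<close>, which produces a large Fourier coefficient.
\<close>

definition dissociated :: "int set \<Rightarrow> (int \<Rightarrow> real) \<Rightarrow> real set \<Rightarrow> bool" where
  "dissociated C b L \<longleftrightarrow>
    (\<forall>w. (\<forall>t. cmod (w t) \<le> 1) \<longrightarrow> (\<Sum>x\<in>C. b x * riesz w L x) \<le> (1 + 1 / 32) ^ card L)"

text \<open>The level 1 / 2 can be an absolute constant because the averagings amplify a fixed loss: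
  outside the spectrum, \<open>m\<close> of them leave at most \<open>4 ^ (- m)\<close>.\<close>

definition spec :: "int set \<Rightarrow> real set" where
  "spec T = {t. real (card T) \<le> 2 * cmod (\<Sum>x\<in>T. cis (t * of_int x))}"

text \<open>The chord bound at \<open>1 / 4\<close>, applied to every factor: its right-hand side is
  \<open>cosh (1 / 4)\<close> times a Riesz factor whose weight is scaled by
  \<open>tanh (1 / 4)\<close>.\<close>

lemma exp_Re_sum_le_riesz:
  assumes "finite L" "\<And>t. cmod (w t) \<le> 1"
  shows "exp ((\<Sum>t\<in>L. Re (w t * cis (t * of_int x))) / 4)
    \<le> cosh (1 / 4) ^ card L * riesz (\<lambda>t. of_real (tanh (1 / 4)) * w t) L x"
proof -
  have ch: "cosh (1 / 4 :: real) > 0"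
    by simp
  have "exp ((\<Sum>t\<in>L. Re (w t * cis (t * of_int x))) / 4)
      = (\<Prod>t\<in>L. exp (1 / 4 * Re (w t * cis (t * of_int x))))"
    using assms(1) by (simp add: exp_sum sum_divide_distrib)
  also have "\<dots> \<le> (\<Prod>t\<in>L. cosh (1 / 4) * (1 + Re ((of_real (tanh (1 / 4)) * w t) * cis (t * of_int x))))"
  proof (rule prod_mono, intro conjI)
    fix t
    have "\<bar>Re (w t * cis (t * of_int x))\<bar> \<le> cmod (w t * cis (t * of_int x))"
      by (rule abs_Re_le_cmod)
    also have "\<dots> \<le> 1"
      using assms(2)[of t] by (simp add: norm_mult)
    finally have "exp (1 / 4 * Re (w t * cis (t * of_int x)))
        \<le> cosh (1 / 4) + Re (w t * cis (t * of_int x)) * sinh (1 / 4)"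
      by (rule exp_le_cosh_sinh)
    also have "\<dots> = cosh (1 / 4) * (1 + tanh (1 / 4) * Re (w t * cis (t * of_int x)))"
      using ch by (simp add: tanh_def field_simps)
    also have "tanh (1 / 4) * Re (w t * cis (t * of_int x))
        = Re ((of_real (tanh (1 / 4)) * w t) * cis (t * of_int x))"
      by (simp add: algebra_simps)
    finally show "exp (1 / 4 * Re (w t * cis (t * of_int x)))
        \<le> cosh (1 / 4) * (1 + Re ((of_real (tanh (1 / 4)) * w t) * cis (t * of_int x)))" .
  qed simp
  also have "\<dots> = cosh (1 / 4) ^ card L * riesz (\<lambda>t. of_real (tanh (1 / 4)) * w t) L x"
    unfolding riesz_def by (simp only: prod.distrib prod_constant)
  finally show ?thesis .
qed

text \<open>The weights \<open>w\<close> align the phases, so that the character sum over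
  \<open>L\<close> has mean at least \<open>card L / 2\<close> on \<open>T\<close>. Its exponential
  moment is then bounded below by convexity, with exponent \<open>card L / 8\<close>, and above
  through Riesz products, with exponent \<open>card L * (1 / 16 + 1 / 32)\<close>. The excess
  \<open>1 / 8 - 3 / 32 = 1 / 32\<close> limits \<open>card L\<close>.\<close>

lemma card_dissociated:
  assumes "finite L" "L \<subseteq> spec T" "dissociated C b L" "finite C" "T \<subseteq> C" "T \<noteq> {}"
    "\<And>x. 0 \<le> b x" "\<And>x. x \<in> T \<Longrightarrow> 1 \<le> c * b x" "c > 0"
  shows "exp (card L / 32) * card T \<le> c"
proof -
  have "\<exists>w. cmod w \<le> 1 \<and> w * z = of_real (cmod z)" for z :: complex
  proof (cases "z = 0")
    case False
    have "cnj z / of_real (cmod z) * z = of_real ((cmod z)\<^sup>2) / of_real (cmod z)"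
      by (simp only: complex_norm_square) (simp add: mult.commute)
    also have "\<dots> = of_real (cmod z)"
      using False by (simp add: power2_eq_square)
    finally show ?thesis
      by (intro exI[of _ "cnj z / of_real (cmod z)"]) (simp add: norm_divide)
  qed (intro exI[of _ 0], simp)
  then obtain W where W: "\<And>z. cmod (W z) \<le> 1" "\<And>z. W z * z = of_real (cmod z)"
    by metis
  define w where "w t = W (\<Sum>x\<in>T. cis (t * of_int x))" for t :: real
  define \<Phi> where "\<Phi> x = (\<Sum>t\<in>L. Re (w t * cis (t * of_int x)))" for x :: int
  have w: "cmod (w t) \<le> 1" for t
    by (simp add: w_def W)
  have finT: "finite T"
    using assms(4,5) finite_subset by blast
  have "(\<Sum>x\<in>T. \<Phi> x) = (\<Sum>t\<in>L. Re (w t * (\<Sum>x\<in>T. cis (t * of_int x))))"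
    unfolding \<Phi>_def by (subst sum.swap) (simp only: sum_distrib_left Re_sum)
  also have "\<dots> = (\<Sum>t\<in>L. cmod (\<Sum>x\<in>T. cis (t * of_int x)))"
    by (simp only: w_def W(2) Re_complex_of_real)
  also have "\<dots> \<ge> (\<Sum>t\<in>L. card T / 2)"
    using assms(2) by (intro sum_mono) (auto simp: spec_def)
  finally have sumPhi: "(\<Sum>x\<in>T. \<Phi> x) \<ge> card L * card T / 2"
    by simp
  let ?a = "card L / 8"
  \<comment> \<open>Jensen's inequality by way of the tangent line at \<open>?a\<close>, which is a
    lower bound for the mean of \<open>\<Phi> x / 4\<close> over \<open>T\<close>.\<close>
  have "exp ?a * card T \<le> exp ?a * (\<Sum>x\<in>T. 1 + (\<Phi> x / 4 - ?a))"
    using sumPhi by (simp add: sum.distrib sum_subtractf algebra_simps flip: sum_divide_distrib)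
  also have "\<dots> \<le> (\<Sum>x\<in>T. exp (\<Phi> x / 4))"
    unfolding sum_distrib_left
  proof (rule sum_mono)
    fix x
    have "exp ?a * (1 + (\<Phi> x / 4 - ?a)) \<le> exp ?a * exp (\<Phi> x / 4 - ?a)"
      by (intro mult_left_mono exp_ge_add_one_self) auto
    then show "exp ?a * (1 + (\<Phi> x / 4 - ?a)) \<le> exp (\<Phi> x / 4)"
      by (simp flip: exp_add)
  qed
  also have "\<dots> \<le> (\<Sum>x\<in>T. c * b x * exp (\<Phi> x / 4))"
    using assms(8) by (intro sum_mono) (simp add: mult_le_cancel_right1)
  also have "\<dots> \<le> (\<Sum>x\<in>C. c * b x * exp (\<Phi> x / 4))"
    using assms(4,5,7,9) by (intro sum_mono2) auto
  also have "\<dots> \<le> (\<Sum>x\<in>C. c * b x * (cosh (1 / 4) ^ card L * riesz (\<lambda>t. of_real (tanh (1 / 4)) * w t) L x))"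
    unfolding \<Phi>_def using assms(1,7,9) w by (intro sum_mono mult_left_mono exp_Re_sum_le_riesz) auto
  also have "\<dots> = c * cosh (1 / 4) ^ card L * (\<Sum>x\<in>C. b x * riesz (\<lambda>t. of_real (tanh (1 / 4)) * w t) L x)"
    by (simp add: sum_distrib_left mult_ac)
  also have "\<dots> \<le> c * cosh (1 / 4) ^ card L * (1 + 1 / 32) ^ card L"
  proof (rule mult_left_mono)
    have "cmod (of_real (tanh (1 / 4)) * w t) \<le> 1" for t
    proof -
      have "\<bar>tanh (1 / 4 :: real)\<bar> * cmod (w t) \<le> 1 * 1"
        using w[of t] tanh_real_lt_1[of "1 / 4"] by (intro mult_mono) auto
      then show ?thesis
        by (simp add: norm_mult)
    qed
    then show "(\<Sum>x\<in>C. b x * riesz (\<lambda>t. of_real (tanh (1 / 4)) * w t) L x) \<le> (1 + 1 / 32) ^ card L"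
      using assms(3) unfolding dissociated_def
      by (elim allE[of _ "\<lambda>t. of_real (tanh (1 / 4)) * w t"]) blast
  qed (use assms(9) in auto)
  also have "\<dots> \<le> c * exp (1 / 16) ^ card L * exp (1 / 32) ^ card L"
  proof (intro mult_mono power_mono)
    show "cosh (1 / 4 :: real) \<le> exp (1 / 16)"
      using cosh_le_exp_square[of "1 / 4"] by (simp add: power2_eq_square)
    show "1 + 1 / 32 \<le> exp (1 / 32 :: real)"
      by (rule exp_ge_add_one_self)
  qed (use assms(9) in auto)
  also have "\<dots> = c * exp (card L * (3 / 32))"
    by (simp flip: exp_of_nat_mult exp_add)
  finally have "exp (card L / 8) * card T \<le> c * exp (card L * (3 / 32))" .
  moreover have "exp (card L / 8) = exp (card L / 32) * exp (card L * (3 / 32))"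
    by (simp flip: exp_add)
  ultimately have "(exp (card L / 32) * card T) * exp (card L * (3 / 32)) \<le> c * exp (card L * (3 / 32))"
    by (simp add: mult_ac)
  then show ?thesis
    by simp
qed

lemma riesz_insert:
  assumes "finite L" "t \<notin> L"
  shows "riesz w (insert t L) x = (1 + Re (w t * cis (t * of_int x))) * riesz w L x"
  using assms by (simp add: riesz_def)

text \<open>Multiplying out one factor turns \<open>\<theta>\<close> into \<open>\<theta>\<close>,
  \<open>\<theta> + t\<close> and \<open>\<theta> - t\<close> with weights of modulus at most 1, 1 /
  2 and 1 / 2, so one of the three sums has at least half the modulus. The final
  \<open>\<phi>\<close> differs from \<open>\<theta>\<close> by a combination of elements of
  \<open>L\<close> with coefficients -1, 0 and 1, whence the second estimate.\<close>

lemma riesz_expand: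
  assumes "finite L" "\<And>t. cmod (w t) \<le> 1"
  shows "\<exists>\<phi>. cmod (\<Sum>x\<in>C. of_real (b x * riesz w L x) * cis (\<theta> * of_int x))
        \<le> 2 ^ card L * cmod (\<Sum>x\<in>C. of_real (b x) * cis (\<phi> * of_int x))
    \<and> (\<forall>v::int. cmod (1 - cis (\<theta> * of_int v))
        \<le> cmod (1 - cis (\<phi> * of_int v)) + (\<Sum>t\<in>L. cmod (1 - cis (t * of_int v))))"
  using assms(1)
proof (induction L arbitrary: \<theta> rule: finite_induct)
  case empty
  show ?case
    by (intro exI[of _ \<theta>]) (simp add: riesz_def)
next
  case (insert t L)
  let ?S = "\<lambda>\<theta>. \<Sum>x\<in>C. of_real (b x * riesz w L x) * cis (\<theta> * of_int x)"
  have eq: "(\<Sum>x\<in>C. of_real (b x * riesz w (insert t L) x) * cis (\<theta> * of_int x))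
      = ?S \<theta> + w t / 2 * ?S (\<theta> + t) + cnj (w t) / 2 * ?S (\<theta> - t)"
  proof -
    have "of_real (b x * riesz w (insert t L) x) * cis (\<theta> * of_int x)
      = of_real (b x * riesz w L x) * cis (\<theta> * of_int x)
        + w t / 2 * (of_real (b x * riesz w L x) * cis ((\<theta> + t) * of_int x))
        + cnj (w t) / 2 * (of_real (b x * riesz w L x) * cis ((\<theta> - t) * of_int x))" for x
    proof -
      have "complex_of_real (Re (w t * cis (t * of_int x)))
          = (w t * cis (t * of_int x) + cnj (w t * cis (t * of_int x))) / 2"
        by (simp only: complex_add_cnj) simp
      then have re: "complex_of_real (1 + Re (w t * cis (t * of_int x)))
          = 1 + (w t * cis (t * of_int x) + cnj (w t) * cis (- (t * of_int x))) / 2"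
        by (simp only: of_real_add of_real_1 complex_cnj_mult cis_cnj)
      have "cis ((\<theta> + t) * of_int x) = cis (\<theta> * of_int x) * cis (t * of_int x)"
        "cis ((\<theta> - t) * of_int x) = cis (\<theta> * of_int x) * cis (- (t * of_int x))"
        by (simp_all add: cis_mult algebra_simps)
      then show ?thesis
        unfolding riesz_insert[OF insert.hyps(1,2)] of_real_mult re by (simp add: field_simps)
    qed
    then show ?thesis
      by (simp add: sum.distrib sum_distrib_left)
  qed
  have "cmod (\<Sum>x\<in>C. of_real (b x * riesz w (insert t L) x) * cis (\<theta> * of_int x))
      \<le> cmod (?S \<theta>) + cmod (w t / 2 * ?S (\<theta> + t)) + cmod (cnj (w t) / 2 * ?S (\<theta> - t))"
    unfolding eq by (rule order_trans[OF norm_triangle_ineq add_right_mono[OF norm_triangle_ineq]])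
  also have "\<dots> \<le> cmod (?S \<theta>) + 1 / 2 * cmod (?S (\<theta> + t)) + 1 / 2 * cmod (?S (\<theta> - t))"
  proof (intro add_mono order_refl)
    have *: "cmod (a / 2 * s) \<le> 1 / 2 * cmod s" if "cmod a \<le> 1" for a s
      using mult_right_mono[OF that, of "cmod s / 2"] by (simp add: norm_mult norm_divide)
    show "cmod (w t / 2 * ?S (\<theta> + t)) \<le> 1 / 2 * cmod (?S (\<theta> + t))"
      by (rule *) (rule assms(2))
    show "cmod (cnj (w t) / 2 * ?S (\<theta> - t)) \<le> 1 / 2 * cmod (?S (\<theta> - t))"
      by (rule *) (simp add: assms(2))
  qed
  finally have le: "cmod (\<Sum>x\<in>C. of_real (b x * riesz w (insert t L) x) * cis (\<theta> * of_int x))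
      \<le> cmod (?S \<theta>) + 1 / 2 * cmod (?S (\<theta> + t)) + 1 / 2 * cmod (?S (\<theta> - t))" .
  obtain \<theta>' where \<theta>': "cmod (\<Sum>x\<in>C. of_real (b x * riesz w (insert t L) x) * cis (\<theta> * of_int x))
      \<le> 2 * cmod (?S \<theta>')" "\<theta>' \<in> {\<theta>, \<theta> + t, \<theta> - t}"
  proof -
    have "\<exists>\<theta>'\<in>{\<theta>, \<theta> + t, \<theta> - t}. cmod (\<Sum>x\<in>C. of_real (b x * riesz w (insert t L) x) * cis (\<theta> * of_int x))
      \<le> 2 * cmod (?S \<theta>')"
    proof (rule ccontr)
      assume "\<not> ?thesis"
      then have "2 * cmod (?S \<theta>'') < cmod (\<Sum>x\<in>C. of_real (b x * riesz w (insert t L) x) * cis (\<theta> * of_int x))"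
        if "\<theta>'' \<in> {\<theta>, \<theta> + t, \<theta> - t}" for \<theta>''
        using that by (meson not_le)
      from this[OF insertI1] this[OF insertI2[OF insertI1]]
        this[OF insertI2[OF insertI2[OF insertI1]]] le
      show False
        by linarith
    qed
    then show ?thesis
      using that by blast
  qed
  obtain \<phi> where \<phi>: "cmod (?S \<theta>') \<le> 2 ^ card L * cmod (\<Sum>x\<in>C. of_real (b x) * cis (\<phi> * of_int x))"
    "\<And>v::int. cmod (1 - cis (\<theta>' * of_int v))
        \<le> cmod (1 - cis (\<phi> * of_int v)) + (\<Sum>t\<in>L. cmod (1 - cis (t * of_int v)))"
    using insert.IH[of \<theta>'] by blast
  have "cmod (1 - cis (\<theta> * of_int v)) \<le> cmod (1 - cis (\<theta>' * of_int v)) + cmod (1 - cis (t * of_int v))" for v :: int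
  proof -
    have "\<theta> * of_int v = \<theta>' * of_int v + 0 \<or> \<theta> * of_int v = \<theta>' * of_int v + t * of_int v
        \<or> \<theta> * of_int v = \<theta>' * of_int v + - (t * of_int v)"
      using \<theta>'(2) by (auto simp: algebra_simps)
    then show ?thesis
      using cmod_one_minus_cis_add[of "\<theta>' * of_int v" 0]
        cmod_one_minus_cis_add[of "\<theta>' * of_int v" "t * of_int v"]
        cmod_one_minus_cis_add[of "\<theta>' * of_int v" "- (t * of_int v)"]
        cmod_one_minus_cis_minus[of "t * of_int v"] norm_ge_zero[of "1 - cis (t * of_int v)"]
      by (smt (verit) cis_zero norm_zero diff_self)
  qed
  then have "cmod (1 - cis (\<theta> * of_int v))
        \<le> cmod (1 - cis (\<phi> * of_int v)) + (\<Sum>t\<in>insert t L. cmod (1 - cis (t * of_int v)))" for v :: int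
    using \<phi>(2)[of v] insert.hyps by (simp add: algebra_simps) (smt (verit))
  moreover have "cmod (\<Sum>x\<in>C. of_real (b x * riesz w (insert t L) x) * cis (\<theta> * of_int x))
        \<le> 2 ^ card (insert t L) * cmod (\<Sum>x\<in>C. of_real (b x) * cis (\<phi> * of_int x))"
    using \<theta>'(1) \<phi>(1) insert.hyps by simp
  ultimately show ?case
    by blast
qed

text \<open>\<open>L\<close> is a dissociated subset of the spectrum of maximal size. For
  \<open>\<theta>\<close> outside \<open>L\<close> the enlarged set is not dissociated, which leaves
  a Riesz-weighted coefficient at \<open>\<theta>\<close> of size at least
  \<open>1 / 32 = 2 ^ (- 5)\<close>; expanding the product loses at most another
  \<open>2 ^ n\<close>. For \<open>\<theta>\<close> in \<open>L\<close> the choice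
  \<open>\<phi> = 0\<close> works, its coefficient being the total mass 1.\<close>

lemma chang:
  assumes "finite C" "T \<subseteq> C" "T \<noteq> {}" "\<And>x. 0 \<le> b x" "(\<Sum>x\<in>C. b x) = 1"
    "\<And>x. x \<in> T \<Longrightarrow> 1 \<le> c * b x" "0 < c" "32 * ln (c / card T) \<le> real n"
  shows "\<exists>L. finite L \<and> card L \<le> n \<and>
    (\<forall>\<theta>\<in>spec T. \<exists>\<phi>. (1 / 2) ^ (n + 5) \<le> cmod (\<Sum>x\<in>C. of_real (b x) * cis (\<phi> * of_int x))
      \<and> (\<forall>v::int. cmod (1 - cis (\<theta> * of_int v))
        \<le> cmod (1 - cis (\<phi> * of_int v)) + (\<Sum>t\<in>L. cmod (1 - cis (t * of_int v)))))"
proof -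
  define good where "good L \<longleftrightarrow> finite L \<and> L \<subseteq> spec T \<and> dissociated C b L" for L
  have T: "real (card T) > 0"
    using assms(1-3) finite_subset by (auto simp: card_gt_0_iff)
  have bound: "card L \<le> n" if "good L" for L
  proof -
    have "exp (card L / 32) * card T \<le> c"
      using card_dissociated[of L T C b c] that assms unfolding good_def by auto
    then have "exp (card L / 32) \<le> c / card T"
      using T by (simp add: pos_le_divide_eq)
    then have "ln (exp (card L / 32)) \<le> ln (c / card T)"
      by (subst ln_le_cancel_iff) (use T assms(7) in auto)
    then show ?thesis
      using assms(8) by simp
  qed
  have "good {}"
    using assms(5) by (simp add: good_def dissociated_def riesz_def)
  then obtain L where L: "good L" "\<And>L'. good L' \<Longrightarrow> card L' \<le> card L"
    using ex_has_greatest_nat[of good "{}" card "Suc n"] bound by (auto simp: less_Suc_eq_le)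
  show ?thesis
  proof (intro exI[of _ L] conjI ballI)
    show finL: "finite L"
      using L(1) by (simp add: good_def)
    show cardL: "card L \<le> n"
      using bound[OF L(1)] .
    fix \<theta> assume \<theta>: "\<theta> \<in> spec T"
    show "\<exists>\<phi>. (1 / 2) ^ (n + 5) \<le> cmod (\<Sum>x\<in>C. of_real (b x) * cis (\<phi> * of_int x))
      \<and> (\<forall>v::int. cmod (1 - cis (\<theta> * of_int v))
        \<le> cmod (1 - cis (\<phi> * of_int v)) + (\<Sum>t\<in>L. cmod (1 - cis (t * of_int v))))"
    proof (cases "\<theta> \<in> L")
      case True
      have "(\<Sum>x\<in>C. complex_of_real (b x) * cis (0 * of_int x)) = of_real (\<Sum>x\<in>C. b x)"
        by simp
      then have "cmod (\<Sum>x\<in>C. complex_of_real (b x) * cis (0 * of_int x)) = 1"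
        using assms(5) by simp
      moreover have "(1 / 2 :: real) ^ (n + 5) \<le> 1"
        by (rule power_le_one) auto
      moreover have "cmod (1 - cis (\<theta> * of_int v)) \<le> (\<Sum>t\<in>L. cmod (1 - cis (t * of_int v)))" for v :: int
        using True finL by (intro member_le_sum) auto
      ultimately show ?thesis
        by (intro exI[of _ 0]) simp
    next
      case False
      have "\<not> good (insert \<theta> L)"
        using L(2)[of "insert \<theta> L"] False finL by auto
      then have "\<not> dissociated C b (insert \<theta> L)"
        using L(1) \<theta> by (simp add: good_def)
      then obtain w where w: "\<And>t. cmod (w t) \<le> 1"
        "(\<Sum>x\<in>C. b x * riesz w (insert \<theta> L) x) > (1 + 1 / 32) ^ card (insert \<theta> L)"
        unfolding dissociated_def by (auto simp: not_le)
      let ?S = "\<Sum>x\<in>C. of_real (b x * riesz w L x) * cis (\<theta> * of_int x)"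
      have "(\<Sum>x\<in>C. b x * riesz w (insert \<theta> L) x) = (\<Sum>x\<in>C. b x * riesz w L x) + Re (w \<theta> * ?S)"
      proof -
        have "b x * riesz w (insert \<theta> L) x
          = b x * riesz w L x + Re (w \<theta> * (of_real (b x * riesz w L x) * cis (\<theta> * of_int x)))" for x
        proof -
          have "w \<theta> * (of_real (b x * riesz w L x) * cis (\<theta> * of_int x))
              = of_real (b x * riesz w L x) * (w \<theta> * cis (\<theta> * of_int x))"
            by (simp add: mult_ac)
          then have "Re (w \<theta> * (of_real (b x * riesz w L x) * cis (\<theta> * of_int x)))
              = b x * riesz w L x * Re (w \<theta> * cis (\<theta> * of_int x))"
            by (simp add: algebra_simps)
          then show ?thesis
            unfolding riesz_insert[OF finL False] by (simp add: algebra_simps)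
        qed
        then show ?thesis
          by (simp only: sum.distrib sum_distrib_left Re_sum)
      qed
      moreover have "(\<Sum>x\<in>C. b x * riesz w L x) \<le> (1 + 1 / 32) ^ card L"
        using L(1) w(1) by (simp add: good_def dissociated_def)
      moreover have "(1 + 1 / 32) ^ card (insert \<theta> L) = (1 + 1 / 32) ^ card L + (1 / 32) * (1 + 1 / 32 :: real) ^ card L"
        using finL False by (simp add: algebra_simps)
      moreover have "(1 + 1 / 32 :: real) ^ card L \<ge> 1"
        by (rule one_le_power) simp
      ultimately have "Re (w \<theta> * ?S) \<ge> 1 / 32"
        using w(2) by linarith
      also have "Re (w \<theta> * ?S) \<le> cmod (w \<theta> * ?S)"
        by (rule complex_Re_le_cmod)
      also have "\<dots> \<le> cmod ?S"
        using w(1)[of \<theta>] by (simp add: norm_mult mult_left_le_one_le)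
      finally have S: "1 / 32 \<le> cmod ?S" .
      obtain \<phi> where \<phi>: "cmod ?S \<le> 2 ^ card L * cmod (\<Sum>x\<in>C. of_real (b x) * cis (\<phi> * of_int x))"
        "\<forall>v::int. cmod (1 - cis (\<theta> * of_int v))
        \<le> cmod (1 - cis (\<phi> * of_int v)) + (\<Sum>t\<in>L. cmod (1 - cis (t * of_int v)))"
        using riesz_expand[where L = L and w = w and C = C and b = b and \<theta> = \<theta>, OF finL] w(1) by blast
      have "1 / 32 \<le> 2 ^ n * cmod (\<Sum>x\<in>C. of_real (b x) * cis (\<phi> * of_int x))"
      proof -
        have "(2::real) ^ card L \<le> 2 ^ n"
          using cardL by (rule power_increasing) simp
        then show ?thesis
          using S \<phi>(1) by (meson order_trans mult_right_mono norm_ge_zero)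
      qed
      then have "(1 / 2) ^ (n + 5) \<le> cmod (\<Sum>x\<in>C. of_real (b x) * cis (\<phi> * of_int x))"
        by (simp add: power_add power_divide field_simps)
      then show ?thesis
        using \<phi>(2) by blast
    qed
  qed
qed


section \<open>Smoothed weights and large coefficients on Bohr sets\<close>

text \<open>
  Convolving \<open>l\<close> times keeps the weight at least \<open>1 / card B0\<close> on the core, and Fourier coefficients become
  \<open>l\<close>-th powers. A coefficient of size \<open>2 ^ (- l)\<close> is thus forced to be at least \<open>1 / 2\<close> for \<open>B\<close>, so the
  radius shrinks by a factor polynomial in \<open>l\<close> and not exponential.
\<close>

fun smooth :: "int set \<Rightarrow> int set \<Rightarrow> nat \<Rightarrow> int \<Rightarrow> real" where
  "smooth B0 B 0 = (\<lambda>x. of_bool (x \<in> B0) / card B0)"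
| "smooth B0 B (Suc l) = (\<lambda>x. (\<Sum>b\<in>B. smooth B0 B l (x + (- b))) / card B)"

lemma smooth_nonneg: "0 \<le> smooth B0 B l x"
  by (induction l arbitrary: x) (auto intro!: divide_nonneg_nonneg sum_nonneg)

lemma fin_supp_smooth:
  assumes "finite B0" "finite B"
  shows "fin_supp (smooth B0 B l)"
proof (induction l)
  case 0
  show ?case
    using assms(1) by (rule rev_finite_subset) auto
next
  case (Suc l)
  have "finite (\<Union>b\<in>B. {x. smooth B0 B l (x + (- b)) \<noteq> 0})"
    using assms(2) Suc by (intro finite_UN_I fin_supp_shift)
  then show ?case
    unfolding smooth.simps by (rule rev_finite_subset) (rule supp_average[OF assms(2)])
qed

lemma ft_smooth:
  assumes "finite B0" "finite B"
  shows "ft (smooth B0 B l) \<theta> = ((\<Sum>b\<in>B. cis (\<theta> * of_int b)) / of_nat (card B)) ^ l * ft (smooth B0 B 0) \<theta>"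
proof (induction l)
  case (Suc l)
  have "ft (smooth B0 B (Suc l)) \<theta> = (\<Sum>b\<in>B. ft (\<lambda>x. smooth B0 B l (x + (- b))) \<theta>) / of_real (card B)"
    unfolding smooth.simps using assms by (intro ft_average fin_supp_shift fin_supp_smooth)
  also have "\<dots> = (\<Sum>b\<in>B. cis (\<theta> * of_int b)) / of_nat (card B) * ft (smooth B0 B l) \<theta>"
    unfolding ft_shift by (simp add: sum_distrib_right)
  finally show ?case
    by (simp only: Suc.IH power_Suc mult.assoc)
qed simp

lemma ft_smooth_0:
  assumes "finite B0"
  shows "ft (smooth B0 B 0) \<theta> = (\<Sum>x\<in>B0. cis (\<theta> * of_int x)) / of_nat (card B0)"
proof -
  have "ft (smooth B0 B 0) \<theta> = (\<Sum>x\<in>B0. of_real (smooth B0 B 0 x) * cis (\<theta> * of_int x))"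
    using assms by (intro ft_eq) (auto split: if_splits)
  also have "\<dots> = (\<Sum>x\<in>B0. cis (\<theta> * of_int x) / of_nat (card B0))"
    by (intro sum.cong refl) simp
  finally show ?thesis
    by (simp add: sum_divide_distrib)
qed

lemma norm_sum_cis_le: "cmod (\<Sum>x\<in>B. cis (f x)) \<le> card B"
  using norm_sum[of "\<lambda>x. cis (f x)" B] by simp

lemma cmod_ft_smooth:
  assumes "finite B0" "finite B"
  shows "cmod (ft (smooth B0 B l) \<theta>) \<le> (cmod (\<Sum>b\<in>B. cis (\<theta> * of_int b)) / card B) ^ l"
proof -
  have "cmod (ft (smooth B0 B 0) \<theta>) \<le> 1"
    using norm_sum_cis_le[of "\<lambda>x. \<theta> * of_int x" B0]
    by (auto simp: ft_smooth_0[OF assms(1)] norm_divide divide_le_eq_1 simp del: smooth.simps)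
  then have "(cmod (\<Sum>b\<in>B. cis (\<theta> * of_int b)) / card B) ^ l * cmod (ft (smooth B0 B 0) \<theta>)
      \<le> (cmod (\<Sum>b\<in>B. cis (\<theta> * of_int b)) / card B) ^ l * 1"
    by (rule mult_left_mono) simp
  moreover have "cmod (ft (smooth B0 B l) \<theta>)
      = (cmod (\<Sum>b\<in>B. cis (\<theta> * of_int b)) / card B) ^ l * cmod (ft (smooth B0 B 0) \<theta>)"
    by (subst ft_smooth[OF assms]) (simp only: norm_mult norm_power norm_divide norm_of_nat)
  ultimately show ?thesis
    by simp
qed

lemma sum_smooth:
  assumes "finite B0" "B0 \<noteq> {}" "finite B" "B \<noteq> {}" "finite C" "\<And>x. smooth B0 B l x \<noteq> 0 \<Longrightarrow> x \<in> C"
  shows "(\<Sum>x\<in>C. smooth B0 B l x) = 1"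
proof -
  have "ft (smooth B0 B l) 0 = of_real (\<Sum>x\<in>C. smooth B0 B l x)"
    using ft_eq[of C "smooth B0 B l" 0] assms(5,6) by simp
  moreover have "ft (smooth B0 B l) 0 = 1"
    using ft_smooth[OF assms(1,3), of l 0] ft_smooth_0[OF assms(1), of B 0] assms by simp
  ultimately show ?thesis
    by (metis of_real_eq_1_iff)
qed

lemma smooth_bohr_lower:
  assumes "R > 0" "r \<ge> 0" "s \<ge> 0" "x \<in> bohr G R r"
  shows "smooth (bohr G R (r + l * s)) (bohr G R s) l x \<ge> 1 / card (bohr G R (r + l * s))"
proof -
  \<comment> \<open>The induction follows a shrinking core: every convolution uses up one more
    \<open>s\<close> of the margin \<open>l * s\<close>.\<close>
  have "smooth (bohr G R (r + l * s)) (bohr G R s) j x \<ge> 1 / card (bohr G R (r + l * s))"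
    if "j \<le> l" "x \<in> bohr G R (r + (l - j) * s)" for j x
    using that
  proof (induction j arbitrary: x)
    case 0
    then show ?case by simp
  next
    case (Suc j)
    let ?B = "bohr G R s" and ?c = "1 / card (bohr G R (r + l * s))"
    have "?c \<le> smooth (bohr G R (r + l * s)) ?B j (x + (- b))" if "b \<in> ?B" for b
    proof (rule Suc.IH)
      have "x - b \<in> bohr G R (r + (l - Suc j) * s + s)"
        using Suc.prems(2) that by (rule bohr_diff)
      moreover have "r + (l - Suc j) * s + s = r + (l - j) * s"
        using Suc.prems(1) by (simp add: of_nat_diff algebra_simps)
      ultimately show "x + (- b) \<in> bohr G R (r + (l - j) * s)"
        by simp
    qed (use Suc.prems in simp)
    then have "(\<Sum>b\<in>?B. ?c) \<le> (\<Sum>b\<in>?B. smooth (bohr G R (r + l * s)) ?B j (x + (- b)))"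
      by (rule sum_mono)
    then have "?c \<le> (\<Sum>b\<in>?B. smooth (bohr G R (r + l * s)) ?B j (x + (- b))) / card ?B"
      using card_bohr_pos[of s R G] assms by (simp add: pos_le_divide_eq mult.commute)
    then show ?case
      by simp
  qed
  from this[of l x] show ?thesis
    using assms(4) by simp
qed

text \<open>Translating the set by \<open>v\<close> multiplies its character sum by
  \<open>cis (\<phi> * v)\<close>, but changes the set only inside the thin layer up to radius
  \<open>s + d\<close>. So \<open>1 - cis (\<phi> * v)\<close> times the sum is at most
  \<open>2 * \<eta>\<close> times the size, and the sum is at least half of the size.\<close>

lemma large_coeff_bohr:
  fixes \<eta> :: real
  assumes "R > 0" "s \<ge> 0" "d \<ge> 0" "v \<in> bohr G R d"
    "real (card (bohr G R (s + d))) \<le> (1 + \<eta>) * card (bohr G R s)"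
    "card (bohr G R s) \<le> 2 * cmod (\<Sum>b\<in>bohr G R s. cis (\<phi> * of_int b))"
  shows "cmod (1 - cis (\<phi> * of_int v)) \<le> 4 * \<eta>"
proof -
  let ?B = "bohr G R s" and ?B' = "bohr G R (s + d)" and ?V = "(\<lambda>b. b + v) ` bohr G R s"
  let ?e = "\<lambda>x::int. cis (\<phi> * of_int x)"
  have sub: "?B \<subseteq> ?B'" "?V \<subseteq> ?B'"
    using assms(1-4) bohr_mono[of s "s + d" R G G] bohr_add[OF _ assms(4)] by auto
  have cardV: "card ?V = card ?B"
    by (intro card_image) (auto simp: inj_on_def)
  have "(\<Sum>x\<in>?V. ?e x) = ?e v * (\<Sum>x\<in>?B. ?e x)"
    by (subst sum.reindex) (auto simp: inj_on_def sum_distrib_left cis_mult algebra_simps intro!: sum.cong)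
  then have "(1 - ?e v) * (\<Sum>x\<in>?B. ?e x) = (\<Sum>x\<in>?B. ?e x) - (\<Sum>x\<in>?V. ?e x)"
    by (simp add: algebra_simps)
  also have "\<dots> = (\<Sum>x\<in>?B' - ?V. ?e x) - (\<Sum>x\<in>?B' - ?B. ?e x)"
    using sub by (simp add: sum_diff)
  finally have "cmod (1 - ?e v) * cmod (\<Sum>x\<in>?B. ?e x)
      \<le> cmod (\<Sum>x\<in>?B' - ?V. ?e x) + cmod (\<Sum>x\<in>?B' - ?B. ?e x)"
    by (metis norm_mult norm_triangle_ineq4)
  also have "\<dots> \<le> card (?B' - ?V) + card (?B' - ?B)"
    using norm_sum_cis_le[of "\<lambda>x. \<phi> * of_int x" "?B' - ?V"] norm_sum_cis_le[of "\<lambda>x. \<phi> * of_int x" "?B' - ?B"]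
    by simp
  also have "\<dots> = 2 * (real (card ?B') - card ?B)"
    using sub cardV card_mono[OF finite_bohr sub(1)] by (simp add: card_Diff_subset finite_subset of_nat_diff)
  also have "\<dots> \<le> 2 * \<eta> * card ?B"
    using assms(5) by (simp add: algebra_simps)
  finally have "cmod (1 - ?e v) * cmod (\<Sum>x\<in>?B. ?e x) \<le> 2 * \<eta> * card ?B" .
  moreover have "cmod (1 - ?e v) * card ?B \<le> cmod (1 - ?e v) * (2 * cmod (\<Sum>x\<in>?B. ?e x))"
    using assms(6) by (intro mult_left_mono) auto
  ultimately have "cmod (1 - ?e v) * card ?B \<le> 4 * \<eta> * card ?B"
    by linarith
  then show ?thesis
    using card_bohr_pos[of s R G] assms(1,2) by simp
qed

text \<open>The weight uses \<open>l = n + 5\<close> convolutions over a regular radius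
  \<open>s\<close> with \<open>l * s \<le> \<delta>\<close>, so the doubling hypothesis bounds the
  set from which the smoothing starts. The tolerance is split in two: \<open>4 * (\<nu> / 8)\<close>
  for the large coefficient at \<open>\<phi>\<close>, and \<open>n * (\<nu> / (2 * n))\<close> for
  the frequencies in \<open>L\<close>.\<close>

lemma chang_bohr:
  fixes \<nu> \<delta> K :: real
  assumes "finite G" "card G + 1 \<le> D" "R > 0" "r > 0" "T \<subseteq> bohr G R r" "T \<noteq> {}" "\<delta> > 0"
    "card (bohr G R (r + \<delta>)) \<le> 2 * card (bohr G R r)"
    "real (card (bohr G R r)) \<le> K * card T" "32 * ln (2 * K) \<le> real n" "0 < \<nu>" "\<nu> \<le> 1" "n > 0"
  obtains L where "finite L" "card L \<le> n"
    "\<And>\<theta> v. \<theta> \<in> spec T \<Longrightarrow>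
      v \<in> bohr (G \<union> L) R (min (\<delta> / (2 * real (n + 5)) * (\<nu> / 8) / (28 * real D)) (\<nu> / (2 * real n))) \<Longrightarrow>
      cmod (1 - cis (\<theta> * of_int v)) \<le> \<nu>"
proof -
  define l where "l = n + 5"
  have lpos: "real l > 0"
    by (simp add: l_def)
  let ?m = "min (\<delta> / (2 * real l) * (\<nu> / 8) / (28 * real D)) (\<nu> / (2 * real n))"
  have D: "real D \<ge> 1"
    using assms(2) by simp
  obtain s where s: "\<delta> / (2 * real l) \<le> s" "s \<le> 2 * (\<delta> / (2 * real l))"
    "real (card (bohr G R (s + s * (\<nu> / 8) / (28 * real D)))) \<le> (1 + \<nu> / 8) * card (bohr G R s)"
    using bohr_regular_radius[of G R "\<delta> / (2 * real l)" D "\<nu> / 8"] assms lpos by auto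
  have spos: "s > 0"
    using s(1) assms(7) lpos by (intro less_le_trans[OF _ s(1)]) simp
  have ls: "l * s \<le> \<delta>"
    using mult_left_mono[OF s(2), of "real l"] lpos by simp
  let ?A = "bohr G R (r + l * s)" and ?B = "bohr G R s"
  let ?b = "smooth ?A ?B l"
  define C where "C = {x. ?b x \<noteq> 0} \<union> T"
  have finT: "finite T"
    using assms(5) by (rule finite_subset) simp
  have C: "finite C" "T \<subseteq> C" "\<And>x. ?b x \<noteq> 0 \<Longrightarrow> x \<in> C"
    unfolding C_def using finT fin_supp_smooth[of ?A ?B l, OF finite_bohr finite_bohr] by simp_all
  have nonempty: "?A \<noteq> {}" "?B \<noteq> {}"
    using card_bohr_pos[of "r + l * s" R G] card_bohr_pos[of s R G] assms(3,4) spos by auto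
  have ftb: "ft ?b \<phi> = (\<Sum>x\<in>C. of_real (?b x) * cis (\<phi> * of_int x))" for \<phi>
    using C by (intro ft_eq)
  let ?c = "2 * real (card (bohr G R r))"
  have cpos: "?c > 0"
    using card_bohr_pos[of r R G] assms(3,4) by simp
  have "bohr G R (r + l * s) \<subseteq> bohr G R (r + \<delta>)"
    using ls assms(3) by (intro bohr_mono) auto
  then have "card ?A \<le> card (bohr G R (r + \<delta>))"
    by (intro card_mono) auto
  then have cardB0: "real (card ?A) \<le> ?c"
    using assms(8) by linarith
  have low: "1 \<le> ?c * ?b x" if "x \<in> T" for x
  proof -
    have pos: "real (card ?A) > 0"
      using nonempty by (simp add: card_gt_0_iff)
    have "?b x \<ge> 1 / card ?A"
      using smooth_bohr_lower[of R r s x G l] assms(3-5) spos that by auto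
    then have "1 \<le> card ?A * ?b x"
      using pos by (simp add: pos_divide_le_eq mult.commute)
    also have "\<dots> \<le> ?c * ?b x"
      using cardB0 by (intro mult_right_mono smooth_nonneg)
    finally show ?thesis .
  qed
  have n: "32 * ln (?c / card T) \<le> real n"
  proof -
    have T: "real (card T) > 0"
      using finT assms(6) by (simp add: card_gt_0_iff)
    have "?c / card T \<le> 2 * K"
      using assms(9) T by (simp add: pos_divide_le_eq)
    moreover have "?c / card T > 0"
      using T cpos by simp
    ultimately have "ln (?c / card T) \<le> ln (2 * K)"
      by (subst ln_le_cancel_iff) auto
    then show ?thesis
      using assms(10) by linarith
  qed
  have sum1: "(\<Sum>x\<in>C. ?b x) = 1"
    using nonempty C(1,3) by (intro sum_smooth) simp_all
  obtain L where "finite L \<and> card L \<le> n \<and>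
    (\<forall>\<theta>\<in>spec T. \<exists>\<phi>. (1 / 2) ^ (n + 5) \<le> cmod (\<Sum>x\<in>C. of_real (?b x) * cis (\<phi> * of_int x))
      \<and> (\<forall>v::int. cmod (1 - cis (\<theta> * of_int v))
        \<le> cmod (1 - cis (\<phi> * of_int v)) + (\<Sum>t\<in>L. cmod (1 - cis (t * of_int v)))))"
    using chang[where b = ?b and c = ?c, OF C(1,2) assms(6) smooth_nonneg sum1 low cpos n] by (rule exE)
  note L = conjunct1[OF this] conjunct1[OF conjunct2[OF this]] conjunct2[OF conjunct2[OF this]]
  show thesis
  proof (rule that[OF L(1,2)])
    fix \<theta> v assume \<theta>: "\<theta> \<in> spec T"
      and "v \<in> bohr (G \<union> L) R (min (\<delta> / (2 * real (n + 5)) * (\<nu> / 8) / (28 * real D)) (\<nu> / (2 * real n)))"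
    then have v: "v \<in> bohr (G \<union> L) R ?m"
      by (simp only: l_def)
    obtain \<phi> where "(1 / 2) ^ (n + 5) \<le> cmod (\<Sum>x\<in>C. of_real (?b x) * cis (\<phi> * of_int x))
      \<and> (\<forall>v::int. cmod (1 - cis (\<theta> * of_int v))
        \<le> cmod (1 - cis (\<phi> * of_int v)) + (\<Sum>t\<in>L. cmod (1 - cis (t * of_int v))))"
      using bspec[OF L(3) \<theta>] by (rule exE)
    note \<phi> = conjunct1[OF this, folded ftb] spec[OF conjunct2[OF this], of v]
    \<comment> \<open>Taking the \<open>l\<close>-th root turns the tiny coefficient of the smoothed
      weight into one of size 1 / 2 for \<open>?B\<close>; comparing the bases needs the exponent as
      a successor.\<close>
    have "(1 / 2) ^ Suc (n + 4) \<le> (cmod (\<Sum>b\<in>?B. cis (\<phi> * of_int b)) / card ?B) ^ Suc (n + 4)"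
      using order_trans[OF \<phi>(1) cmod_ft_smooth[of ?A ?B l \<phi>, OF finite_bohr finite_bohr]]
      by (simp only: l_def add_Suc_right[symmetric] numeral_eq_Suc pred_numeral_simps)
    then have "1 / 2 \<le> cmod (\<Sum>b\<in>?B. cis (\<phi> * of_int b)) / card ?B"
      by (rule power_le_imp_le_base) auto
    then have big: "card ?B \<le> 2 * cmod (\<Sum>b\<in>?B. cis (\<phi> * of_int b))"
      using nonempty by (simp add: card_gt_0_iff pos_le_divide_eq)
    let ?d = "s * (\<nu> / 8) / (28 * real D)"
    have "\<delta> / (2 * real l) * (\<nu> / 8) / (28 * real D) \<le> ?d"
      using s(1) assms(11) D by (intro divide_right_mono mult_right_mono) auto
    then have "?m \<le> ?d"
      by linarith
    then have "bohr (G \<union> L) R ?m \<subseteq> bohr G R ?d"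
      using assms(3) by (intro bohr_mono) auto
    then have "cmod (1 - cis (\<phi> * of_int v)) \<le> 4 * (\<nu> / 8)"
      using v spos D assms(3,11) s(3) big by (intro large_coeff_bohr[of R s ?d v G]) auto
    moreover have "(\<Sum>t\<in>L. cmod (1 - cis (t * of_int v))) \<le> \<nu> / 2"
    proof -
      have "(\<Sum>t\<in>L. cmod (1 - cis (t * of_int v))) \<le> (\<Sum>t\<in>L. \<nu> / (2 * real n))"
        using v by (intro sum_mono) (auto simp: bohr_def)
      also have "\<dots> = card L * (\<nu> / (2 * real n))"
        by simp
      also have "\<dots> \<le> real n * (\<nu> / (2 * real n))"
        using L(2) assms(11) by (intro mult_right_mono) auto
      finally show ?thesis
        using assms(13) by simp
    qed
    ultimately show "cmod (1 - cis (\<theta> * of_int v)) \<le> \<nu>"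
      using \<phi>(2) by simp
  qed
qed


text \<open>
  The exponent \<open>k\<close> below is the number of samples: the accuracy \<open>1 / (32 m)\<close> has to survive \<open>m\<close> averagings, with
  failure probability \<open>exp (- 4 m)\<close>.
\<close>

lemma sparse_low_hit_ratio:
  fixes \<delta> R r r' :: real and m :: nat
  defines "n \<equiv> 2 ^ 21 * m ^ 4"
  assumes m: "m \<ge> 20"
    and G: "finite G" "card G + 1 \<le> D" "R > 0" "r > 0" "\<delta> > 0"
    and double: "card (bohr G R (r + \<delta>)) \<le> 2 * card (bohr G R r)"
    and Y: "Y \<subseteq> bohr G R r'" "Y \<noteq> {}" "real (card (bohr G R (r' + r))) \<le> exp (3 * real m) * card Y"
    and P: "finite P" "finite U"
      "\<And>u. (\<exists>y\<in>(\<lambda>y. 3 * y) ` Y. u + y \<in> S) \<Longrightarrow> u \<in> U" "finite S"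
      "\<And>p y. p \<in> P \<Longrightarrow> y \<in> Y \<Longrightarrow> p + 3 * y \<in> S"
  obtains L where "finite L" "card L \<le> n"
    "\<And>v. v \<in> bohr (G \<union> L) R (min (\<delta> / (2 * real (n + 5)) * (2 / 4 ^ m / 8) / (28 * real D)) (2 / 4 ^ m / (2 * real n))) \<Longrightarrow>
      real (card {u \<in> P. hit_ratio S ((\<lambda>y. 3 * y) ` Y) (u + 3 * v) < 1 / 2}) \<le> exp (- 2 * real m) / 40 * card U"
proof -
  let ?t = "\<lambda>y::int. 3 * y"
  let ?Y = "?t ` Y" and ?E = "?t ` bohr G R r" and ?W = "?t ` bohr G R (r' + r)"
  define k where "k = 16384 * m ^ 3"
  define \<epsilon> where "\<epsilon> = 1 / (32 * real m)"
  define F where "F = hit_ratio S ?Y"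
  have inj: "inj_on ?t X" for X
    by (simp add: inj_on_def)
  have m0: "real m \<ge> 20"
    using m by simp
  have finY: "finite Y"
    using Y(1) by (rule finite_subset) simp
  have kpos: "k > 0"
    using m by (simp add: k_def)
  have eps: "0 < \<epsilon>" "\<epsilon> \<le> 1"
    using m0 by (auto simp: \<epsilon>_def divide_le_eq)
  have ek: "\<epsilon>\<^sup>2 * k / 4 = 4 * real m"
    using m0 by (simp add: \<epsilon>_def k_def power2_eq_square power3_eq_cube field_simps)
  obtain T where T: "T \<subseteq> ?E" "real (card ?Y) ^ k * real (card ?E) \<le> 2 * real (card ?W) ^ k * real (card T)"
    "\<And>t t'. t \<in> T \<Longrightarrow> t' \<in> T \<Longrightarrow> \<exists>h. l1_bounded (8 * exp (- (\<epsilon>\<^sup>2 * k / 4)) * card U) h \<and>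
       (\<forall>u. \<bar>hit_ratio S ?Y (u + (t - t')) - hit_ratio S ?Y u\<bar> \<le> 2 * \<epsilon> + h u)"
  proof (rule croot_sisask[of S ?Y \<epsilon> ?E k U ?W])
    show "y + t \<in> ?W" if yt: "y \<in> ?Y" "t \<in> ?E" for y t
    proof -
      obtain y' t' where "y = 3 * y'" "t = 3 * t'" "y' \<in> Y" "t' \<in> bohr G R r"
        using yt by blast
      then show ?thesis
        using bohr_add[of y' G R r' t' r] Y(1) by (intro image_eqI[of _ _ "y' + t'"]) auto
    qed
  qed (use P Y(2) finY eps kpos in auto)
  \<comment> \<open>The dilation by 3 is undone: the coefficient of \<open>T\<close> at
    \<open>\<theta>\<close> is that of \<open>T0\<close> at \<open>3 * \<theta>\<close>, so Chang's
    theorem is applied to \<open>T0\<close> inside an undilated Bohr set. There \<open>v\<close>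
    nearly annihilates \<open>3 * \<theta>\<close>, which makes \<open>3 * v\<close> the almost
    period.\<close>
  define T0 where "T0 = {t \<in> bohr G R r. 3 * t \<in> T}"
  have T0: "T = ?t ` T0" "T0 \<subseteq> bohr G R r"
    using T(1) by (auto simp: T0_def)
  have finT0: "finite T0"
    using T0(2) by (rule finite_subset) simp
  have cardT: "card T = card T0"
    unfolding T0(1) using inj by (rule card_image)
  have Ypos: "real (card Y) > 0"
    using Y(2) finY by (simp add: card_gt_0_iff)
  \<comment> \<open>Every sample loses the density of \<open>Y\<close> in
    \<open>bohr G R (r' + r)\<close>, a factor of at most \<open>exp (3 * m)\<close>; the
    \<open>k\<close> samples lose its \<open>k\<close>-th power.\<close>
  have Tbig: "real (card (bohr G R r)) \<le> 2 * exp (3 * real m) ^ k * card T0"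
  proof -
    have "real (card Y) ^ k * real (card (bohr G R r)) \<le> 2 * real (card (bohr G R (r' + r))) ^ k * real (card T0)"
      using T(2) by (simp add: card_image[OF inj] cardT)
    also have "\<dots> \<le> 2 * (exp (3 * real m) * card Y) ^ k * real (card T0)"
      using Y(3) by (intro mult_right_mono mult_left_mono power_mono) auto
    finally have "real (card Y) ^ k * real (card (bohr G R r)) \<le> real (card Y) ^ k * (2 * exp (3 * real m) ^ k * card T0)"
      by (simp add: power_mult_distrib mult_ac)
    then show ?thesis
      by (rule mult_left_le_imp_le) (use Ypos in simp)
  qed
  have T0ne: "T0 \<noteq> {}"
  proof
    assume "T0 = {}"
    then have "real (card (bohr G R r)) \<le> 0"
      using Tbig by simp
    then show False
      using card_bohr_pos[of r R G] G by simp
  qed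
  \<comment> \<open>The tolerance on the spectrum matches the damping
    \<open>2 * (1 / 2) ^ (2 * m)\<close> off it.\<close>
  let ?\<nu> = "2 / 4 ^ m :: real"
  have nu: "0 < ?\<nu>" "?\<nu> \<le> 1"
  proof -
    have "(4::real) ^ 1 \<le> 4 ^ m"
      using m by (intro power_increasing) auto
    then show "?\<nu> \<le> 1"
      by (simp add: divide_le_eq)
  qed simp
  have npos: "n > 0"
    using m by (simp add: n_def)
  \<comment> \<open>The origin of \<open>n\<close>: the logarithm is at most
    \<open>4 * k * m\<close> with \<open>k = 2 ^ 14 * m ^ 3\<close>, and
    \<open>32 * 4 * 2 ^ 14 = 2 ^ 21\<close>.\<close>
  have n: "32 * ln (2 * (2 * exp (3 * real m) ^ k)) \<le> real n"
  proof -
    have "ln (2 * (2 * exp (3 * real m) ^ k)) = ln (4 * exp (k * (3 * real m)))"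
      by (simp flip: exp_of_nat_mult)
    also have "\<dots> = ln 4 + k * (3 * real m)"
      by (subst ln_mult) auto
    also have "\<dots> \<le> 4 + k * (3 * real m)"
      using ln_le_minus_one[of "4::real"] by simp
    also have "\<dots> \<le> 4 * (k * real m)"
    proof -
      have "1 * 20 \<le> real k * real m"
        using kpos m0 by (intro mult_mono) auto
      then show ?thesis
        by simp
    qed
    finally have "32 * ln (2 * (2 * exp (3 * real m) ^ k)) \<le> 128 * (k * real m)"
      by simp
    also have "\<dots> = real n"
      by (simp add: n_def k_def power3_eq_cube power4_eq_xxxx)
    finally show ?thesis .
  qed
  let ?rad = "min (\<delta> / (2 * real (n + 5)) * (?\<nu> / 8) / (28 * real D)) (?\<nu> / (2 * real n))"
  obtain L where L: "finite L" "card L \<le> n"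
    "\<And>\<theta> v. \<theta> \<in> spec T0 \<Longrightarrow> v \<in> bohr (G \<union> L) R ?rad \<Longrightarrow> cmod (1 - cis (\<theta> * of_int v)) \<le> ?\<nu>"
    by (rule chang_bohr[OF G(1,2,3,4) T0(2) T0ne G(5) double Tbig n nu npos]) blast
  show thesis
  proof (rule that[OF L(1,2)])
    fix v assume v: "v \<in> bohr (G \<union> L) R ?rad"
    define H where "H = (autoavg T ^^ m) F"
    have finT: "finite T" "T \<noteq> {}"
      using T0 finT0 T0ne by auto
    define c where "c = m * (8 * exp (- (4 * real m)) * card U)"
    obtain h where h: "l1_bounded c h" "\<And>u. \<bar>H u - F u\<bar> \<le> 1 / 16 + h u"
    proof -
      have "\<exists>h. l1_bounded (m * (8 * exp (- (4 * real m)) * card U)) h \<and> (\<forall>u. \<bar>((autoavg T ^^ m) F) u - F u\<bar> \<le> m * (2 * \<epsilon>) + h u)"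
        using T(3) unfolding ek F_def by (intro autoavg_iterate_close finT) simp
      moreover have "m * (2 * \<epsilon>) = 1 / 16"
        using m0 by (simp add: \<epsilon>_def)
      ultimately show ?thesis
        using that unfolding H_def c_def by auto
    qed
    have F1: "F u = 1" if "u \<in> P" for u
    proof -
      have "{y \<in> ?Y. u + y \<in> S} = ?Y"
        using P(5)[OF that] by auto
      then show ?thesis
        using Y(2) finY by (simp add: F_def hit_ratio_def card_image[OF inj])
    qed
    have F0: "u \<in> U" if "F u \<noteq> 0" for u
      using hit_ratio_eq_0[of ?Y u S] that P(3)[of u] unfolding F_def by blast
    have Fle: "(F u)\<^sup>2 \<le> 1" for u
      using hit_ratio_bounds(1)[of S ?Y u] hit_ratio_bounds(2)[of ?Y S u] finY
      unfolding F_def by (simp add: power_le_one)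
    have l2: "(\<Sum>u\<in>P. (H (u + 3 * v) - H u)\<^sup>2) \<le> ?\<nu>\<^sup>2 * card U"
    proof -
      have "(\<Sum>u\<in>P. (H (u + 3 * v) - H u)\<^sup>2) \<le> ?\<nu>\<^sup>2 * (\<Sum>u\<in>U. (F u)\<^sup>2)"
        unfolding H_def
      proof (rule autoavg_iterate_almost_period[OF finT(1) _ P(1,2) F0])
        fix \<theta>
        let ?z = "cmod (\<Sum>t\<in>T. cis (\<theta> * of_int t))"
        have z: "?z = cmod (\<Sum>t\<in>T0. cis ((3 * \<theta>) * of_int t))"
          unfolding T0(1) by (subst sum.reindex[OF inj]) (simp add: mult_ac)
        have Tp: "real (card T) > 0"
          using finT by (simp add: card_gt_0_iff)
        have e: "\<theta> * of_int (3 * v) = (3 * \<theta>) * of_int v"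
          by simp
        show "(?z / card T) ^ (2 * m) * cmod (1 - cis (\<theta> * of_int (3 * v))) \<le> ?\<nu>"
        proof (cases "3 * \<theta> \<in> spec T0")
          case True
          have "?z / card T \<le> 1"
            using norm_sum_cis_le[of "\<lambda>t. \<theta> * of_int t" T] Tp by simp
          then have "(?z / card T) ^ (2 * m) \<le> 1"
            by (intro power_le_one) auto
          then have "(?z / card T) ^ (2 * m) * cmod (1 - cis (\<theta> * of_int (3 * v)))
              \<le> 1 * cmod (1 - cis (\<theta> * of_int (3 * v)))"
            by (rule mult_right_mono) simp
          also have "\<dots> \<le> ?\<nu>"
            using L(3)[OF True v] unfolding e by simp
          finally show ?thesis .
        next
          case False
          then have "?z / card T \<le> 1 / 2"
            using Tp by (simp add: spec_def z cardT[symmetric] divide_le_eq)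
          then have "(?z / card T) ^ (2 * m) \<le> (1 / 2) ^ (2 * m)"
            by (intro power_mono) auto
          moreover have "cmod (1 - cis a) \<le> 2" for a
            using norm_triangle_ineq4[of 1 "cis a"] by simp
          ultimately have "(?z / card T) ^ (2 * m) * cmod (1 - cis (\<theta> * of_int (3 * v))) \<le> (1 / 2) ^ (2 * m) * 2"
            by (intro mult_mono) auto
          then show ?thesis
            by (simp add: power_mult power_divide power2_eq_square)
        qed
      qed (use nu in auto)
      also have "(\<Sum>u\<in>U. (F u)\<^sup>2) \<le> (\<Sum>u\<in>U. 1)"
        using Fle by (rule sum_mono)
      finally show ?thesis
        by (simp add: mult_left_mono)
    qed
    define X where "X = {u \<in> P. F (u + 3 * v) < 1 / 2}"
    \<comment> \<open>Where \<open>h\<close> is below 1 / 16, \<open>H\<close> is within 1 / 8 of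
      \<open>F\<close>. A drop of \<open>F\<close> from 1 to below 1 / 2 thus leaves a change of at
      least 1 / 4 in \<open>H\<close>. Markov's inequality handles the first two sets, Chebyshev's
      the third.\<close>
    have "X \<subseteq> {u \<in> P. h u \<ge> 1 / 16} \<union> {u \<in> P. h (u + 3 * v) \<ge> 1 / 16} \<union> {u \<in> P. (H (u + 3 * v) - H u)\<^sup>2 \<ge> 1 / 16}"
    proof
      fix u assume u: "u \<in> X"
      then have uP: "u \<in> P" "F u = 1" "F (u + 3 * v) < 1 / 2"
        by (simp_all add: X_def F1)
      have "\<bar>H (u + 3 * v) - H u\<bar> \<ge> 1 / 4" if "h u < 1 / 16" "h (u + 3 * v) < 1 / 16"
        using h(2)[of u] h(2)[of "u + 3 * v"] uP that by linarith
      moreover have "(H (u + 3 * v) - H u)\<^sup>2 \<ge> 1 / 16" if "\<bar>H (u + 3 * v) - H u\<bar> \<ge> 1 / 4"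
        using power_mono[OF that, of 2] by (simp add: power2_eq_square)
      ultimately show "u \<in> {u \<in> P. h u \<ge> 1 / 16} \<union> {u \<in> P. h (u + 3 * v) \<ge> 1 / 16} \<union> {u \<in> P. (H (u + 3 * v) - H u)\<^sup>2 \<ge> 1 / 16}"
        using uP(1) by (simp only: Un_iff mem_Collect_eq simp_thms) (meson not_le)
    qed
    then have "card X \<le> card ({u \<in> P. h u \<ge> 1 / 16} \<union> {u \<in> P. h (u + 3 * v) \<ge> 1 / 16} \<union> {u \<in> P. (H (u + 3 * v) - H u)\<^sup>2 \<ge> 1 / 16})"
      using P(1) by (intro card_mono) auto
    also have "\<dots> \<le> card {u \<in> P. h u \<ge> 1 / 16} + card {u \<in> P. h (u + 3 * v) \<ge> 1 / 16} + card {u \<in> P. (H (u + 3 * v) - H u)\<^sup>2 \<ge> 1 / 16}"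
      by (intro order_trans[OF card_Un_le] add_mono card_Un_le order_refl)
    finally have "real (card X) \<le> real (card {u \<in> P. h u \<ge> 1 / 16}) + real (card {u \<in> P. h (u + 3 * v) \<ge> 1 / 16}) + real (card {u \<in> P. (H (u + 3 * v) - H u)\<^sup>2 \<ge> 1 / 16})"
      by linarith
    also have "\<dots> \<le> c / (1 / 16) + c / (1 / 16) + 16 * (?\<nu>\<^sup>2 * card U)"
    proof (intro add_mono)
      show "real (card {u \<in> P. h u \<ge> 1 / 16}) \<le> c / (1 / 16)"
        using P(1) by (intro l1_bounded_card[OF h(1)]) auto
      show "real (card {u \<in> P. h (u + 3 * v) \<ge> 1 / 16}) \<le> c / (1 / 16)"
        using P(1) by (intro l1_bounded_card[OF l1_bounded_shift[OF h(1), of "3 * v"]]) auto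
      let ?Z = "{u \<in> P. (H (u + 3 * v) - H u)\<^sup>2 \<ge> 1 / 16}"
      have "real (card ?Z) * (1 / 16) = (\<Sum>u\<in>?Z. 1 / 16)"
        by simp
      also have "\<dots> \<le> (\<Sum>u\<in>?Z. (H (u + 3 * v) - H u)\<^sup>2)"
        by (rule sum_mono) simp
      also have "\<dots> \<le> (\<Sum>u\<in>P. (H (u + 3 * v) - H u)\<^sup>2)"
        using P(1) by (intro sum_mono2) auto
      finally show "real (card ?Z) \<le> 16 * (?\<nu>\<^sup>2 * card U)"
        using l2 by linarith
    qed
    also have "\<dots> = (256 * real m * exp (- (4 * real m)) + 64 / 16 ^ m) * card U"
    proof -
      have "?\<nu>\<^sup>2 = 4 / 16 ^ m"
        by (simp add: power2_eq_square power_mult_distrib[symmetric])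
      then show ?thesis
        by (simp add: c_def algebra_simps)
    qed
    \<comment> \<open>Each of the two terms is at most \<open>exp (- 2 * m) / 80\<close>, by
      \<open>4 \<le> exp 2 \<le> 8\<close> and \<open>2 ^ m \<ge> 20480\<close>.\<close>
    also have "\<dots> \<le> exp (- 2 * real m) / 40 * card U"
    proof (rule mult_right_mono)
      have big: "(2::real) ^ m \<ge> 20480"
      proof -
        have "(2::real) ^ 20 \<le> 2 ^ m"
          using m by (intro power_increasing) auto
        then show ?thesis
          by simp
      qed
      have e2: "exp 2 \<le> (8::real)"
      proof -
        have "exp (1::real) \<le> 2.8"
          using e_less_272 by simp
        then have "exp (1::real) * exp 1 \<le> 2.8 * 2.8"
          by (intro mult_mono) auto
        then show ?thesis
          by (simp flip: exp_add)
      qed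
      have "exp (2 * real m) \<le> 8 ^ m"
        using power_mono[OF e2, of m] by (simp add: exp_of_nat_mult[symmetric] mult.commute)
      then have "64 / 16 ^ m * exp (2 * real m) \<le> 64 / 16 ^ m * 8 ^ m"
        by (intro mult_left_mono) auto
      also have "\<dots> = 64 / 2 ^ m"
        by (simp add: field_simps flip: power_mult_distrib)
      also have "\<dots> \<le> 1 / 80"
        using big by (simp add: field_simps)
      finally have 1: "64 / 16 ^ m * exp (2 * real m) \<le> 1 / 80" .
      have "real m \<le> 2 ^ m"
        using of_nat_less_two_power[of m, where 'a = real] by simp
      moreover have "exp (- (2 * real m)) \<le> 1 / 4 ^ m"
      proof -
        have "(2::real) \<le> exp 1"
          using exp_ge_add_one_self[of "1::real"] by simp
        then have "2 * 2 \<le> exp (1::real) * exp 1"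
          by (intro mult_mono) auto
        then have "4 \<le> exp (2::real)"
          by (simp flip: exp_add)
        then have "4 ^ m \<le> exp (2 * real m)"
          using power_mono[of 4 "exp (2::real)" m] by (simp add: exp_of_nat_mult[symmetric] mult.commute)
        then show ?thesis
          by (simp add: exp_minus field_simps)
      qed
      ultimately have "256 * real m * exp (- (2 * real m)) \<le> 256 * 2 ^ m * (1 / 4 ^ m)"
        by (intro mult_mono) auto
      also have "\<dots> = 256 / 2 ^ m"
        by (simp add: field_simps flip: power_mult_distrib)
      also have "\<dots> \<le> 1 / 80"
        using big by (simp add: field_simps)
      finally have 2: "256 * real m * exp (- (2 * real m)) \<le> 1 / 80" .
      have "(256 * real m * exp (- (4 * real m)) + 64 / 16 ^ m) * exp (2 * real m)
          = 256 * real m * exp (- (2 * real m)) + 64 / 16 ^ m * exp (2 * real m)"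
        by (simp add: algebra_simps flip: exp_add)
      also have "\<dots> \<le> 1 / 40"
        using 1 2 by linarith
      finally show "256 * real m * exp (- (4 * real m)) + 64 / 16 ^ m \<le> exp (- 2 * real m) / 40"
        by (simp add: exp_minus field_simps)
    qed simp
    finally show "real (card {u \<in> P. hit_ratio S ?Y (u + 3 * v) < 1 / 2}) \<le> exp (- 2 * real m) / 40 * card U"
      by (simp add: X_def F_def)
  qed
qed


section \<open>The density increment\<close>

definition sol_free :: "int set \<Rightarrow> bool" where
  "sol_free A \<longleftrightarrow> (\<forall>x\<in>A. \<forall>y\<in>A. \<forall>z\<in>A. \<forall>w\<in>A. x + y + z = 3 * w \<longrightarrow> x = y \<and> y = z \<and> z = w)"

text \<open>The dilation \<open>q\<close> takes the values 1 and 3: the argument needs the density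
  of \<open>A\<close> on translates of Bohr sets and of their dilates by 3, and both are measured by
  counting inside the undilated Bohr set.\<close>

definition cnt :: "int set \<Rightarrow> int \<Rightarrow> int \<Rightarrow> int set \<Rightarrow> nat" where
  "cnt A x q C = card {c \<in> C. x + q * c \<in> A}"

text \<open>Here 2800 = 28 * 100 is the width obtained for \<open>\<eta> = 1 / 100\<close>.
  \<open>D\<close> is a separate upper bound for the rank, so that one value can serve all steps of
  the iteration.\<close>

definition regular :: "nat \<Rightarrow> real set \<Rightarrow> real \<Rightarrow> real \<Rightarrow> bool" where
  "regular D G R r \<longleftrightarrow> real (card (bohr G R (r + r / (2800 * real D)))) \<le> 101 / 100 * card (bohr G R r)"

lemma regular_radius:
  assumes "finite G" "R > 0" "r > 0" "card G + 1 \<le> D"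
  obtains s where "r \<le> s" "s \<le> 2 * r" "regular D G R s"
  using bohr_regular_radius[of G R r D "1 / 100"] assms by (auto simp: regular_def)

lemma regularD:
  assumes "regular D G R r" "R > 0" "d \<le> r / (2800 * real D)"
  shows "real (card (bohr G R (r + d))) \<le> 101 / 100 * card (bohr G R r)"
proof -
  have "bohr G R (r + d) \<subseteq> bohr G R (r + r / (2800 * real D))"
    using assms by (intro bohr_mono) auto
  then have "card (bohr G R (r + d)) \<le> card (bohr G R (r + r / (2800 * real D)))"
    by (intro card_mono) auto
  then show ?thesis
    using assms(1) unfolding regular_def by linarith
qed

lemma card_filter_eq_sum: "finite C \<Longrightarrow> card {c \<in> C. P c} = (\<Sum>c\<in>C. of_bool (P c))"
  by (simp add: Int_def)

text \<open>Double counting: each \<open>c\<close> is related by \<open>Q\<close> to the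
  \<open>card P\<close> distinct points \<open>f c p\<close> of \<open>B\<close>.\<close>

lemma sum_cnt_lower:
  assumes "finite B" "finite C" "finite P" "\<And>c p. c \<in> C \<Longrightarrow> p \<in> P \<Longrightarrow> f c p \<in> B"
    "\<And>c. inj_on (f c) P" "\<And>c p. c \<in> C \<Longrightarrow> p \<in> P \<Longrightarrow> Q (f c p) c"
  shows "card C * card P \<le> (\<Sum>x\<in>B. card {c \<in> C. Q x c})"
proof -
  have "card C * card P = (\<Sum>c\<in>C. card P)"
    by simp
  also have "\<dots> \<le> (\<Sum>c\<in>C. card {x \<in> B. Q x c})"
  proof (rule sum_mono)
    fix c assume "c \<in> C"
    then show "card P \<le> card {x \<in> B. Q x c}"
      using assms by (intro card_inj_on_le[of "f c"]) auto
  qed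
  also have "\<dots> = (\<Sum>c\<in>C. \<Sum>x\<in>B. of_bool (Q x c))"
    using assms(1) by (simp only: card_filter_eq_sum)
  also have "\<dots> = (\<Sum>x\<in>B. \<Sum>c\<in>C. of_bool (Q x c))"
    by (rule sum.swap)
  also have "\<dots> = (\<Sum>x\<in>B. card {c \<in> C. Q x c})"
    using assms(2) by (simp only: card_filter_eq_sum)
  finally show ?thesis .
qed

text \<open>The mean density over the translates is almost \<alpha> and none exceeds
  \<open>101 / 100 * \<alpha>\<close>, so a shortfall below \<open>\<beta> * \<alpha>\<close> cannot
  be compensated elsewhere. The constant comes from
  \<open>101 / 100 - 100 / 101 \<le> 1 / 50\<close>.\<close>

lemma few_sparse_translates:
  fixes \<alpha> \<beta> :: real
  assumes "R > 0" "finite C" "C \<noteq> {}" "\<And>c. c \<in> C \<Longrightarrow> q * c \<in> bohr G R d" "\<alpha> > 0" "\<beta> < 101 / 100" "0 \<le> \<beta>"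
    "real (card (bohr G R (r + d))) \<le> 101 / 100 * card (bohr G R r)"
    "\<alpha> * card (bohr G R r) \<le> card (A \<inter> bohr G R r)"
    "\<And>x. real (cnt A x q C) \<le> 101 / 100 * \<alpha> * card C"
  shows "(101 / 100 - \<beta>) * card {x \<in> bohr G R (r + d). real (cnt A x q C) < \<beta> * \<alpha> * card C} \<le> 1 / 50 * card (bohr G R (r + d))"
proof -
  let ?B = "bohr G R (r + d)"
  let ?low = "{x \<in> ?B. real (cnt A x q C) < \<beta> * \<alpha> * card C}"
  have C: "real (card C) > 0"
    using assms(2,3) by (simp add: card_gt_0_iff)
  have "card C * card (A \<inter> bohr G R r) \<le> (\<Sum>x\<in>?B. cnt A x q C)"
    unfolding cnt_def
  proof (rule sum_cnt_lower[where f = "\<lambda>c p. p - q * c"])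
    show "p - q * c \<in> ?B" if "c \<in> C" "p \<in> A \<inter> bohr G R r" for c p
      using that assms(4)[of c] by (auto intro: bohr_diff)
  qed (use assms(2) in \<open>auto simp: inj_on_def\<close>)
  then have "real (card C * card (A \<inter> bohr G R r)) \<le> real (\<Sum>x\<in>?B. cnt A x q C)"
    by (rule of_nat_mono)
  then have "card C * real (card (A \<inter> bohr G R r)) \<le> (\<Sum>x\<in>?B. real (cnt A x q C))"
    by simp
  also have "\<dots> \<le> (\<Sum>x\<in>?B. 101 / 100 * \<alpha> * card C - (101 / 100 - \<beta>) * \<alpha> * card C * of_bool (x \<in> ?low))"
    using assms(10) by (intro sum_mono) (auto simp: algebra_simps of_bool_def)
  also have "\<dots> = \<alpha> * card C * (101 / 100 * card ?B - (101 / 100 - \<beta>) * card ?low)"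
  proof -
    have "(\<Sum>x\<in>?B. of_bool (x \<in> ?low)) = real (card (?B \<inter> {x. x \<in> ?low}))"
      by (intro sum_of_bool_eq finite_bohr)
    also have "?B \<inter> {x. x \<in> ?low} = ?low"
      by auto
    finally show ?thesis
      by (simp only: sum_subtractf sum_constant sum_distrib_left[symmetric]) (simp add: algebra_simps)
  qed
  finally have "card C * real (card (A \<inter> bohr G R r)) \<le> \<alpha> * card C * (101 / 100 * card ?B - (101 / 100 - \<beta>) * card ?low)" .
  moreover have "card C * (\<alpha> * card (bohr G R r)) \<le> card C * real (card (A \<inter> bohr G R r))"
    using assms(9) by (intro mult_left_mono) auto
  ultimately have "\<alpha> * card C * card (bohr G R r) \<le> \<alpha> * card C * (101 / 100 * card ?B - (101 / 100 - \<beta>) * card ?low)"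
    by (simp add: mult_ac)
  then have "real (card (bohr G R r)) \<le> 101 / 100 * card ?B - (101 / 100 - \<beta>) * card ?low"
    using C assms(5) by simp
  then show ?thesis
    using assms(8) by linarith
qed

text \<open>The coefficients of \<open>x + y + z - 3 * w\<close> sum to 0, so translations and
  dilations carry solutions to solutions. This allows \<open>A\<close> to be recentred and rescaled
  at every step.\<close>

lemma sol_free_affine:
  assumes "sol_free A" "q \<noteq> 0"
  shows "sol_free {y. x + q * y \<in> A}"
  unfolding sol_free_def
proof (intro ballI impI)
  fix a b c d assume *: "a \<in> {y. x + q * y \<in> A}" "b \<in> {y. x + q * y \<in> A}" "c \<in> {y. x + q * y \<in> A}"
    "d \<in> {y. x + q * y \<in> A}" "a + b + c = 3 * d"
  have "q * (a + b + c) = q * (3 * d)"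
    using *(5) by simp
  then have "(x + q * a) + (x + q * b) + (x + q * c) = 3 * (x + q * d)"
    by (simp add: algebra_simps)
  then have "x + q * a = x + q * b \<and> x + q * b = x + q * c \<and> x + q * c = x + q * d"
    using assms(1) * unfolding sol_free_def by blast
  then show "a = b \<and> b = c \<and> c = d"
    using assms(2) by simp
qed

lemma scale_le:
  assumes "0 \<le> x" "1 \<le> a" "0 \<le> b" "b \<le> 1" "1 \<le> c"
  shows "x / a * b / c \<le> (x :: real)"
proof -
  have "x / a * b \<le> x * 1"
    using assms by (intro mult_mono) (auto simp: divide_le_eq mult_le_cancel_left1)
  moreover have "0 \<le> x / a * b"
    using assms by auto
  moreover have "y / c \<le> y" if "0 \<le> y" for y
    using that assms(5) by (simp add: divide_le_eq mult_le_cancel_left1)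
  ultimately show ?thesis
    by fastforce
qed

text \<open>Each radius has its task: \<open>r0\<close> carries \<open>P\<close>, \<open>r1\<close>
  the translate \<open>c + Y\<close>, \<open>r2\<close> the set \<open>Y\<close>, and
  \<open>r3\<close> the shifts that give almost periods. The gaps between them let regularity absorb
  the shifts, so that everything stays in a set \<open>U\<close> barely larger than
  \<open>bohr G R r0\<close>. The density on \<open>r0\<close> is \<open>9 / 10 * \<alpha>\<close>,
  not \<open>1 / 2 * \<alpha>\<close> as on the others, because the final count of overlaps gives no
  contradiction at half the density.\<close>

lemma centred_contradiction:
  fixes \<alpha> R r0 r1 r2 r3 :: real and m D :: nat
  defines "n \<equiv> 2 ^ 21 * m ^ 4"
  defines "\<delta> \<equiv> r3 / (2800 * real D)"
  defines "rad \<equiv> min (\<delta> / (2 * real (n + 5)) * (2 / 4 ^ m / 8) / (28 * real D)) (2 / 4 ^ m / (2 * real n))"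
  assumes m: "m \<ge> 20" and \<alpha>: "exp (- real m) \<le> \<alpha>" and A: "sol_free A"
    and G: "finite G" "card G + 1 + n \<le> D" "R > 0"
    and r: "0 < r3" "r3 \<le> r2 / (2800 * real D)" "r2 \<le> r1 / (2800 * real D)" "r1 \<le> r0 / (2800 * real D) / 20"
    and reg: "regular D G R r0" "regular D G R r1" "regular D G R r2" "regular D G R r3"
    and dense: "9 / 10 * \<alpha> * card (bohr G R r0) \<le> card (A \<inter> bohr G R r0)"
      "1 / 2 * \<alpha> * card (bohr G R r1) \<le> cnt A 0 1 (bohr G R r1)"
      "1 / 2 * \<alpha> * card (bohr G R r2) \<le> cnt A 0 3 (bohr G R r2)"
    and noinc: "\<And>G' s x. finite G' \<Longrightarrow> G \<subseteq> G' \<Longrightarrow> card G' \<le> card G + n \<Longrightarrow> rad / 4 \<le> s \<Longrightarrow> s \<le> rad / 2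
      \<Longrightarrow> regular D G' R s \<Longrightarrow> real (cnt A x 3 (bohr G' R s)) \<le> 101 / 100 * \<alpha> * card (bohr G' R s)"
    and large: "25 * exp (2 * real m) \<le> card (bohr G R r2)"
  shows False
proof -
  have D: "real D \<ge> 1"
    using G(2) by simp
  have m0: "real m \<ge> 20"
    using m by simp
  have \<alpha>0: "\<alpha> > 0"
    using \<alpha> exp_gt_zero[of "- real m"] by linarith
  have sq: "exp (- 2 * real m) \<le> \<alpha>\<^sup>2"
  proof -
    have "exp (- real m) * exp (- real m) \<le> \<alpha> * \<alpha>"
      using \<alpha> \<alpha>0 by (intro mult_mono) auto
    then show ?thesis
      by (simp add: power2_eq_square flip: exp_add)
  qed
  have shrink: "0 < t \<and> t \<le> s" if "0 < s" "t = s / (2800 * real D)" for s t :: real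
    using that D by (simp add: divide_le_eq)
  have r2: "0 < r2"
    using r(1,2) D by (smt (verit) zero_less_divide_iff)
  have r1: "0 < r1"
    using r2 r(3) D by (smt (verit) zero_less_divide_iff)
  have r0: "0 < r0"
    using r1 r(4) D by (smt (verit) zero_less_divide_iff)
  define d0 where "d0 = r0 / (2800 * real D)"
  have d0: "0 < d0" "d0 \<le> r0" "r1 \<le> d0 / 20"
    using shrink[OF r0 d0_def] r(4) by (simp_all add: d0_def)
  have r21: "r2 \<le> r1" and r32: "r3 \<le> r2"
    using shrink[OF r1 refl] shrink[OF r2 refl] r(2,3) by linarith+
  have \<delta>: "0 < \<delta>" "\<delta> \<le> r3"
    using shrink[OF r(1) \<delta>_def[THEN meta_eq_to_obj_eq]] by auto
  define W where "W = A \<inter> bohr G R r1"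
  define Y1 where "Y1 = {e \<in> bohr G R r2. 3 * e \<in> A}"
  have W: "1 / 2 * \<alpha> * card (bohr G R r1) \<le> card W"
  proof -
    have "{c \<in> bohr G R r1. 0 + 1 * c \<in> A} = W"
      by (auto simp: W_def)
    then show ?thesis
      using dense(2) by (simp only: cnt_def)
  qed
  have Y1: "1 / 2 * \<alpha> * card (bohr G R r2) \<le> card Y1"
    using dense(3) by (simp add: cnt_def Y1_def)
  let ?Z = "bohr G R (r1 + r2)"
  have Zle: "real (card ?Z) \<le> 101 / 100 * card (bohr G R r1)"
    using regularD[OF reg(2) G(3) r(3)] .
  have "card Y1 * card W \<le> (\<Sum>c\<in>?Z. card {y \<in> Y1. y + c \<in> W})"
  proof (rule sum_cnt_lower[where f = "\<lambda>y w. w - y"])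
    show "w - y \<in> ?Z" if "y \<in> Y1" "w \<in> W" for y w
      using that by (auto simp: Y1_def W_def intro: bohr_diff)
  qed (auto simp: inj_on_def Y1_def W_def)
  then have sumY: "real (card Y1) * card W \<le> (\<Sum>c\<in>?Z. real (card {y \<in> Y1. y + c \<in> W}))"
    by (simp flip: of_nat_mult of_nat_sum)
  \<comment> \<open>Averaging over \<open>c\<close>: differences of \<open>W\<close> and
    \<open>Y1\<close> lie in \<open>?Z\<close>, which is hardly larger than
    \<open>bohr G R r1\<close>, so some \<open>c\<close> retains a proportion of about
    \<open>\<alpha> / 2\<close> of \<open>Y1\<close>.\<close>
  have "\<exists>c\<in>?Z. 1 / 2 * \<alpha> * card Y1 \<le> 101 / 100 * card {y \<in> Y1. y + c \<in> W}"
  proof (rule ccontr)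
    assume "\<not> ?thesis"
    then have "\<And>c. c \<in> ?Z \<Longrightarrow> 101 / 100 * real (card {y \<in> Y1. y + c \<in> W}) < 1 / 2 * \<alpha> * card Y1"
      by (auto simp: not_le)
    then have "(\<Sum>c\<in>?Z. 101 / 100 * real (card {y \<in> Y1. y + c \<in> W})) < (\<Sum>c\<in>?Z. 1 / 2 * \<alpha> * card Y1)"
    proof (intro sum_strict_mono)
      show "?Z \<noteq> {}"
        using card_bohr_pos[of "r1 + r2" R G] r1 r2 G(3) by (auto simp: card_gt_0_iff)
    qed simp_all
    moreover have "(\<Sum>c\<in>?Z. 101 / 100 * real (card {y \<in> Y1. y + c \<in> W})) = 101 / 100 * (\<Sum>c\<in>?Z. real (card {y \<in> Y1. y + c \<in> W}))"
      by (rule sum_distrib_left[symmetric])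
    moreover have "(\<Sum>c\<in>?Z. 1 / 2 * \<alpha> * card Y1) = card ?Z * (1 / 2 * \<alpha> * card Y1)"
      by (rule sum_constant)
    ultimately have "101 / 100 * (real (card Y1) * card W) < card ?Z * (1 / 2 * \<alpha> * card Y1)"
      using sumY by linarith
    also have "\<dots> \<le> 101 / 100 * card (bohr G R r1) * (1 / 2 * \<alpha> * card Y1)"
      using Zle \<alpha>0 by (intro mult_right_mono) auto
    also have "\<dots> = 101 / 100 * card Y1 * (1 / 2 * \<alpha> * card (bohr G R r1))"
      by simp
    also have "\<dots> \<le> 101 / 100 * card Y1 * card W"
      using W by (intro mult_left_mono) auto
    finally show False
      by simp
  qed
  then obtain c where c: "c \<in> ?Z" "1 / 2 * \<alpha> * card Y1 \<le> 101 / 100 * card {y \<in> Y1. y + c \<in> W}"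
    by blast
  define Y where "Y = {y \<in> Y1. y + c \<in> W}"
  have YA: "y \<in> bohr G R r2" "3 * y \<in> A" "c + y \<in> A" if "y \<in> Y" for y
    using that by (auto simp: Y_def Y1_def W_def add.commute)
  have cardY: "\<alpha>\<^sup>2 * card (bohr G R r2) \<le> 5 * card Y"
  proof -
    have "1 / 2 * \<alpha> * (1 / 2 * \<alpha> * card (bohr G R r2)) \<le> 1 / 2 * \<alpha> * card Y1"
      using Y1 \<alpha>0 by (intro mult_left_mono) auto
    also have "\<dots> \<le> 101 / 100 * card Y"
      using c(2) by (simp add: Y_def)
    finally have "\<alpha>\<^sup>2 * card (bohr G R r2) \<le> 101 / 25 * card Y"
      by (simp add: power2_eq_square)
    also have "\<dots> \<le> 5 * card Y"
      by simp
    finally show ?thesis .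
  qed
  have finY: "finite Y"
    by (simp add: Y_def Y1_def)
  \<comment> \<open>At least 5 elements, so that half of \<open>Y\<close> still contains
    two.\<close>
  have Y5: "card Y \<ge> 5"
  proof -
    have "25 = exp (- 2 * real m) * (25 * exp (2 * real m))"
      by (simp flip: exp_add)
    also have "\<dots> \<le> \<alpha>\<^sup>2 * card (bohr G R r2)"
      using sq large by (intro mult_mono) auto
    finally show ?thesis
      using cardY by linarith
  qed
  have Ydens: "real (card (bohr G R (r2 + r3))) \<le> exp (3 * real m) * card Y"
  proof -
    have "real (card (bohr G R (r2 + r3))) \<le> 101 / 100 * card (bohr G R r2)"
      by (rule regularD[OF reg(3) G(3) r(2)])
    also have "real (card (bohr G R r2)) = exp (2 * real m) * (exp (- 2 * real m) * card (bohr G R r2))"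
      by (simp add: mult.assoc[symmetric] flip: exp_add)
    also have "101 / 100 * (exp (2 * real m) * (exp (- 2 * real m) * card (bohr G R r2)))
        \<le> 101 / 100 * (exp (2 * real m) * (5 * card Y))"
      using order_trans[OF mult_right_mono[OF sq, of "card (bohr G R r2)"] cardY]
      by (intro mult_left_mono) auto
    also have "\<dots> = exp (2 * real m) * (101 / 20 * card Y)"
      by simp
    also have "\<dots> \<le> exp (2 * real m) * (exp (real m) * card Y)"
    proof (intro mult_left_mono mult_right_mono)
      show "101 / 20 \<le> exp (real m)"
        using exp_ge_add_one_self[of "real m"] m0 by linarith
    qed auto
    also have "\<dots> = exp (3 * real m) * card Y"
      by (simp add: mult.assoc[symmetric] flip: exp_add)
    finally show ?thesis .
  qed
  define P where "P = A \<inter> bohr G R r0"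
  define U where "U = bohr G R (r0 + d0)"
  define S where "S = (\<lambda>(p, y). p + 3 * y) ` (P \<times> Y)"
  have finP: "finite P" and finU: "finite U" and finS: "finite S"
    using finY by (auto simp: P_def U_def S_def)
  have cardU: "real (card U) \<le> 101 / 100 * card (bohr G R r0)"
    unfolding U_def by (rule regularD[OF reg(1) G(3)]) (simp add: d0_def)
  have inU: "x \<in> U" if "x \<in> bohr G R (r0 + t)" "t \<le> d0" for x t
    using bohr_mono[of "r0 + t" "r0 + d0" R G G] that G(3) by (auto simp: U_def)
  have supp: "u \<in> U" if uS: "\<exists>y\<in>(\<lambda>y. 3 * y) ` Y. u + y \<in> S" for u
  proof -
    obtain y p y' where *: "y \<in> Y" "p \<in> P" "y' \<in> Y" "u + 3 * y = p + 3 * y'"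
      using uS unfolding S_def by auto
    have u: "u = p + 3 * y' - 3 * y"
      using *(4) by simp
    have "u \<in> bohr G R (r0 + 3 * r2 + 3 * r2)"
      unfolding u using * YA(1) by (intro bohr_diff bohr_add bohr_triple) (auto simp: P_def)
    then show ?thesis
      using inU[of u "6 * r2"] r21 d0 by (simp add: add.assoc)
  qed
  have double: "card (bohr G R (r3 + \<delta>)) \<le> 2 * card (bohr G R r3)"
    using regularD[OF reg(4) G(3), of \<delta>] by (simp add: \<delta>_def)
  have hyps: "card G + 1 \<le> D" "Y \<subseteq> bohr G R r2" "Y \<noteq> {}" "\<And>p y. p \<in> P \<Longrightarrow> y \<in> Y \<Longrightarrow> p + 3 * y \<in> S"
    using G(2) YA(1) Y5 by (auto simp: S_def)
  obtain L where L: "finite L" "card L \<le> n"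
    "\<And>v. v \<in> bohr (G \<union> L) R rad \<Longrightarrow>
      real (card {u \<in> P. hit_ratio S ((\<lambda>y. 3 * y) ` Y) (u + 3 * v) < 1 / 2}) \<le> exp (- 2 * real m) / 40 * card U"
    by (rule sparse_low_hit_ratio[OF m G(1) hyps(1) G(3) r(1) \<delta>(1) double hyps(2,3) Ydens finP finU supp finS hyps(4),
          folded n_def, folded rad_def]; blast)
  have low: "hit_ratio S ((\<lambda>y. 3 * y) ` Y) (3 * c - a) < 1 / 2" if a: "a \<in> A" for a
  proof (rule ccontr)
    assume "\<not> ?thesis"
    then have ge: "hit_ratio S ((\<lambda>y. 3 * y) ` Y) (3 * c - a) \<ge> 1 / 2"
      by simp
    let ?Q = "{y \<in> Y. 3 * c - a + 3 * y \<in> S}"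
    have "{y \<in> (\<lambda>y. 3 * y) ` Y. 3 * c - a + y \<in> S} = (\<lambda>y. 3 * y) ` ?Q"
      by auto
    moreover have "inj_on (\<lambda>y::int. 3 * y) X" for X
      by (simp add: inj_on_def)
    ultimately have "hit_ratio S ((\<lambda>y. 3 * y) ` Y) (3 * c - a) = card ?Q / card Y"
      unfolding hit_ratio_def by (simp only: card_image)
    then have "1 / 2 \<le> card ?Q / card Y"
      using ge by (simp only:)
    moreover have "real (card Y) > 0"
      using Y5 by simp
    ultimately have "real (card Y) \<le> 2 * card ?Q"
      by (simp add: pos_le_divide_eq)
    \<comment> \<open>A trivial solution would determine the element of \<open>Q\<close>, hence two elements suffice.\<close>
    then have "card ?Q \<ge> 2"
      using Y5 by linarith
    then have "\<not> ?Q \<subseteq> {a - c}"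
      using card_mono[of "{a - c}" ?Q] by auto
    then obtain e where e: "e \<in> Y" "3 * c - a + 3 * e \<in> S" "e \<noteq> a - c"
      by blast
    then obtain p y where py: "p \<in> P" "y \<in> Y" "3 * c - a + 3 * e = p + 3 * y"
      by (auto simp: S_def)
    then have "a + 3 * y + p = 3 * (c + e)"
      by (simp add: algebra_simps)
    moreover have "p \<in> A" "3 * y \<in> A" "c + e \<in> A"
      using py YA e by (auto simp: P_def)
    ultimately have "a = 3 * y \<and> 3 * y = p \<and> p = c + e"
      using A a unfolding sol_free_def by blast
    then show False
      using e(3) by simp
  qed
  \<comment> \<open>The point \<open>a = 3 * c - u - 3 * v\<close> of \<open>A\<close> is reflected
    to \<open>u + 3 * v\<close>, where the hit ratio is below 1 / 2; few \<open>u\<close> in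
    \<open>P\<close> allow this.\<close>
  have sparse: "real (card {u \<in> P. 3 * c - u - 3 * v \<in> A}) \<le> \<alpha>\<^sup>2 / 40 * card U" if v: "v \<in> bohr (G \<union> L) R rad" for v
  proof -
    have "{u \<in> P. 3 * c - u - 3 * v \<in> A} \<subseteq> {u \<in> P. hit_ratio S ((\<lambda>y. 3 * y) ` Y) (u + 3 * v) < 1 / 2}"
      using low[of "3 * c - _ - 3 * v"] by auto
    then have "card {u \<in> P. 3 * c - u - 3 * v \<in> A} \<le> card {u \<in> P. hit_ratio S ((\<lambda>y. 3 * y) ` Y) (u + 3 * v) < 1 / 2}"
      using finP by (intro card_mono) auto
    then have "real (card {u \<in> P. 3 * c - u - 3 * v \<in> A}) \<le> exp (- 2 * real m) / 40 * card U"
      using L(3)[OF v] by linarith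
    also have "\<dots> \<le> \<alpha>\<^sup>2 / 40 * card U"
      using sq by (intro mult_right_mono) auto
    finally show ?thesis .
  qed
  define G' where "G' = G \<union> L"
  have G': "finite G'" "G \<subseteq> G'" "card G' \<le> card G + n"
    using G(1) L(1,2) card_Un_le[of G L] by (auto simp: G'_def)
  have npos: "n > 0"
    using m by (simp add: n_def)
  have rad: "0 < rad" "rad \<le> r3"
  proof -
    have "(1::real) \<le> 4 ^ m"
      by (rule one_le_power) simp
    then have "(1::real) \<le> 4 * 4 ^ m"
      by linarith
    then have "2 / 4 ^ m / 8 \<le> (1::real)"
      by (simp add: divide_le_eq)
    then have "\<delta> / (2 * real (n + 5)) * (2 / 4 ^ m / 8) / (28 * real D) \<le> \<delta>"
      using \<delta>(1) D by (intro scale_le) auto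
    then show "rad \<le> r3"
      unfolding rad_def using \<delta>(2) by linarith
    show "0 < rad"
      unfolding rad_def using \<delta>(1) D npos by simp
  qed
  obtain s where s: "rad / 4 \<le> s" "s \<le> 2 * (rad / 4)" "regular D G' R s"
    using regular_radius[of G' R "rad / 4" D] G' G rad by auto
  let ?V = "bohr G' R s"
  define M where "M = 101 / 100 * \<alpha> * card ?V"
  \<comment> \<open>\<open>g\<close> and \<open>h\<close> count \<open>P\<close> and the reflection
    of \<open>A\<close> on the translate of \<open>3 * ?V\<close> by \<open>u\<close>, the latter up
    to the sign of \<open>v\<close>. The radius of \<open>?V\<close> is at most
    \<open>rad / 2\<close>, so that sums \<open>v + w\<close> are still admissible shifts.\<close>
  define g where "g u = card {v \<in> ?V. u + 3 * v \<in> P}" for u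
  define h where "h u = card {v \<in> ?V. 3 * c - u + 3 * v \<in> A}" for u
  have spos: "0 < s" "s \<le> rad / 2"
    using s rad by auto
  have Vpos: "real (card ?V) > 0"
    using card_bohr_pos[of s R G'] spos G(3) by simp
  have hM: "real (h u) \<le> M" for u
    using noinc[of G' s "3 * c - u"] G' s spos by (simp add: h_def cnt_def M_def)
  have gM: "real (g u) \<le> M" for u
  proof -
    have "g u \<le> cnt A u 3 ?V"
      unfolding g_def cnt_def by (intro card_mono) (auto simp: P_def)
    then show ?thesis
      using noinc[of G' s u] G' s spos by (simp add: M_def)
  qed
  have Vsmall: "3 * v \<in> bohr G R (3 * s)" if "v \<in> ?V" for v
    using that bohr_mono[of s s R G G'] G' G(3) by (intro bohr_triple) auto
  have sd: "s \<le> d0 / 20"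
    using spos rad r32 r21 d0 by linarith
  have sumg: "card ?V * card P \<le> (\<Sum>u\<in>U. g u)"
    unfolding g_def
  proof (rule sum_cnt_lower[where f = "\<lambda>v p. p - 3 * v"])
    show "p - 3 * v \<in> U" if "v \<in> ?V" "p \<in> P" for v p
    proof (rule inU)
      show "p - 3 * v \<in> bohr G R (r0 + 3 * s)"
        using that Vsmall by (intro bohr_diff) (auto simp: P_def)
    qed (use sd d0 in auto)
  qed (use finP finU in \<open>auto simp: inj_on_def\<close>)
  \<comment> \<open>The reflection moves points by \<open>3 * c\<close>, of radius
    \<open>3 * (r1 + r2)\<close>; the extra factor 1 / 20 in the bound for \<open>r1\<close> keeps
    the image in \<open>U\<close>.\<close>
  have sumh: "card ?V * card P \<le> (\<Sum>u\<in>U. h u)"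
    unfolding h_def
  proof (rule sum_cnt_lower[where f = "\<lambda>v p. 3 * c + 3 * v - p"])
    show "3 * c + 3 * v - p \<in> U" if "v \<in> ?V" "p \<in> P" for v p
    proof (rule inU)
      have "3 * c + 3 * v - p \<in> bohr G R (3 * (r1 + r2) + 3 * s + r0)"
        using that(2) bohr_diff[OF bohr_add[OF bohr_triple[OF c(1)] Vsmall[OF that(1)]], of p r0]
        by (simp add: P_def)
      then show "3 * c + 3 * v - p \<in> bohr G R (r0 + (3 * (r1 + r2) + 3 * s))"
        by (simp add: algebra_simps)
    qed (use sd d0 r21 in auto)
    show "3 * c - (3 * c + 3 * v - p) + 3 * v \<in> A" if "v \<in> ?V" "p \<in> P" for v p
      using that by (simp add: P_def)
  qed (use finP finU in \<open>auto simp: inj_on_def\<close>)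
  have upper: "(\<Sum>u\<in>U. real (g u) * real (h u)) \<le> (card ?V)\<^sup>2 * (\<alpha>\<^sup>2 / 40 * card U)"
  proof -
    have "(\<Sum>u\<in>U. g u * h u) = (\<Sum>u\<in>U. \<Sum>v\<in>?V. \<Sum>w\<in>?V. of_bool (u + 3 * v \<in> P \<and> 3 * c - u + 3 * w \<in> A))"
      unfolding g_def h_def
      by (simp only: card_filter_eq_sum[OF finite_bohr] sum_product of_bool_conj)
    also have "\<dots> = (\<Sum>v\<in>?V. \<Sum>w\<in>?V. \<Sum>u\<in>U. of_bool (u + 3 * v \<in> P \<and> 3 * c - u + 3 * w \<in> A))"
      by (subst sum.swap) (intro sum.cong refl sum.swap)
    also have "\<dots> = (\<Sum>v\<in>?V. \<Sum>w\<in>?V. card {u \<in> U. u + 3 * v \<in> P \<and> 3 * c - u + 3 * w \<in> A})"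
      by (simp only: card_filter_eq_sum[OF finU])
    finally have "(\<Sum>u\<in>U. real (g u) * real (h u))
        = (\<Sum>v\<in>?V. \<Sum>w\<in>?V. real (card {u \<in> U. u + 3 * v \<in> P \<and> 3 * c - u + 3 * w \<in> A}))"
      by (simp flip: of_nat_mult of_nat_sum)
    also have "\<dots> \<le> (\<Sum>v\<in>?V. \<Sum>w\<in>?V. \<alpha>\<^sup>2 / 40 * card U)"
    proof (intro sum_mono)
      fix v w assume vw: "v \<in> ?V" "w \<in> ?V"
      have "v + w \<in> bohr (G \<union> L) R (s + s)"
        using vw unfolding G'_def by (rule bohr_add)
      moreover have "bohr (G \<union> L) R (s + s) \<subseteq> bohr (G \<union> L) R rad"
        using spos G(3) by (intro bohr_mono) auto
      ultimately have "- (v + w) \<in> bohr (G \<union> L) R rad"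
        by (intro bohr_uminus) (rule subsetD)
      from sparse[OF this]
      have "real (card {u \<in> P. 3 * c - u - 3 * - (v + w) \<in> A}) \<le> \<alpha>\<^sup>2 / 40 * card U" .
      moreover have "card {u \<in> U. u + 3 * v \<in> P \<and> 3 * c - u + 3 * w \<in> A} \<le> card {u \<in> P. 3 * c - u - 3 * - (v + w) \<in> A}"
        using finP by (intro card_inj_on_le[of "\<lambda>u. u + 3 * v"]) (auto simp: inj_on_def algebra_simps)
      ultimately show "real (card {u \<in> U. u + 3 * v \<in> P \<and> 3 * c - u + 3 * w \<in> A}) \<le> \<alpha>\<^sup>2 / 40 * card U"
        by linarith
    qed
    also have "\<dots> = (card ?V)\<^sup>2 * (\<alpha>\<^sup>2 / 40 * card U)"
      by (simp add: power2_eq_square)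
    finally show ?thesis .
  qed
  have "M * (2 * (card ?V * real (card P))) - M\<^sup>2 * card U \<le> (\<Sum>u\<in>U. M * (real (g u) + real (h u)) - M\<^sup>2)"
  proof -
    have "real (card ?V * card P) \<le> real (\<Sum>u\<in>U. g u)" "real (card ?V * card P) \<le> real (\<Sum>u\<in>U. h u)"
      by (rule of_nat_mono[OF sumg], rule of_nat_mono[OF sumh])
    then have "2 * (card ?V * real (card P)) \<le> (\<Sum>u\<in>U. real (g u)) + (\<Sum>u\<in>U. real (h u))"
      by simp
    then have "M * (2 * (card ?V * real (card P))) \<le> M * ((\<Sum>u\<in>U. real (g u)) + (\<Sum>u\<in>U. real (h u)))"
      using \<alpha>0 by (intro mult_left_mono) (auto simp: M_def)
    then show ?thesis
      by (simp add: sum_subtractf sum.distrib mult.commute flip: sum_distrib_left sum_distrib_right)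
  qed
  \<comment> \<open>Two functions that are close to their common maximum on average must overlap:
    \<open>(M - g u) * (M - h u) \<ge> 0\<close>.\<close>
  also have "\<dots> \<le> (\<Sum>u\<in>U. real (g u) * real (h u))"
  proof (rule sum_mono)
    fix u
    have "0 \<le> (M - g u) * (M - h u)"
      using gM hM by (intro mult_nonneg_nonneg) auto
    then show "M * (real (g u) + real (h u)) - M\<^sup>2 \<le> real (g u) * real (h u)"
      by (simp add: algebra_simps power2_eq_square)
  qed
  also note upper
  finally have fin: "M * (2 * (card ?V * real (card P))) - M\<^sup>2 * card U \<le> (card ?V)\<^sup>2 * (\<alpha>\<^sup>2 / 40 * card U)" .
  define b where "b = real (card (bohr G R r0))"
  define q where "q = (real (card ?V))\<^sup>2 * \<alpha>\<^sup>2"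
  have b: "b > 0"
    using card_bohr_pos[of r0 R G] r0 G(3) by (simp add: b_def)
  have q: "q > 0"
    unfolding q_def using Vpos \<alpha>0 by (intro mult_pos_pos zero_less_power)
  \<comment> \<open>In units of \<open>q * b\<close> the main term is 1.818, the subtracted square
    is below 1.031, and the upper bound for the overlap is below 0.026.\<close>
  have "101 / 100 * 2 * (9 / 10) * (q * b) \<le> M * (2 * (card ?V * real (card P)))"
  proof -
    have "M * (2 * (card ?V * (9 / 10 * \<alpha> * b))) \<le> M * (2 * (card ?V * real (card P)))"
      using dense(1) \<alpha>0 by (intro mult_left_mono) (auto simp: M_def P_def b_def)
    moreover have "M * (2 * (card ?V * (9 / 10 * \<alpha> * b))) = 101 / 100 * 2 * (9 / 10) * (q * b)"
      by (simp add: M_def q_def power2_eq_square)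
    ultimately show ?thesis
      by (simp only:)
  qed
  moreover have "M\<^sup>2 * card U = 10201 / 10000 * (q * card U)"
    by (simp add: M_def q_def power2_eq_square)
  moreover have "(card ?V)\<^sup>2 * (\<alpha>\<^sup>2 / 40 * card U) = q * card U / 40"
    by (simp add: q_def)
  moreover have "q * card U \<le> 101 / 100 * (q * b)"
    using mult_left_mono[OF cardU, of q] q by (simp add: b_def mult_ac)
  moreover have "q * b > 0"
    using q b by simp
  ultimately show False
    using fin by linarith
qed


section \<open>Parameters of one increment and the choice of a centre\<close>

definition dim_step :: "nat \<Rightarrow> nat" where
  "dim_step m = 2 ^ 21 * m ^ 4"

text \<open>Five factors \<open>1 / (2800 * D)\<close> lead from the old radius through four nested
  regular radii to the width \<delta> at the smallest. The denominator is that of the radius from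
  Chang's theorem, where \<open>2 ^ 20\<close> covers the numerical losses,
  \<open>320 * 1792\<close> in all.\<close>

definition shrink :: "nat \<Rightarrow> nat \<Rightarrow> real" where
  "shrink m D = (1 / (2800 * real D)) ^ 5 / (2 ^ 20 * real (dim_step m) * 4 ^ m * real D)"

lemma cnt_translate: "cnt {y. a + 1 * y \<in> A} x q C = cnt A (a + x) q C"
  by (simp add: cnt_def add.assoc)

lemma card_Int_eq_cnt: "card ({y. x + q * y \<in> A} \<inter> B) = cnt A x q B"
  unfolding cnt_def by (rule arg_cong[of _ _ card]) auto

text \<open>Affine preimages of \<open>A\<close> are solution free, so the negated conclusion caps
  the density of \<open>A\<close> on every translate, dilated or not, of every admissible Bohr set.
  Under such a cap few translates are sparse, and one centre is good at three scales at
  once.\<close>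

lemma density_increment:
  fixes \<alpha> R r :: real
  assumes m: "m \<ge> 20" and \<alpha>: "exp (- real m) \<le> \<alpha>" and A: "sol_free A"
    and G: "finite G" "card G + 1 + dim_step m \<le> D" "R > 0"
    and r: "0 < r" "r \<le> 2" "regular D G R r"
    and dense: "\<alpha> * card (bohr G R r) \<le> card (A \<inter> bohr G R r)"
    and large: "25 * exp (2 * real m) \<le> card (bohr G R (shrink m D * r))"
  shows "\<exists>A' G' r'. sol_free A' \<and> finite G' \<and> card G' \<le> card G + dim_step m \<and> shrink m D * r \<le> r' \<and> r' \<le> r
    \<and> regular D G' R r' \<and> 101 / 100 * \<alpha> * card (bohr G' R r') \<le> card (A' \<inter> bohr G' R r')"
proof (rule ccontr)
  assume contra: "\<not> ?thesis"
  have noinc: "real (cnt A x q (bohr G' R s)) \<le> 101 / 100 * \<alpha> * card (bohr G' R s)"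
    if "q \<noteq> 0" "finite G'" "card G' \<le> card G + dim_step m" "shrink m D * r \<le> s" "s \<le> r" "regular D G' R s"
    for x q G' s
  proof -
    have "sol_free {y. x + q * y \<in> A}"
      using A that(1) by (rule sol_free_affine)
    then have "\<not> 101 / 100 * \<alpha> * card (bohr G' R s) \<le> card ({y. x + q * y \<in> A} \<inter> bohr G' R s)"
      using contra that by blast
    then show ?thesis
      unfolding card_Int_eq_cnt by linarith
  qed
  let ?n = "dim_step m"
  have D: "real D \<ge> 1"
    using G(2) by simp
  have \<alpha>0: "\<alpha> > 0"
    using \<alpha> exp_gt_zero[of "- real m"] by linarith
  have n: "real ?n \<ge> 5"
  proof -
    have "(1::real) \<le> real m ^ 4"
      using m by (intro one_le_power) auto
    then show ?thesis
      by (simp add: dim_step_def)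
  qed
  define \<kappa> where "\<kappa> = 1 / (2800 * real D)"
  have \<kappa>: "0 < \<kappa>" "\<kappa> \<le> 1 / 2800"
    using D by (auto simp: \<kappa>_def divide_simps)
  have kd: "t / (2800 * real D) = \<kappa> * t" for t
    by (simp add: \<kappa>_def)
  have kle: "\<kappa> * t \<le> t / 2800" if "t \<ge> 0" for t
    using mult_right_mono[OF \<kappa>(2) that] by simp
  have D1: "card G + 1 \<le> D"
    using G(2) by simp
  \<comment> \<open>Each radius is about \<open>\<kappa>\<close> times the one before, up to the
    factor 2 lost in making it regular; for \<open>r1\<close> another 20 leaves room for the shift
    by \<open>3 * c\<close>.\<close>
  obtain r0 where r0: "\<kappa> * r / 2 \<le> r0" "r0 \<le> 2 * (\<kappa> * r / 2)" "regular D G R r0"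
    using regular_radius[of G R "\<kappa> * r / 2" D] G D1 r \<kappa> by auto
  have r0p: "r0 > 0"
    using r0(1) r(1) \<kappa>(1) by (meson divide_pos_pos less_le_trans mult_pos_pos zero_less_numeral)
  obtain r1 where r1: "\<kappa> * r0 / 40 \<le> r1" "r1 \<le> 2 * (\<kappa> * r0 / 40)" "regular D G R r1"
    using regular_radius[of G R "\<kappa> * r0 / 40" D] G D1 r0p \<kappa> by auto
  have r1p: "r1 > 0"
    using r1(1) r0p \<kappa>(1) by (meson divide_pos_pos less_le_trans mult_pos_pos zero_less_numeral)
  obtain r2 where r2: "\<kappa> * r1 / 2 \<le> r2" "r2 \<le> 2 * (\<kappa> * r1 / 2)" "regular D G R r2"
    using regular_radius[of G R "\<kappa> * r1 / 2" D] G D1 r1p \<kappa> by auto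
  have r2p: "r2 > 0"
    using r2(1) r1p \<kappa>(1) by (meson divide_pos_pos less_le_trans mult_pos_pos zero_less_numeral)
  obtain r3 where r3: "\<kappa> * r2 / 2 \<le> r3" "r3 \<le> 2 * (\<kappa> * r2 / 2)" "regular D G R r3"
    using regular_radius[of G R "\<kappa> * r2 / 2" D] G D1 r2p \<kappa> by auto
  have r3p: "r3 > 0"
    using r3(1) r2p \<kappa>(1) by (meson divide_pos_pos less_le_trans mult_pos_pos zero_less_numeral)
  have order: "r3 \<le> r2" "r2 \<le> r1" "r1 \<le> r0" "r0 \<le> \<kappa> * r" "\<kappa> * r \<le> r" "3 * r2 \<le> \<kappa> * r"
    using r0(2) r1(2) r2(2) r3(2) kle[of r] kle[of r0] kle[of r1] kle[of r2] r(1) r0p r1p r2p by linarith+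
  have low3: "\<kappa> ^ 4 * r / 320 \<le> r3"
  proof -
    have "\<kappa> * (\<kappa> * r / 2) \<le> \<kappa> * r0"
      using r0(1) \<kappa> by (intro mult_left_mono) auto
    then have 1: "\<kappa> * (\<kappa> * r) / 80 \<le> r1"
      using r1(1) by simp
    then have "\<kappa> * (\<kappa> * (\<kappa> * r) / 80) \<le> \<kappa> * r1"
      using \<kappa> by (intro mult_left_mono) auto
    then have 2: "\<kappa> * (\<kappa> * (\<kappa> * r)) / 160 \<le> r2"
      using r2(1) by simp
    then have "\<kappa> * (\<kappa> * (\<kappa> * (\<kappa> * r)) / 160) \<le> \<kappa> * r2"
      using \<kappa> by (intro mult_left_mono) auto
    then have "\<kappa> * (\<kappa> * (\<kappa> * (\<kappa> * r))) / 320 \<le> r3"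
      using r3(1) by simp
    then show ?thesis
      by (simp add: power4_eq_xxxx mult_ac)
  qed
  define K where "K = real ?n * 4 ^ m * real D"
  have K: "K \<ge> real ?n * 4 ^ m" "K > 0" "K \<ge> 1"
  proof -
    have "real ?n * 4 ^ m * 1 \<le> K"
      unfolding K_def using D by (intro mult_left_mono) auto
    then show "K \<ge> real ?n * 4 ^ m"
      by simp
    moreover have "1 * 1 \<le> real ?n * 4 ^ m"
      using n by (intro mult_mono) auto
    ultimately show "K > 0" "K \<ge> 1"
      by linarith+
  qed
  have sh: "shrink m D * r = \<kappa> ^ 5 * r / (2 ^ 20 * K)"
    by (simp add: shrink_def \<kappa>_def K_def mult_ac)
  define rad where "rad = min (r3 / (2800 * real D) / (2 * real (?n + 5)) * (2 / 4 ^ m / 8) / (28 * real D))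
    (2 / 4 ^ m / (2 * real ?n))"
  have low_rad: "shrink m D * r \<le> rad / 4"
  proof -
    have "shrink m D * r \<le> (r3 / (2800 * real D) / (2 * real (?n + 5)) * (2 / 4 ^ m / 8) / (28 * real D)) / 4"
    proof -
      have "\<kappa> * (\<kappa> ^ 4 * r / 320) \<le> \<kappa> * r3"
        using low3 \<kappa> by (intro mult_left_mono) auto
      then have a: "\<kappa> ^ 5 * r / 320 \<le> \<kappa> * r3"
        by (simp add: eval_nat_numeral mult_ac)
      have "shrink m D * r = \<kappa> ^ 5 * r / 320 / (2 ^ 20 / 320 * K)"
        by (simp add: sh)
      also have "\<dots> \<le> \<kappa> * r3 / (2 ^ 20 / 320 * K)"
        using a K(2) by (intro divide_right_mono) auto
      also have "\<dots> \<le> \<kappa> * r3 / (896 * ((real ?n + 5) * 4 ^ m * real D))"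
      proof (rule divide_left_mono)
        have "(real ?n + 5) * (4 ^ m * real D) \<le> (2 * real ?n) * (4 ^ m * real D)"
          using n D by (intro mult_right_mono) auto
        also have "\<dots> = 2 * K"
          by (simp add: K_def)
        finally have "(real ?n + 5) * 4 ^ m * real D \<le> 2 * K"
          by (simp only: mult.assoc)
        then show "896 * ((real ?n + 5) * 4 ^ m * real D) \<le> 2 ^ 20 / 320 * K"
        proof -
          assume "(real ?n + 5) * 4 ^ m * real D \<le> 2 * K"
          moreover have "2 ^ 20 / 320 * K = 16384 / 5 * K"
            by simp
          ultimately show ?thesis
            using K(2) by linarith
        qed
        show "0 \<le> \<kappa> * r3"
          using \<kappa> r3p by simp
        show "0 < 2 ^ 20 / 320 * K * (896 * ((real ?n + 5) * 4 ^ m * real D))"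
          using K(2) n D by (intro mult_pos_pos) auto
      qed
      also have "\<dots> = (r3 / (2800 * real D) / (2 * real (?n + 5)) * (2 / 4 ^ m / 8) / (28 * real D)) / 4"
        unfolding kd by simp
      finally show ?thesis .
    qed
    moreover have "shrink m D * r \<le> (2 / 4 ^ m / (2 * real ?n)) / 4"
    proof -
      have "\<kappa> ^ 5 \<le> 1"
        using \<kappa> by (intro power_le_one) auto
      then have "\<kappa> ^ 5 * r \<le> 1 * 2"
        using r(1,2) \<kappa> by (intro mult_mono) auto
      then have "shrink m D * r \<le> 2 / (2 ^ 20 * K)"
        unfolding sh using K(2) by (intro divide_right_mono) auto
      also have "\<dots> \<le> 2 / (8 * (real ?n * 4 ^ m))"
        using K n by (intro divide_left_mono) auto
      also have "\<dots> = (2 / 4 ^ m / (2 * real ?n)) / 4"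
        by (simp add: mult_ac)
      finally show ?thesis .
    qed
    ultimately show ?thesis
      unfolding rad_def by linarith
  qed
  have rad_up: "rad \<le> r3"
  proof -
    have "(1::real) \<le> 4 ^ m"
      by (rule one_le_power) simp
    then have "(1::real) \<le> 4 * 4 ^ m"
      by linarith
    then have "2 / 4 ^ m / 8 \<le> (1::real)"
      by (simp add: divide_le_eq)
    then have "r3 / (2800 * real D) / (2 * real (?n + 5)) * (2 / 4 ^ m / 8) / (28 * real D) \<le> r3 / (2800 * real D)"
      using r3p D by (intro scale_le) auto
    also have "\<dots> \<le> r3"
      unfolding kd using kle[of r3] r3p by linarith
    finally show ?thesis
      unfolding rad_def by linarith
  qed
  have rad0: "0 < rad"
    unfolding rad_def using r3p D n by simp
  have sle: "shrink m D * r \<le> r3"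
    using low_rad rad_up rad0 by linarith
  let ?B = "bohr G R (r + \<kappa> * r)"
  let ?low = "\<lambda>\<beta> q C. {x \<in> ?B. real (cnt A x q C) < \<beta> * \<alpha> * card C}"
  have grow: "real (card ?B) \<le> 101 / 100 * card (bohr G R r)"
    using regularD[OF r(3) G(3), of "\<kappa> * r"] by (simp add: kd)
  have sparse: "(101 / 100 - \<beta>) * card (?low \<beta> q (bohr G R s)) \<le> 1 / 50 * card ?B"
    if "q = 1 \<or> q = 3 \<and> s = r2" "regular D G R s" "r3 \<le> s" "s \<le> r0" "\<beta> < 101 / 100" "0 \<le> \<beta>" for \<beta> q s
  proof (rule few_sparse_translates[OF G(3) finite_bohr _ _ \<alpha>0 that(5,6) grow dense])
    show "bohr G R s \<noteq> {}"
      using card_bohr_pos[of s R G] that(3) r3p G(3) by (auto simp: card_gt_0_iff)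
    show "q * c \<in> bohr G R (\<kappa> * r)" if c: "c \<in> bohr G R s" for c
      using \<open>q = 1 \<or> q = 3 \<and> s = r2\<close>
    proof
      assume "q = 1"
      then show ?thesis
        using c bohr_mono[of s "\<kappa> * r" R G G] \<open>s \<le> r0\<close> order(4) G(3) by auto
    next
      assume "q = 3 \<and> s = r2"
      then show ?thesis
        using bohr_triple[OF c] bohr_mono[of "3 * r2" "\<kappa> * r" R G G] order(6) G(3) by auto
    qed
    show "real (cnt A x q (bohr G R s)) \<le> 101 / 100 * \<alpha> * card (bohr G R s)" for x
      using that order sle by (intro noinc G(1)) auto
  qed
  let ?L1 = "?low (9 / 10) 1 (bohr G R r0)" and ?L2 = "?low (1 / 2) 1 (bohr G R r1)" and ?L3 = "?low (1 / 2) 3 (bohr G R r2)"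
  \<comment> \<open>The proportions of bad centres are at most 2 / 11, 2 / 51 and 2 / 51, together
    less than 1.\<close>
  have "(11 / 100) * real (card ?L1) \<le> 1 / 50 * card ?B"
    using sparse[of 1 r0 "9 / 10"] r0(3) order by simp
  moreover have "(51 / 100) * real (card ?L2) \<le> 1 / 50 * card ?B"
    using sparse[of 1 r1 "1 / 2"] r1(3) order by simp
  moreover have "(51 / 100) * real (card ?L3) \<le> 1 / 50 * card ?B"
    using sparse[of 3 r2 "1 / 2"] r2(3) order by simp
  moreover have "real (card ?B) > 0"
    using card_bohr_pos[of "r + \<kappa> * r" R G] r(1) \<kappa>(1) G(3) by simp
  ultimately have "real (card ?L1) + real (card ?L2) + real (card ?L3) < real (card ?B)"
    by linarith
  moreover have "card (?L1 \<union> ?L2 \<union> ?L3) \<le> card ?L1 + card ?L2 + card ?L3"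
    by (rule order_trans[OF card_Un_le add_right_mono[OF card_Un_le]])
  ultimately have "card (?L1 \<union> ?L2 \<union> ?L3) < card ?B"
    by linarith
  then have "\<not> ?B \<subseteq> ?L1 \<union> ?L2 \<union> ?L3"
    using card_mono[of "?L1 \<union> ?L2 \<union> ?L3" ?B] by auto
  then obtain a where a: "a \<in> ?B" "a \<notin> ?L1" "a \<notin> ?L2" "a \<notin> ?L3"
    by blast
  then have dense': "9 / 10 * \<alpha> * card (bohr G R r0) \<le> cnt A a 1 (bohr G R r0)"
    "1 / 2 * \<alpha> * card (bohr G R r1) \<le> cnt A a 1 (bohr G R r1)"
    "1 / 2 * \<alpha> * card (bohr G R r2) \<le> cnt A a 3 (bohr G R r2)"
    by (simp_all add: not_less)
  let ?A = "{y. a + 1 * y \<in> A}"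
  show False
  proof (rule centred_contradiction[of m \<alpha> ?A G D R r3 r2 r1 r0])
    show "sol_free ?A"
      using A by (rule sol_free_affine) simp
    show "card G + 1 + 2 ^ 21 * m ^ 4 \<le> D"
      using G(2) by (simp add: dim_step_def)
    show "9 / 10 * \<alpha> * card (bohr G R r0) \<le> card (?A \<inter> bohr G R r0)"
      unfolding card_Int_eq_cnt by (rule dense'(1))
    show "1 / 2 * \<alpha> * card (bohr G R r1) \<le> cnt ?A 0 1 (bohr G R r1)"
      unfolding cnt_translate using dense'(2) by simp
    show "1 / 2 * \<alpha> * card (bohr G R r2) \<le> cnt ?A 0 3 (bohr G R r2)"
      unfolding cnt_translate using dense'(3) by simp
    show "25 * exp (2 * real m) \<le> card (bohr G R r2)"
    proof -
      have "bohr G R (shrink m D * r) \<subseteq> bohr G R r2"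
        using sle order(1) G(3) by (intro bohr_mono) auto
      then have "card (bohr G R (shrink m D * r)) \<le> card (bohr G R r2)"
        by (intro card_mono) auto
      then show ?thesis
        using large by linarith
    qed
    show "real (cnt ?A x 3 (bohr G' R s)) \<le> 101 / 100 * \<alpha> * card (bohr G' R s)"
      if "finite G'" "G \<subseteq> G'" "card G' \<le> card G + 2 ^ 21 * m ^ 4"
        "min (r3 / (2800 * real D) / (2 * real (2 ^ 21 * m ^ 4 + 5)) * (2 / 4 ^ m / 8) / (28 * real D))
          (2 / 4 ^ m / (2 * real (2 ^ 21 * m ^ 4))) / 4 \<le> s"
        "s \<le> min (r3 / (2800 * real D) / (2 * real (2 ^ 21 * m ^ 4 + 5)) * (2 / 4 ^ m / 8) / (28 * real D))
          (2 / 4 ^ m / (2 * real (2 ^ 21 * m ^ 4))) / 2"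
        "regular D G' R s" for G' s x
    proof -
      have "rad / 4 \<le> s" "s \<le> rad / 2"
        using that(4,5) by (simp_all only: rad_def dim_step_def)
      then show ?thesis
        unfolding cnt_translate using that(1,3,6) low_rad rad_up rad0 order
        by (intro noinc) (auto simp: dim_step_def)
    qed
    show "r1 \<le> r0 / (2800 * real D) / 20" "r2 \<le> r1 / (2800 * real D)" "r3 \<le> r2 / (2800 * real D)"
      using r1(2) r2(2) r3(2) unfolding kd by simp_all
  qed (use m \<alpha> G r3p r0 r1 r2 r3 in auto)
qed


section \<open>Iteration\<close>

lemma shrink_pos: "m > 0 \<Longrightarrow> D > 0 \<Longrightarrow> 0 < shrink m D"
  by (simp add: shrink_def dim_step_def)

lemma shrink_le_1:
  assumes "m > 0" "D > 0"
  shows "shrink m D \<le> 1"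
proof -
  have "(1 / (2800 * real D)) ^ 5 \<le> 1"
    using assms by (intro power_le_one) auto
  moreover have "1 \<le> 2 ^ 20 * real (dim_step m) * 4 ^ m * real D"
  proof -
    have "0 < dim_step m"
      using assms by (simp add: dim_step_def)
    then have "(1::real) \<le> real (dim_step m)"
      by linarith
    moreover have "(1::real) \<le> 4 ^ m"
      by (rule one_le_power) simp
    ultimately have "(1 * 1) * 1 * 1 \<le> 2 ^ 20 * real (dim_step m) * 4 ^ m * real D"
      using assms by (intro mult_mono) auto
    then show ?thesis
      by simp
  qed
  ultimately show ?thesis
    unfolding shrink_def by (subst divide_le_eq_1) linarith
qed

text \<open>\<open>D\<close> bounds the rank of every step in advance, so regularity and the radius
  factor keep one meaning while frequencies are added. The start is the Bohr set without
  frequencies, an interval. \<open>A\<close> is quantified anew, as each increment may pass to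
  another solution-free set.\<close>

lemma density_increment_iterate:
  fixes \<alpha> R r :: real
  assumes m: "m \<ge> 20" and \<alpha>: "exp (- real m) \<le> \<alpha>"
    and D: "D = 1 + dim_step m * (I + 1)" and R: "R > 0"
    and start: "sol_free A" "1 \<le> r" "r \<le> 2" "regular D {} R r" "\<alpha> * card (bohr {} R r) \<le> card (A \<inter> bohr {} R r)"
    and large: "\<And>G. finite G \<Longrightarrow> card G + 1 \<le> D \<Longrightarrow> 25 * exp (2 * real m) \<le> card (bohr G R (shrink m D ^ (I + 1)))"
    and i: "i \<le> I"
  shows "\<exists>A G r. sol_free A \<and> finite G \<and> card G \<le> dim_step m * i \<and> shrink m D ^ i \<le> r \<and> r \<le> 2
    \<and> regular D G R r \<and> (101 / 100) ^ i * \<alpha> * card (bohr G R r) \<le> card (A \<inter> bohr G R r)"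
  using i
proof (induction i)
  case 0
  then show ?case
    using start by (intro exI[of _ A] exI[of _ "{}"] exI[of _ r]) simp
next
  case (Suc i)
  let ?s = "shrink m D"
  have pos: "0 < ?s" "?s \<le> 1"
    using shrink_pos[of m D] shrink_le_1[of m D] m D by auto
  obtain A G r where IH: "sol_free A" "finite G" "card G \<le> dim_step m * i" "?s ^ i \<le> r" "r \<le> 2"
    "regular D G R r" "(101 / 100) ^ i * \<alpha> * card (bohr G R r) \<le> card (A \<inter> bohr G R r)"
    using Suc by auto
  have dim: "card G + 1 + dim_step m \<le> D"
  proof -
    have "dim_step m * i + dim_step m = dim_step m * (i + 1)"
      by simp
    also have "\<dots> \<le> dim_step m * (I + 1)"
      using Suc.prems by (intro mult_le_mono2) simp
    finally have "dim_step m * i + dim_step m \<le> dim_step m * (I + 1)" .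
    then show ?thesis
      using IH(3) unfolding D by linarith
  qed
  have rpos: "0 < r"
    using IH(4) pos(1) by (meson less_le_trans zero_less_power)
  have "\<exists>A' G' r'. sol_free A' \<and> finite G' \<and> card G' \<le> card G + dim_step m \<and> ?s * r \<le> r' \<and> r' \<le> r
    \<and> regular D G' R r' \<and> 101 / 100 * ((101 / 100) ^ i * \<alpha>) * card (bohr G' R r') \<le> card (A' \<inter> bohr G' R r')"
  proof (rule density_increment[OF m _ IH(1,2) dim R rpos IH(5,6,7)])
    have "\<alpha> > 0"
      using \<alpha> exp_gt_zero[of "- real m"] by linarith
    moreover have "(1::real) \<le> (101 / 100) ^ i"
      by (rule one_le_power) simp
    ultimately have "1 * \<alpha> \<le> (101 / 100) ^ i * \<alpha>"
      by (intro mult_right_mono) auto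
    then show "exp (- real m) \<le> (101 / 100) ^ i * \<alpha>"
      using \<alpha> by simp
    have "?s ^ (I + 1) \<le> ?s ^ (i + 1)"
      using Suc.prems pos by (intro power_decreasing) auto
    also have "\<dots> \<le> ?s * r"
      using IH(4) pos by (simp add: mult_left_mono)
    finally have "bohr G R (?s ^ (I + 1)) \<subseteq> bohr G R (?s * r)"
      using R by (intro bohr_mono) auto
    then have "card (bohr G R (?s ^ (I + 1))) \<le> card (bohr G R (?s * r))"
      by (intro card_mono) auto
    then show "25 * exp (2 * real m) \<le> card (bohr G R (?s * r))"
      using large[OF IH(2)] dim by linarith
  qed
  then obtain A' G' r' where *: "sol_free A'" "finite G'" "card G' \<le> card G + dim_step m" "?s * r \<le> r'" "r' \<le> r"
    "regular D G' R r'" "101 / 100 * ((101 / 100) ^ i * \<alpha>) * card (bohr G' R r') \<le> card (A' \<inter> bohr G' R r')"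
    by blast
  have "card G' \<le> dim_step m * Suc i"
    using *(3) IH(3) by simp
  moreover have "?s ^ Suc i \<le> r'"
    using order_trans[OF mult_left_mono[OF IH(4)] *(4)] pos by simp
  moreover have "(101 / 100) ^ Suc i * \<alpha> * card (bohr G' R r') \<le> card (A' \<inter> bohr G' R r')"
    using *(7) by (simp only: power_Suc mult.assoc)
  ultimately show ?case
    using * IH(5) by (intro exI[of _ A'] exI[of _ G'] exI[of _ r']) simp
qed

text \<open>\<open>D\<close> is at most \<open>2 ^ (7 * m)\<close> and \<open>dim_step m\<close> at
  most \<open>2 ^ (6 * m)\<close>, so the denominator is at most \<open>2 ^ (60 + 51 * m)\<close>;
  \<open>m \<ge> 20\<close> is just enough for \<open>60 \<le> 3 * m\<close>.\<close>

lemma shrink_lower: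
  assumes m: "m \<ge> 20" and D: "D = 1 + dim_step m * (200 * m + 1)"
  shows "(1 / 2) ^ (54 * m) \<le> shrink m D" "real D \<le> 2 ^ 30 * real m ^ 5"
proof -
  have mpow: "real m \<le> 2 ^ m"
    using of_nat_less_two_power[of m, where 'a = real] by simp
  have m1: "1 \<le> real m"
    using m by simp
  have n: "real (dim_step m) = 2 ^ 21 * real m ^ 4"
    by (simp add: dim_step_def)
  have m4: "1 \<le> real m ^ 4" "1 \<le> real m ^ 5"
    using m1 by (simp_all add: one_le_power)
  show DD: "real D \<le> 2 ^ 30 * real m ^ 5"
  proof -
    have "real D = 1 + (2 ^ 21 * real m ^ 4) * (200 * real m + 1)"
      by (simp only: D of_nat_add of_nat_mult n of_nat_1 of_nat_numeral)
    also have "\<dots> \<le> real m ^ 5 + (2 ^ 21 * real m ^ 4) * (201 * real m)"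
      using m1 m4 by (intro add_mono mult_left_mono) auto
    also have "\<dots> = (1 + 2 ^ 21 * 201) * real m ^ 5"
      by (simp add: eval_nat_numeral algebra_simps)
    also have "\<dots> \<le> 2 ^ 30 * real m ^ 5"
      by (intro mult_right_mono) auto
    finally show ?thesis .
  qed
  have pw: "(2::real) ^ a \<le> 2 ^ b" if "a \<le> b" for a b
    using that by (intro power_increasing) auto
  have D7: "real D \<le> 2 ^ (7 * m)"
  proof -
    have "real m ^ 5 \<le> (2 ^ m) ^ 5"
      using mpow by (intro power_mono) auto
    then have "real D \<le> 2 ^ 30 * (2 ^ m) ^ 5"
      by (intro order_trans[OF DD] mult_left_mono) auto
    also have "\<dots> = 2 ^ (30 + m * 5)"
      by (simp only: power_mult[symmetric] power_add[symmetric])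
    also have "\<dots> \<le> 2 ^ (7 * m)"
      using m by (intro pw) auto
    finally show ?thesis .
  qed
  have n6: "real (dim_step m) \<le> 2 ^ (6 * m)"
  proof -
    have "real m ^ 4 \<le> (2 ^ m) ^ 4"
      using mpow by (intro power_mono) auto
    then have "real (dim_step m) \<le> 2 ^ 21 * (2 ^ m) ^ 4"
      unfolding n by (intro mult_left_mono) auto
    also have "\<dots> = 2 ^ (21 + m * 4)"
      by (simp only: power_mult[symmetric] power_add[symmetric])
    also have "\<dots> \<le> 2 ^ (6 * m)"
      using m by (intro pw) auto
    finally show ?thesis .
  qed
  have "D > 0"
    by (simp add: D)
  then have Dpos: "real D > 0"
    by simp
  have "(2800 * real D) ^ 5 * (2 ^ 20 * real (dim_step m) * 4 ^ m * real D)
      \<le> (2 ^ 12 * 2 ^ (7 * m)) ^ 5 * (2 ^ m * 2 ^ (6 * m) * 2 ^ (2 * m) * 2 ^ (7 * m))"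
  proof (intro mult_mono power_mono)
    show "(2::real) ^ 20 \<le> 2 ^ m"
      using m by (rule pw)
    show "(4::real) ^ m \<le> 2 ^ (2 * m)"
      by (simp add: power_mult)
  qed (use D7 n6 in auto)
  also have "\<dots> = 2 ^ (60 + 51 * m)"
    unfolding power_mult_distrib power_mult[symmetric] power_add[symmetric]
    by (rule arg_cong[of _ _ "\<lambda>k. 2 ^ k"]) simp
  also have "\<dots> \<le> 2 ^ (54 * m)"
    using m by (intro pw) auto
  finally have "(2800 * real D) ^ 5 * (2 ^ 20 * real (dim_step m) * 4 ^ m * real D) \<le> 2 ^ (54 * m)" .
  moreover have "0 < (2800 * real D) ^ 5 * (2 ^ 20 * real (dim_step m) * 4 ^ m * real D)"
    using Dpos m by (simp add: dim_step_def)
  ultimately have "1 / 2 ^ (54 * m) \<le> 1 / ((2800 * real D) ^ 5 * (2 ^ 20 * real (dim_step m) * 4 ^ m * real D))"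
    by (intro divide_left_mono) auto
  then show "(1 / 2) ^ (54 * m) \<le> shrink m D"
    by (simp add: shrink_def power_divide)
qed

text \<open>\<open>I = 200 * m\<close> increments would multiply the density
  \<open>exp (- m)\<close> by at least \<open>4 ^ m\<close> and push it above 1. They are possible
  as long as the Bohr sets stay large: \<open>54 * m * (I + 1)\<close>, that is O (m^2), halvings of
  the radius at rank O (m^5) cost a factor exp (O (m^7)), which a larger \<open>N\<close> could
  afford.\<close>

lemma log_card_bound:
  fixes N m :: nat
  assumes m: "m \<ge> 20" and N: "N \<ge> 1" and A: "sol_free A" "A \<subseteq> {1..int N}"
    and dense: "exp (- real m) * (5 * N) \<le> card A"
  shows "ln (real N) < 2 ^ 50 * real m ^ 7"
proof (rule ccontr)
  assume "\<not> ?thesis"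
  then have big: "2 ^ 50 * real m ^ 7 \<le> ln (real N)"
    by simp
  define I where "I = 200 * m"
  define D where "D = 1 + dim_step m * (I + 1)"
  define \<alpha> where "\<alpha> = exp (- real m)"
  have Nr: "real N \<ge> 1"
    using N by simp
  have m1: "1 \<le> real m"
    using m by simp
  have sh: "(1 / 2) ^ (54 * m) \<le> shrink m D" "real D \<le> 2 ^ 30 * real m ^ 5"
    using shrink_lower[OF m, of D] by (simp_all add: D_def I_def)
  have large: "25 * exp (2 * real m) \<le> card (bohr G N (shrink m D ^ (I + 1)))"
    if G: "finite G" "card G + 1 \<le> D" for G
  proof -
    let ?j = "54 * m * (I + 1)"
    have "((1 / 2) ^ (54 * m)) ^ (I + 1) \<le> shrink m D ^ (I + 1)"
      using sh(1) by (intro power_mono) auto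
    then have "bohr G N ((1 / 2) ^ ?j) \<subseteq> bohr G N (shrink m D ^ (I + 1))"
      using Nr by (intro bohr_mono) (auto simp only: power_mult)
    then have le: "card (bohr G N ((1 / 2) ^ ?j)) \<le> card (bohr G N (shrink m D ^ (I + 1)))"
      by (intro card_mono) auto
    have "real N \<le> 100 ^ (D * (?j + 1)) * real (card (bohr G N ((1 / 2) ^ ?j)))"
      by (rule card_bohr_lower[OF G(1) Nr G(2)])
    moreover have "25 * exp (2 * real m) * 100 ^ (D * (?j + 1)) \<le> real N"
    proof -
      have e1: "(2::real) \<le> exp 1"
        using exp_ge_add_one_self[of "1::real"] by simp
      have e5: "(100::real) \<le> exp 7"
      proof -
        have "(2::real) ^ 7 \<le> exp 1 ^ 7"
          using e1 by (rule power_mono) simp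
        then show ?thesis
          by (simp flip: exp_of_nat_mult)
      qed
      have "(100::real) ^ (D * (?j + 1)) \<le> exp 7 ^ (D * (?j + 1))"
        using e5 by (rule power_mono) simp
      also have "\<dots> = exp (real D * (real ?j + 1) * 7)"
        by (simp add: exp_of_nat_mult[symmetric] algebra_simps)
      finally have "25 * exp (2 * real m) * 100 ^ (D * (?j + 1))
          \<le> exp 7 * exp (2 * real m) * exp (real D * (real ?j + 1) * 7)"
        using e5 by (intro mult_mono) auto
      also have "\<dots> = exp (7 + 2 * real m + real D * (real ?j + 1) * 7)"
        by (simp add: exp_add)
      also have "\<dots> \<le> exp (ln (real N))"
      proof -
        have m7: "real m \<le> real m ^ 7" "1 \<le> real m ^ 7"
          using m1 power_increasing[of 1 7 "real m"] by (simp_all add: one_le_power)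
        have "real ?j + 1 = 10800 * real m ^ 2 + 54 * real m + 1"
          by (simp add: I_def power2_eq_square algebra_simps)
        also have "\<dots> \<le> 10800 * real m ^ 2 + 54 * real m ^ 2 + real m ^ 2"
        proof -
          have "real m \<le> real m ^ 2" "1 \<le> real m ^ 2"
            using m1 power_increasing[of 1 2 "real m"] by (simp_all add: one_le_power)
          then show ?thesis
            by linarith
        qed
        also have "\<dots> \<le> 2 ^ 14 * real m ^ 2"
          by simp
        finally have "real ?j + 1 \<le> 2 ^ 14 * real m ^ 2" .
        then have "real D * (real ?j + 1) \<le> (2 ^ 30 * real m ^ 5) * (2 ^ 14 * real m ^ 2)"
          using sh(2) by (intro mult_mono) auto
        also have "\<dots> = 2 ^ 44 * real m ^ 7"
          by (simp add: eval_nat_numeral)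
        finally have "real D * (real ?j + 1) * 7 \<le> 2 ^ 44 * 7 * real m ^ 7"
          by simp
        moreover have "7 + 2 * real m \<le> 9 * real m ^ 7"
          using m7 by linarith
        moreover have "9 * real m ^ 7 + 2 ^ 44 * 7 * real m ^ 7 \<le> 2 ^ 50 * real m ^ 7"
          by simp
        ultimately have "7 + 2 * real m + real D * (real ?j + 1) * 7 \<le> ln (real N)"
          using big by linarith
        then show ?thesis
          by simp
      qed
      also have "\<dots> = real N"
        using Nr by simp
      finally show ?thesis .
    qed
    ultimately have "100 ^ (D * (?j + 1)) * (25 * exp (2 * real m))
        \<le> 100 ^ (D * (?j + 1)) * real (card (bohr G N ((1 / 2) ^ ?j)))"
      by (simp only: mult_ac)
    then have "25 * exp (2 * real m) \<le> real (card (bohr G N ((1 / 2) ^ ?j)))"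
      by (rule mult_left_le_imp_le) simp
    then show ?thesis
      using le by linarith
  qed
  obtain r where r: "1 \<le> r" "r \<le> 2" "regular D {} N r"
    using regular_radius[of "{}" "real N" 1 D] Nr by (auto simp: D_def)
  have sub: "A \<subseteq> bohr {} N r"
  proof
    fix x assume "x \<in> A"
    then have "1 \<le> x" "x \<le> int N"
      using A(2) by auto
    then have "\<bar>real_of_int x\<bar> \<le> 1 * real N"
      by simp
    also have "\<dots> \<le> r * real N"
      using r(1) by (intro mult_right_mono) auto
    finally show "x \<in> bohr {} N r"
      by (simp add: bohr_def)
  qed
  \<comment> \<open>As \<open>r \<le> 2\<close>, the set lies in \<open>[- 2 * N, 2 * N]\<close>,
    which has \<open>4 * N + 1\<close> elements; this is the 5 in the density hypothesis.\<close>
  have "card (bohr {} N r) \<le> 5 * real N"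
  proof -
    have "bohr {} N r \<subseteq> {- (2 * int N)..2 * int N}"
    proof
      fix x assume "x \<in> bohr {} N r"
      then have "\<bar>real_of_int x\<bar> \<le> r * real N"
        by (simp add: bohr_def)
      also have "\<dots> \<le> 2 * real N"
        using r(2) by (intro mult_right_mono) auto
      finally have "\<bar>x\<bar> \<le> 2 * int N"
        by linarith
      then show "x \<in> {- (2 * int N)..2 * int N}"
        by auto
    qed
    then have "card (bohr {} N r) \<le> card {- (2 * int N)..2 * int N}"
      by (intro card_mono) auto
    then show ?thesis
      using N by simp
  qed
  then have "\<alpha> * card (bohr {} N r) \<le> exp (- real m) * (5 * N)"
    unfolding \<alpha>_def by (intro mult_left_mono) auto
  also have "\<dots> \<le> card (A \<inter> bohr {} N r)"
    using dense sub by (simp add: Int_absorb2)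
  finally have start: "\<alpha> * card (bohr {} N r) \<le> card (A \<inter> bohr {} N r)" .
  obtain A' G' r' where *: "finite G'" "shrink m D ^ I \<le> r'"
    "(101 / 100) ^ I * \<alpha> * card (bohr G' N r') \<le> card (A' \<inter> bohr G' N r')"
    using density_increment_iterate[OF m _ D_def _ A(1) r start large order_refl] Nr
    unfolding \<alpha>_def by auto
  have spos: "0 < shrink m D ^ I"
    using m by (intro zero_less_power shrink_pos) (auto simp: D_def)
  then have "0 < r'"
    using *(2) spos by linarith
  then have pos: "real (card (bohr G' N r')) > 0"
    using card_bohr_pos[of r' N G'] Nr by simp
  have "card (A' \<inter> bohr G' N r') \<le> card (bohr G' N r')"
    by (intro card_mono) auto
  then have "(101 / 100) ^ I * \<alpha> * card (bohr G' N r') \<le> 1 * real (card (bohr G' N r'))"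
    using *(3) by linarith
  then have "(101 / 100) ^ I * \<alpha> \<le> 1"
    using pos by (rule mult_right_le_imp_le)
  moreover have "(101 / 100) ^ I \<ge> (4::real) ^ m"
  proof -
    have "(1 + 1 / 100 :: real) ^ 100 \<ge> 1 + real 100 * (1 / 100)"
      by (rule Bernoulli_inequality) simp
    then have "(101 / 100 :: real) ^ 100 \<ge> 2"
      by simp
    then have "((101 / 100 :: real) ^ 100) ^ (2 * m) \<ge> 2 ^ (2 * m)"
      by (rule power_mono) simp
    moreover have "((101 / 100 :: real) ^ 100) ^ (2 * m) = (101 / 100) ^ I"
      unfolding power_mult[symmetric] I_def by (rule arg_cong[of _ _ "\<lambda>k. (101 / 100) ^ k"]) simp
    moreover have "(2::real) ^ (2 * m) = 4 ^ m"
      by (simp add: power_mult)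
    ultimately show ?thesis
      by linarith
  qed
  moreover have "\<alpha> > 0"
    by (simp add: \<alpha>_def)
  ultimately have "4 ^ m * \<alpha> \<le> 1"
    by (meson mult_right_mono order_trans less_imp_le)
  moreover have "exp (real m) < 4 ^ m"
  proof -
    have "exp (1::real) < 4"
      using e_less_272 by simp
    then have "exp (1::real) ^ m < 4 ^ m"
      using m by (intro power_strict_mono) auto
    then show ?thesis
      by (simp flip: exp_of_nat_mult)
  qed
  then have "exp (real m) * \<alpha> < 4 ^ m * \<alpha>"
    using \<open>\<alpha> > 0\<close> by (intro mult_strict_right_mono)
  moreover have "exp (real m) * \<alpha> = 1"
    by (simp add: \<alpha>_def flip: exp_add)
  ultimately show False
    by linarith
qed

lemma sol_free_int_image:
  assumes "\<not> (\<exists>s. is_solution A s \<and> \<not> trivial s)"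
  shows "sol_free (int ` A)"
  unfolding sol_free_def
proof (intro ballI impI)
  fix x y z w assume *: "x \<in> int ` A" "y \<in> int ` A" "z \<in> int ` A" "w \<in> int ` A" "x + y + z = 3 * w"
  then obtain a b c d where abcd: "x = int a" "y = int b" "z = int c" "w = int d" "a \<in> A" "b \<in> A" "c \<in> A" "d \<in> A"
    by blast
  then have "a + b + c = 3 * d"
    using *(5) by linarith
  then have "is_solution A (a, b, c, d)"
    using abcd by (simp add: is_solution_def)
  then have "trivial (a, b, c, d)"
    using assms by blast
  then show "x = y \<and> y = z \<and> z = w"
    using abcd by (simp add: trivial_def)
qed

theorem theorem1p4:
  shows "\<exists>c::real. c > 0 \<and>
    (\<forall>(N::nat) (A::nat set). N \<ge> 2 \<longrightarrow> A \<subset> {1..N} \<longrightarrow>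
       \<not> (\<exists>s. is_solution A s \<and> \<not> trivial s) \<longrightarrow>
       real (card A) \<le> real N / exp (c * (ln (real N)) powr (1 / 7)))"
proof -
  \<comment> \<open>\<open>2 ^ 8\<close> comes from \<open>2 ^ 50 \<le> (2 ^ 8) ^ 7\<close> and 24
    from \<open>t + 23 \<le> 24 * t\<close> for \<open>t \<ge> 1\<close>. For \<open>t < 1\<close>
    one has \<open>ln N \<le> K\<close> instead, and the factor \<open>exp (- K)\<close> in
    \<open>c\<close> brings the left-hand side down to \<open>1 / N\<close>.\<close>
  define K where "K = (2 ^ 8 * 24 :: real) ^ 7"
  define c where "c = exp (- K) / (2 ^ 8 * 24)"
  have K: "K > 0" and c: "c > 0"
    by (simp_all add: K_def c_def)
  have "real (card A) \<le> real N / exp (c * (ln (real N)) powr (1 / 7))"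
    if N: "N \<ge> 2" and A: "A \<subset> {1..N}" and free: "\<not> (\<exists>s. is_solution A s \<and> \<not> trivial s)" for N A
  proof (cases "A = {}")
    case False
    have fin: "finite A"
      using A finite_subset by blast
    have cardA: "1 \<le> card A" "card A < N"
      using False fin psubset_card_mono[OF _ A] by (auto simp: Suc_le_eq card_gt_0_iff)
    define t where "t = ln (real N / card A)"
    have ratio: "real N / card A = exp t" "real N / card A > 1"
      using cardA by (simp_all add: t_def)
    have t0: "t > 0"
      unfolding t_def using ratio(2) by (rule ln_gt_zero)
    have cA: "real (card A) = real N * exp (- t)"
      using ratio(1) cardA by (simp add: exp_minus field_simps)
    \<comment> \<open>The surplus 22 secures \<open>m \<ge> 20\<close> and absorbs the factor 5 of
      the density hypothesis.\<close>
    define m where "m = nat \<lceil>t\<rceil> + 22"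
    have m: "m \<ge> 20" "t + 22 \<le> real m" "real m \<le> t + 23"
      using t0 unfolding m_def by linarith+
    have "ln (real N) < 2 ^ 50 * real m ^ 7"
    proof (rule log_card_bound[OF m(1)])
      show "sol_free (int ` A)"
        using free by (rule sol_free_int_image)
      show "int ` A \<subseteq> {1..int N}"
        using A by auto
      have "(5::real) \<le> exp 22"
        using exp_ge_add_one_self[of "22::real"] by simp
      then have "exp (- real m) * 5 \<le> exp (- real m) * exp 22"
        by (rule mult_left_mono) simp
      also have "\<dots> = exp (22 - real m)"
        by (simp flip: exp_add)
      also have "\<dots> \<le> exp (- t)"
        using m(2) by simp
      finally have "real N * (exp (- real m) * 5) \<le> real N * exp (- t)"
        by (rule mult_left_mono) simp
      also have "\<dots> = card A"
        by (simp only: cA)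
      finally show "exp (- real m) * (5 * N) \<le> card (int ` A)"
        by (simp add: card_image mult_ac)
    qed (use N in simp)
    also have "\<dots> \<le> (2 ^ 8 * real m) ^ 7"
      by (simp add: power_mult_distrib)
    also have "\<dots> \<le> (2 ^ 8 * (t + 23)) ^ 7"
      using m(3) by (intro power_mono mult_left_mono) auto
    finally have lnN: "ln (real N) \<le> (2 ^ 8 * (t + 23)) ^ 7"
      by simp
    have lnN0: "0 \<le> ln (real N)"
      using N by simp
    have root: "ln (real N) powr (1 / 7) \<le> b" if "ln (real N) \<le> b ^ 7" "b > 0" for b
    proof -
      have "ln (real N) powr (1 / 7) \<le> (b ^ 7) powr (1 / 7)"
        using that lnN0 by (intro powr_mono2) auto
      also have "b ^ 7 = b powr real 7"
        by (rule powr_realpow[OF that(2), symmetric])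
      also have "(b powr real 7) powr (1 / 7) = b"
        using that(2) unfolding powr_powr by simp
      finally show ?thesis .
    qed
    have "c * ln (real N) powr (1 / 7) \<le> t"
    proof (cases "t \<ge> 1")
      case True
      have "ln (real N) powr (1 / 7) \<le> 2 ^ 8 * (t + 23)"
        using lnN t0 by (intro root) auto
      also have "\<dots> \<le> 2 ^ 8 * 24 * t"
        using True by simp
      finally have "c * ln (real N) powr (1 / 7) \<le> c * (2 ^ 8 * 24 * t)"
        using c by (intro mult_left_mono) auto
      also have "\<dots> = exp (- K) * t"
        by (simp add: c_def)
      also have "\<dots> \<le> 1 * t"
        using K t0 by (intro mult_right_mono) auto
      finally show ?thesis
        by simp
    next
      case False
      have "(2 ^ 8 * (t + 23)) ^ 7 \<le> K"
        unfolding K_def using False t0 by (intro power_mono mult_left_mono) auto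
      then have lnK: "ln (real N) \<le> K"
        using lnN by linarith
      then have "ln (real N) powr (1 / 7) \<le> 2 ^ 8 * 24"
        unfolding K_def by (intro root) auto
      then have "c * ln (real N) powr (1 / 7) \<le> c * (2 ^ 8 * 24)"
        using c by (intro mult_left_mono) auto
      also have "\<dots> = exp (- K)"
        by (simp add: c_def)
      also have "\<dots> \<le> exp (- ln (real N))"
        using lnK by simp
      also have "\<dots> = 1 / real N"
        using N by (simp add: exp_minus inverse_eq_divide)
      \<comment> \<open>The proper inclusion enters here: \<open>card A \<le> N - 1\<close> keeps
        \<open>t\<close> at least \<open>1 / N\<close>.\<close>
      also have "\<dots> \<le> t"
      proof -
        have "exp (- t) = card A / real N"
          using cA N by simp
        also have "\<dots> \<le> (real N - 1) / real N"
          using cardA(2) by (intro divide_right_mono) auto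
        also have "\<dots> = 1 - 1 / real N"
          using N by (simp add: diff_divide_distrib)
        finally show ?thesis
          using exp_ge_add_one_self[of "- t"] by linarith
      qed
      finally show ?thesis .
    qed
    then have "real N * exp (- t) \<le> real N * exp (- (c * ln (real N) powr (1 / 7)))"
      by (intro mult_left_mono) auto
    then show ?thesis
      by (simp only: cA divide_inverse exp_minus[symmetric])
  qed simp
  then show ?thesis
    using c by blast
qed

end
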